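(* Let $\Phi:\mathcal{L}(\mathcal{H})\to\mathcal{L}(\mathcal{K})$ be a quantum channel whose operator system $S_\Phi\subseteq\mathcal{L}(\mathcal{H})$ is a unital $*$-subalgebra of $\mathcal{L}(\mathcal{H})$. Then $\Phi$ has a dominating transmittable algebra $\mathscr{A}_{\mathrm{dom}}(\Phi)$, and $\mathscr{A}_{\mathrm{dom}}(\Phi)\cong S_\Phi'$, where $S_\Phi'$ is the commutant of $S_\Phi$ in $\mathcal{L}(\mathcal{H})$.
   Context: All Hilbert spaces are finite-dimensional and complex; all $C^*$-algebras are finite-dimensional and nonzero. $\mathcal{L}(\mathcal{H})$ is the algebra of linear operators on $\mathcal{H}$. A quantum channel is a linear, completely positive, trace-preserving map $\Phi:\mathcal{L}(\mathcal{H})\to\mathcal{L}(\mathcal{K})$; its adjoint $\Phi^*$ is defined by $\mathrm{Tr}(Y\Phi(X))=\mathrm{Tr}(\Phi^*(Y)X)$. For a Kraus representation $\Phi(X)=\sum_{i=1}^nK_iXK_i^*$, the operator system of $\Phi$ is $S_\Phi=\mathrm{span}\{K_i^*K_j:1\le i,j\le n\}\subseteq\mathcal{L}(\mathcal{H})$ (independent of the chosen Kraus representation). $\cong$ denotes $*$-isomorphism. Embedding: $\mathscr{A}\leq\mathscr{B}$ means there is an injective (not necessarily unital) $*$-homomorphism $\mathscr{A}\to\mathscr{B}$. Correctability: a $*$-subalgebra $\mathscr{A}\subseteq\mathcal{L}(\mathcal{H})$ with unit projection $P$ (possibly $P\neq 1_{\mathcal{H}}$) is correctable for $\Phi$ if,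 with $C=P\mathcal{H}$, $V:C\to\mathcal{H}$ the inclusion and $\Phi|_C(Y)=\Phi(VYV^* )$, there is a channel $\mathcal{D}:\mathcal{L}(\mathcal{K})\to\mathcal{L}(C)$ with $(\mathcal{D}\circ\Phi|_C)^*(X)=X$ for all $X\in V^*\mathscr{A}V$. $\mathscr{A}$ is transmittable via $\Phi$ if there is an injective $*$-homomorphism $\pi:\mathscr{A}\to\mathcal{L}(\mathcal{H})$ whose image is correctable for $\Phi$; $\mathscr{T}(\Phi)$ is the set of transmittable algebras up to $*$-isomorphism. A dominating transmittable algebra $\mathscr{A}_{\mathrm{dom}}(\Phi)$ is an element of $\mathscr{T}(\Phi)$ into which every element of $\mathscr{T}(\Phi)$ embeds. *)

theory Defs
  imports "Jordan_Normal_Form.Schur_Decomposition" "Jordan_Normal_Form.VS_Connect"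
begin

text \<open>
  Hilbert spaces are coordinatised: \<open>H = \<complex>\<^sup>n\<close>, \<open>K = \<complex>\<^sup>m\<close>, so \<open>L(H)\<close> is \<open>carrier_mat n n\<close>.
  Maps between operator algebras are functions on \<open>complex mat\<close>; only their values on the
  respective carrier matter.
\<close>

record 'a star_algebra = "(complex, 'a) module" +
  star :: "'a \<Rightarrow> 'a"

text \<open>Not assumed commutative. Every finite-dimensional C*-algebra is unital, so a unit is part of
  the structure; homomorphisms need not preserve it.\<close>

locale star_algebra = Module.module class_ring A + ring A for A :: "'a star_algebra" (structure) +
  assumes smult_mult_left: "\<lbrakk>x \<in> carrier A; y \<in> carrier A\<rbrakk> \<Longrightarrow> (c \<odot> x) \<otimes> y = c \<odot> (x \<otimes> y)"
    and smult_mult_right: "\<lbrakk>x \<in> carrier A; y \<in> carrier A\<rbrakk> \<Longrightarrow> x \<otimes> (c \<odot> y) = c \<odot> (x \<otimes> y)"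
    and star_closed: "x \<in> carrier A \<Longrightarrow> star A x \<in> carrier A"
    and star_star: "x \<in> carrier A \<Longrightarrow> star A (star A x) = x"
    and star_add: "\<lbrakk>x \<in> carrier A; y \<in> carrier A\<rbrakk> \<Longrightarrow> star A (x \<oplus> y) = star A x \<oplus> star A y"
    and star_smult: "x \<in> carrier A \<Longrightarrow> star A (c \<odot> x) = cnj c \<odot> star A x"
    and star_mult: "\<lbrakk>x \<in> carrier A; y \<in> carrier A\<rbrakk> \<Longrightarrow> star A (x \<otimes> y) = star A y \<otimes> star A x"

definition cstar_norm :: "'a star_algebra \<Rightarrow> ('a \<Rightarrow> real) \<Rightarrow> bool" where
  "cstar_norm A N \<longleftrightarrow>
     (\<forall>x\<in>carrier A. 0 \<le> N x \<and> (N x = 0 \<longleftrightarrow> x = \<zero>\<^bsub>A\<^esub>)) \<and>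
     (\<forall>c. \<forall>x\<in>carrier A. N (c \<odot>\<^bsub>A\<^esub> x) = cmod c * N x) \<and>
     (\<forall>x\<in>carrier A. \<forall>y\<in>carrier A. N (x \<oplus>\<^bsub>A\<^esub> y) \<le> N x + N y) \<and>
     (\<forall>x\<in>carrier A. \<forall>y\<in>carrier A. N (x \<otimes>\<^bsub>A\<^esub> y) \<le> N x * N y) \<and>
     (\<forall>x\<in>carrier A. N (star A x \<otimes>\<^bsub>A\<^esub> x) = (N x)\<^sup>2)"

text \<open>The C*-norm of a C*-algebra is unique, and completeness is automatic in finite dimension.\<close>

definition fd_cstar_algebra :: "'a star_algebra \<Rightarrow> bool" where
  "fd_cstar_algebra A \<longleftrightarrow>
     star_algebra A \<and> vectorspace.fin_dim class_ring A \<and> carrier A \<noteq> {\<zero>\<^bsub>A\<^esub>} \<and>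
     (\<exists>N. cstar_norm A N)"

definition star_hom :: "'a star_algebra \<Rightarrow> 'b star_algebra \<Rightarrow> ('a \<Rightarrow> 'b) set" where
  "star_hom A B = {f \<in> LinearCombinations.module_hom class_ring A B \<inter> hom A B.
     \<forall>x\<in>carrier A. f (star A x) = star B (f x)}"

definition star_embeds :: "'a star_algebra \<Rightarrow> 'b star_algebra \<Rightarrow> bool" where
  "star_embeds A B \<longleftrightarrow> (\<exists>f\<in>star_hom A B. inj_on f (carrier A))"

definition star_isomorphic :: "'a star_algebra \<Rightarrow> 'b star_algebra \<Rightarrow> bool" where
  "star_isomorphic A B \<longleftrightarrow> (\<exists>f\<in>star_hom A B. bij_betw f (carrier A) (carrier B))"

definition op_algebra :: "nat \<Rightarrow> complex mat star_algebra" where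
  "op_algebra n = \<lparr>carrier = carrier_mat n n, monoid.mult = (*), one = 1\<^sub>m n, zero = 0\<^sub>m n n,
     add = (+), module.smult = (\<cdot>\<^sub>m), star = mat_adjoint\<rparr>"

definition star_subalgebra :: "nat \<Rightarrow> complex mat set \<Rightarrow> bool" where
  "star_subalgebra n A \<longleftrightarrow>
     LinearCombinations.submodule class_ring A (op_algebra n) \<and>
     (\<forall>X\<in>A. \<forall>Y\<in>A. X * Y \<in> A) \<and> (\<forall>X\<in>A. mat_adjoint X \<in> A)"

definition unital_star_subalgebra :: "nat \<Rightarrow> complex mat set \<Rightarrow> bool" where
  "unital_star_subalgebra n A \<longleftrightarrow> star_subalgebra n A \<and> 1\<^sub>m n \<in> A"

definition commutant :: "nat \<Rightarrow> complex mat set \<Rightarrow> complex mat set" where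
  "commutant n S = {X \<in> carrier_mat n n. \<forall>Y\<in>S. X * Y = Y * X}"

definition commutant_algebra :: "nat \<Rightarrow> complex mat set \<Rightarrow> complex mat star_algebra" where
  "commutant_algebra n S = (op_algebra n)\<lparr>carrier := commutant n S\<rparr>"

definition mat_trace :: "complex mat \<Rightarrow> complex" where
  "mat_trace X = (\<Sum>i<dim_row X. X $$ (i, i))"

definition positive_op :: "nat \<Rightarrow> complex mat \<Rightarrow> bool" where
  "positive_op n X \<longleftrightarrow> X \<in> carrier_mat n n \<and> (\<forall>v\<in>carrier_vec n. 0 \<le> (X *\<^sub>v v) \<bullet>c v)"

text \<open>\<open>ampliation k n m \<Phi>\<close> is \<open>id \<otimes> \<Phi>\<close> on \<open>k \<times> k\<close> block matrices with blocks of size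
  \<open>n \<times> n\<close>: it applies \<open>\<Phi>\<close> to each block.\<close>

definition mat_block :: "nat \<Rightarrow> complex mat \<Rightarrow> nat \<Rightarrow> nat \<Rightarrow> complex mat" where
  "mat_block n X a b = mat n n (\<lambda>(i, j). X $$ (a * n + i, b * n + j))"

definition ampliation ::
  "nat \<Rightarrow> nat \<Rightarrow> nat \<Rightarrow> (complex mat \<Rightarrow> complex mat) \<Rightarrow> complex mat \<Rightarrow> complex mat" where
  "ampliation k n m \<Phi> X = mat (k * m) (k * m)
     (\<lambda>(i, j). \<Phi> (mat_block n X (i div m) (j div m)) $$ (i mod m, j mod m))"

definition completely_positive ::
  "nat \<Rightarrow> nat \<Rightarrow> (complex mat \<Rightarrow> complex mat) \<Rightarrow> bool" where
  "completely_positive n m \<Phi> \<longleftrightarrow>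
     (\<forall>k X. positive_op (k * n) X \<longrightarrow> positive_op (k * m) (ampliation k n m \<Phi> X))"

definition channel :: "nat \<Rightarrow> nat \<Rightarrow> (complex mat \<Rightarrow> complex mat) \<Rightarrow> bool" where
  "channel n m \<Phi> \<longleftrightarrow>
     \<Phi> \<in> LinearCombinations.module_hom class_ring (op_algebra n) (op_algebra m) \<and>
     completely_positive n m \<Phi> \<and>
     (\<forall>X\<in>carrier_mat n n. mat_trace (\<Phi> X) = mat_trace X)"

definition adjoint_map ::
  "nat \<Rightarrow> nat \<Rightarrow> (complex mat \<Rightarrow> complex mat) \<Rightarrow> complex mat \<Rightarrow> complex mat" where
  "adjoint_map n m \<Phi> Y = (THE Z. Z \<in> carrier_mat n n \<and>
     (\<forall>X\<in>carrier_mat n n. mat_trace (Y * \<Phi> X) = mat_trace (Z * X)))"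

definition kraus_rep ::
  "nat \<Rightarrow> nat \<Rightarrow> (complex mat \<Rightarrow> complex mat) \<Rightarrow> nat \<Rightarrow> (nat \<Rightarrow> complex mat) \<Rightarrow> bool" where
  "kraus_rep n m \<Phi> k K \<longleftrightarrow>
     (\<forall>i<k. K i \<in> carrier_mat m n) \<and>
     (\<forall>X\<in>carrier_mat n n.
        \<Phi> X = (\<Oplus>\<^bsub>op_algebra m\<^esub>i\<in>{..<k}. K i * X * mat_adjoint (K i)))"

definition kraus_span :: "nat \<Rightarrow> nat \<Rightarrow> (nat \<Rightarrow> complex mat) \<Rightarrow> complex mat set" where
  "kraus_span n k K = LinearCombinations.module.span class_ring (op_algebra n)
     {mat_adjoint (K i) * K j | i j. i < k \<and> j < k}"

text \<open>The span does not depend on the Kraus representation, and every channel has one.\<close>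

definition operator_system ::
  "nat \<Rightarrow> nat \<Rightarrow> (complex mat \<Rightarrow> complex mat) \<Rightarrow> complex mat set" where
  "operator_system n m \<Phi> = (SOME S. \<exists>k K. kraus_rep n m \<Phi> k K \<and> S = kraus_span n k K)"

text \<open>The subspace \<open>C = PH\<close> is identified with \<open>\<complex>\<^sup>r\<close>, so its inclusion into \<open>H\<close> becomes an isometry
  \<open>V\<close> with range \<open>PH\<close>, i.e. \<open>V\<^sup>* V = 1\<close> and \<open>V V\<^sup>* = P\<close>. The choice of such a \<open>V\<close> (an orthonormal
  basis of \<open>C\<close>) is immaterial.\<close>

definition compression :: "complex mat \<Rightarrow> (complex mat \<Rightarrow> complex mat) \<Rightarrow> complex mat \<Rightarrow> complex mat"
  where "compression V \<Phi> Y = \<Phi> (V * Y * mat_adjoint V)"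

definition correctable ::
  "nat \<Rightarrow> nat \<Rightarrow> (complex mat \<Rightarrow> complex mat) \<Rightarrow> complex mat set \<Rightarrow> bool" where
  "correctable n m \<Phi> A \<longleftrightarrow>
     star_subalgebra n A \<and>
     (\<exists>P r V D.
        P \<in> A \<and> (\<forall>X\<in>A. P * X = X \<and> X * P = X) \<and>
        V \<in> carrier_mat n r \<and> mat_adjoint V * V = 1\<^sub>m r \<and> V * mat_adjoint V = P \<and>
        channel m r D \<and>
        (\<forall>X\<in>A. adjoint_map r r (D \<circ> compression V \<Phi>) (mat_adjoint V * X * V)
                = mat_adjoint V * X * V))"

definition transmittable ::
  "nat \<Rightarrow> nat \<Rightarrow> (complex mat \<Rightarrow> complex mat) \<Rightarrow> 'a star_algebra \<Rightarrow> bool" where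
  "transmittable n m \<Phi> A \<longleftrightarrow>
     fd_cstar_algebra A \<and>
     (\<exists>\<pi>\<in>star_hom A (op_algebra n). inj_on \<pi> (carrier A) \<and> correctable n m \<Phi> (\<pi> ` carrier A))"

text \<open>The \<open>itself\<close> argument fixes the type over which the dominated algebras range. Up to
  *-isomorphism \<open>complex mat\<close> already covers every transmittable algebra, through its image under
  the embedding into \<open>L(H)\<close>.\<close>

definition dominating_transmittable ::
  "'b itself \<Rightarrow> nat \<Rightarrow> nat \<Rightarrow> (complex mat \<Rightarrow> complex mat) \<Rightarrow> 'a star_algebra \<Rightarrow> bool" where
  "dominating_transmittable TYPE('b) n m \<Phi> A \<longleftrightarrow>
     transmittable n m \<Phi> A \<and>
     (\<forall>B :: 'b star_algebra. transmittable n m \<Phi> B \<longrightarrow> star_embeds B A)"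

end

theory Submission
  imports Defs "HOL-Analysis.L2_Norm"
begin

text \<open>
  Two liftings of the same kind give the two directions. If \<open>X\<close> commutes with all \<open>T\<^sub>i\<^sup>* T\<^sub>j\<close>, then
  there is a unique operator \<open>lift X\<close>, vanishing off the joint range of the \<open>T\<^sub>i\<close>, with
  \<open>lift X T\<^sub>i = T\<^sub>i X\<close>; it equals \<open>R (\<Sum>\<^sub>i T\<^sub>i X T\<^sub>i\<^sup>*) R\<close>, where \<open>R\<close> is the inverse square root of
  \<open>\<Sum>\<^sub>i T\<^sub>i T\<^sub>i\<^sup>*\<close> on its support, and \<open>X \<mapsto> lift X\<close> is a *-homomorphism.

  For \<open>T\<^sub>i = K\<^sub>i\<close> the Kraus operators and \<open>X\<close> in the commutant of \<open>S\<^sub>\<Phi>\<close>, the formula is manifestly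
  completely positive in \<open>X\<close>, hence dual to a channel that corrects the whole commutant. Conversely,
  if an algebra with unit projection \<open>V V\<^sup>*\<close> is correctable, a multiplicative domain argument shows
  that its compression commutes with \<open>V\<^sup>* S\<^sub>\<Phi> V\<close>; as \<open>S\<^sub>\<Phi>\<close> is a *-algebra, lifting along
  \<open>T\<^sub>i\<^sub>j = K\<^sub>i\<^sup>* K\<^sub>j V\<close> embeds the algebra into the commutant of \<open>S\<^sub>\<Phi>\<close>. Any other dominating algebra
  and the commutant embed into each other, so they are isomorphic by dimension.
\<close>

text \<open>The obstacle in the converse direction is that the compressed set
  \<open>V\<^sup>\<dagger> S V\<close> need not be an algebra, and that an operator commuting with
  it has no evident extension to the whole space. Closure of S under products and adjoints answers
  this twice: the products \<open>(Y V)\<^sup>\<dagger> (Z V)\<close> with Y, Z in S stay in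
  \<open>V\<^sup>\<dagger> S V\<close>, so the lift along the operators \<open>Z V\<close> exists;
  and S maps their joint range into itself, so the lift commutes with S. The identity in S puts V
  itself in the span of these operators, hence \<open>lift X * V = V * X\<close>, and X can be
  recovered from its lift. The lift kills the orthogonal complement of the joint range, so the
  resulting embedding is in general not unital. The shape of the formula has a reason as well. The
  sum over the family commutes with the Gram operator, so on the support both factors R may be moved
  to one side, where they invert the Gram operator; this yields the intertwining relation and
  multiplicativity. Placing one R on each side keeps the expression symmetric, which is what
  complete positivity needs.\<close>

notation mat_adjoint ("_\<^sup>\<dagger>" [1000] 1000)

subsection \<open>Adjoints and finite sums of matrices\<close>

lemma adj_eq_mat: "A\<^sup>\<dagger> = mat (dim_col A) (dim_row A) (\<lambda>(i, j). cnj (A $$ (j, i)))"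
  for A :: "complex mat"
  by (rule eq_matI) (auto simp: mat_adjoint_def mat_of_rows_index)

lemma adj_dim [simp]: "dim_row (A\<^sup>\<dagger>) = dim_col A" "dim_col (A\<^sup>\<dagger>) = dim_row A" for A :: "complex mat"
  by (simp_all add: adj_eq_mat)

lemma adj_index [simp]:
  "i < dim_col A \<Longrightarrow> j < dim_row A \<Longrightarrow> A\<^sup>\<dagger> $$ (i, j) = cnj (A $$ (j, i))" for A :: "complex mat"
  by (simp add: adj_eq_mat)

lemma adj_carrier [intro]: "A \<in> carrier_mat n m \<Longrightarrow> A\<^sup>\<dagger> \<in> carrier_mat m n" for A :: "complex mat"
  by (metis adj_dim carrier_matD carrier_matI)

lemma adj_adj [simp]: "A\<^sup>\<dagger>\<^sup>\<dagger> = A" for A :: "complex mat"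
  by (rule eq_matI) auto

lemma adj_mult: "dim_col A = dim_row B \<Longrightarrow> (A * B)\<^sup>\<dagger> = B\<^sup>\<dagger> * A\<^sup>\<dagger>" for A B :: "complex mat"
  by (rule eq_matI) (auto simp: scalar_prod_def mult.commute)

lemma adj_add: "dim_row A = dim_row B \<Longrightarrow> dim_col A = dim_col B \<Longrightarrow> (A + B)\<^sup>\<dagger> = A\<^sup>\<dagger> + B\<^sup>\<dagger>"
  for A B :: "complex mat"
  by (rule eq_matI) auto

lemma adj_minus: "dim_row A = dim_row B \<Longrightarrow> dim_col A = dim_col B \<Longrightarrow> (A - B)\<^sup>\<dagger> = A\<^sup>\<dagger> - B\<^sup>\<dagger>"
  for A B :: "complex mat"
  by (rule eq_matI) auto

lemma adj_smult: "(c \<cdot>\<^sub>m A)\<^sup>\<dagger> = cnj c \<cdot>\<^sub>m A\<^sup>\<dagger>" for A :: "complex mat"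
  by (rule eq_matI) auto

lemma adj_one [simp]: "(1\<^sub>m n)\<^sup>\<dagger> = (1\<^sub>m n :: complex mat)"
  by (rule eq_matI) auto

lemma adj_zero [simp]: "(0\<^sub>m n m)\<^sup>\<dagger> = (0\<^sub>m m n :: complex mat)"
  by (rule eq_matI) auto

text \<open>This and the following laws carry equations between dimensions in place of carrier
  membership. The simplifier discharges such side conditions by the dimension rules, so products can
  be renormalised inside larger terms.\<close>

lemma mat_assoc:
  "dim_col A = dim_row B \<Longrightarrow> dim_col B = dim_row C \<Longrightarrow> A * B * C = A * (B * C)"
  for A :: "'a :: semiring_0 mat"
  by (rule assoc_mult_mat[of _ "dim_row A" "dim_col A" _ "dim_col B" _ "dim_col C"]) auto

lemma mat_one_left: "dim_row A = n \<Longrightarrow> 1\<^sub>m n * A = (A :: complex mat)"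
  by (metis carrier_matI left_mult_one_mat)

lemma mat_one_right: "dim_col A = n \<Longrightarrow> A * 1\<^sub>m n = (A :: complex mat)"
  by (metis carrier_matI right_mult_one_mat)

lemma mat_add_left:
  "dim_row A = dim_row B \<Longrightarrow> dim_col A = dim_col B \<Longrightarrow> dim_col A = dim_row C \<Longrightarrow> (A + B) * C = A * C + B * C"
  for A :: "complex mat"
  by (rule add_mult_distrib_mat[of _ "dim_row A" "dim_col A" _ _ "dim_col C"]) (auto intro!: carrier_matI)

lemma mat_add_right:
  "dim_row B = dim_row C \<Longrightarrow> dim_col B = dim_col C \<Longrightarrow> dim_col A = dim_row B \<Longrightarrow> A * (B + C) = A * B + A * C"
  for A :: "complex mat"
  by (rule mult_add_distrib_mat[of _ "dim_row A" "dim_col A" _ "dim_col B"]) (auto intro!: carrier_matI)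

lemma mat_minus_left:
  "dim_row A = dim_row B \<Longrightarrow> dim_col A = dim_col B \<Longrightarrow> dim_col A = dim_row C \<Longrightarrow> (A - B) * C = A * C - B * C"
  for A :: "complex mat"
  by (rule minus_mult_distrib_mat[of _ "dim_row A" "dim_col A" _ _ "dim_col C"]) (auto intro!: carrier_matI)

lemma mat_minus_right:
  "dim_row B = dim_row C \<Longrightarrow> dim_col B = dim_col C \<Longrightarrow> dim_col A = dim_row B \<Longrightarrow> A * (B - C) = A * B - A * C"
  for A :: "complex mat"
  by (rule mult_minus_distrib_mat[of _ "dim_row A" "dim_col A" _ "dim_col B"]) (auto intro!: carrier_matI)

lemma mat_smult_left: "dim_col A = dim_row B \<Longrightarrow> (c \<cdot>\<^sub>m A) * B = c \<cdot>\<^sub>m (A * B)" for A :: "complex mat"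
  by (rule mult_smult_assoc_mat[of _ "dim_row A" "dim_col A" _ "dim_col B"]) (auto intro!: carrier_matI)

lemma mat_smult_right: "dim_col A = dim_row B \<Longrightarrow> A * (c \<cdot>\<^sub>m B) = c \<cdot>\<^sub>m (A * B)" for A :: "complex mat"
  by (rule mult_smult_distrib[of _ "dim_row A" "dim_col A" _ "dim_col B"]) (auto intro!: carrier_matI)

lemma mat_minus_self: "dim_row A = r \<Longrightarrow> dim_col A = c \<Longrightarrow> A - A = 0\<^sub>m r c" for A :: "complex mat"
  by (intro eq_matI) auto

lemma entry_mult:
  "i < dim_row A \<Longrightarrow> j < dim_col B \<Longrightarrow> dim_col A = dim_row B \<Longrightarrow>
   (A * B) $$ (i, j) = (\<Sum>k<dim_row B. A $$ (i, k) * B $$ (k, j))"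
  by (simp add: scalar_prod_def lessThan_atLeast0)

text \<open>The size is an argument, so that rectangular families are allowed and the empty sum
  still has a definite shape; \<open>finsum\<close> in \<open>op_algebra\<close> covers square
  matrices only.\<close>

definition mat_sum :: "nat \<Rightarrow> nat \<Rightarrow> ('i \<Rightarrow> complex mat) \<Rightarrow> 'i set \<Rightarrow> complex mat" where
  "mat_sum r c f I = mat r c (\<lambda>(i, j). \<Sum>k\<in>I. f k $$ (i, j))"

lemma mat_sum_dim [simp]: "dim_row (mat_sum r c f I) = r" "dim_col (mat_sum r c f I) = c"
  by (simp_all add: mat_sum_def)

lemma mat_sum_carrier [simp, intro]: "mat_sum r c f I \<in> carrier_mat r c"
  by (simp add: mat_sum_def)

lemma mat_sum_index [simp]:
  "i < r \<Longrightarrow> j < c \<Longrightarrow> mat_sum r c f I $$ (i, j) = (\<Sum>k\<in>I. f k $$ (i, j))"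
  by (simp add: mat_sum_def)

lemma mat_sum_cong: "I = J \<Longrightarrow> (\<And>k. k \<in> J \<Longrightarrow> f k = g k) \<Longrightarrow> mat_sum r c f I = mat_sum r c g J"
  by (auto simp: mat_sum_def)

lemma mat_sum_mult_left:
  assumes "dim_col A = r" "\<And>k. k \<in> I \<Longrightarrow> f k \<in> carrier_mat r c"
  shows "A * mat_sum r c f I = mat_sum (dim_row A) c (\<lambda>k. A * f k) I"
proof (rule eq_matI)
  fix i j assume "i < dim_row (mat_sum (dim_row A) c (\<lambda>k. A * f k) I)"
    "j < dim_col (mat_sum (dim_row A) c (\<lambda>k. A * f k) I)"
  then have ij: "i < dim_row A" "j < c" by auto
  have "(A * mat_sum r c f I) $$ (i, j) = (\<Sum>l<r. A $$ (i, l) * (\<Sum>k\<in>I. f k $$ (l, j)))"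
    using ij assms(1) by (subst entry_mult) auto
  also have "\<dots> = (\<Sum>k\<in>I. \<Sum>l<r. A $$ (i, l) * f k $$ (l, j))"
    by (subst sum.swap) (simp add: sum_distrib_left)
  also have "\<dots> = (\<Sum>k\<in>I. (A * f k) $$ (i, j))"
  proof (rule sum.cong[OF refl])
    fix k assume "k \<in> I"
    then have "f k \<in> carrier_mat r c" using assms(2) by auto
    then show "(\<Sum>l<r. A $$ (i, l) * f k $$ (l, j)) = (A * f k) $$ (i, j)"
      using ij assms(1) by (subst entry_mult) auto
  qed
  finally show "(A * mat_sum r c f I) $$ (i, j) = mat_sum (dim_row A) c (\<lambda>k. A * f k) I $$ (i, j)"
    using ij by simp
qed auto

lemma mat_sum_mult_right:
  assumes "dim_row A = c" "\<And>k. k \<in> I \<Longrightarrow> f k \<in> carrier_mat r c"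
  shows "mat_sum r c f I * A = mat_sum r (dim_col A) (\<lambda>k. f k * A) I"
proof (rule eq_matI)
  fix i j assume "i < dim_row (mat_sum r (dim_col A) (\<lambda>k. f k * A) I)"
    "j < dim_col (mat_sum r (dim_col A) (\<lambda>k. f k * A) I)"
  then have ij: "i < r" "j < dim_col A" by auto
  have "(mat_sum r c f I * A) $$ (i, j) = (\<Sum>l<c. (\<Sum>k\<in>I. f k $$ (i, l)) * A $$ (l, j))"
    using ij assms(1) by (subst entry_mult) auto
  also have "\<dots> = (\<Sum>k\<in>I. \<Sum>l<c. f k $$ (i, l) * A $$ (l, j))"
    by (subst sum.swap) (simp add: sum_distrib_right)
  also have "\<dots> = (\<Sum>k\<in>I. (f k * A) $$ (i, j))"
  proof (rule sum.cong[OF refl])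
    fix k assume "k \<in> I"
    then have "f k \<in> carrier_mat r c" using assms(2) by auto
    then show "(\<Sum>l<c. f k $$ (i, l) * A $$ (l, j)) = (f k * A) $$ (i, j)"
      using ij assms(1) by (subst entry_mult) auto
  qed
  finally show "(mat_sum r c f I * A) $$ (i, j) = mat_sum r (dim_col A) (\<lambda>k. f k * A) I $$ (i, j)"
    using ij by simp
qed auto

lemma mat_sum_adj:
  assumes "\<And>k. k \<in> I \<Longrightarrow> f k \<in> carrier_mat r c"
  shows "(mat_sum r c f I)\<^sup>\<dagger> = mat_sum c r (\<lambda>k. (f k)\<^sup>\<dagger>) I"
proof (rule eq_matI)
  fix i j assume "i < dim_row (mat_sum c r (\<lambda>k. (f k)\<^sup>\<dagger>) I)" "j < dim_col (mat_sum c r (\<lambda>k. (f k)\<^sup>\<dagger>) I)"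
  then have ij: "i < c" "j < r" by auto
  have "cnj (f k $$ (j, i)) = (f k)\<^sup>\<dagger> $$ (i, j)" if "k \<in> I" for k
    using assms[OF that] ij by auto
  then show "(mat_sum r c f I)\<^sup>\<dagger> $$ (i, j) = mat_sum c r (\<lambda>k. (f k)\<^sup>\<dagger>) I $$ (i, j)"
    using ij by (simp add: cnj_sum)
qed auto

lemma mat_sum_add:
  assumes "\<And>k. k \<in> I \<Longrightarrow> f k \<in> carrier_mat r c" "\<And>k. k \<in> I \<Longrightarrow> g k \<in> carrier_mat r c"
  shows "mat_sum r c (\<lambda>k. f k + g k) I = mat_sum r c f I + mat_sum r c g I"
proof (rule eq_matI)
  fix i j assume "i < dim_row (mat_sum r c f I + mat_sum r c g I)"
    "j < dim_col (mat_sum r c f I + mat_sum r c g I)"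
  then have ij: "i < r" "j < c" by auto
  have "(f k + g k) $$ (i, j) = f k $$ (i, j) + g k $$ (i, j)" if "k \<in> I" for k
    using assms(1)[OF that] assms(2)[OF that] ij by auto
  then show "mat_sum r c (\<lambda>k. f k + g k) I $$ (i, j) = (mat_sum r c f I + mat_sum r c g I) $$ (i, j)"
    using ij by (simp add: sum.distrib)
qed auto

lemma mat_sum_minus:
  assumes "\<And>k. k \<in> I \<Longrightarrow> f k \<in> carrier_mat r c" "\<And>k. k \<in> I \<Longrightarrow> g k \<in> carrier_mat r c"
  shows "mat_sum r c (\<lambda>k. f k - g k) I = mat_sum r c f I - mat_sum r c g I"
proof (rule eq_matI)
  fix i j assume "i < dim_row (mat_sum r c f I - mat_sum r c g I)"
    "j < dim_col (mat_sum r c f I - mat_sum r c g I)"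
  then have ij: "i < r" "j < c" by auto
  have "(f k - g k) $$ (i, j) = f k $$ (i, j) - g k $$ (i, j)" if "k \<in> I" for k
    using assms(1)[OF that] assms(2)[OF that] ij by auto
  then show "mat_sum r c (\<lambda>k. f k - g k) I $$ (i, j) = (mat_sum r c f I - mat_sum r c g I) $$ (i, j)"
    using ij by (simp add: sum_subtractf)
qed auto

lemma mat_sum_smult:
  assumes "\<And>k. k \<in> I \<Longrightarrow> f k \<in> carrier_mat r c"
  shows "mat_sum r c (\<lambda>k. a \<cdot>\<^sub>m f k) I = a \<cdot>\<^sub>m mat_sum r c f I"
proof (rule eq_matI)
  fix i j assume "i < dim_row (a \<cdot>\<^sub>m mat_sum r c f I)" "j < dim_col (a \<cdot>\<^sub>m mat_sum r c f I)"
  then have ij: "i < r" "j < c" by auto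
  have "(a \<cdot>\<^sub>m f k) $$ (i, j) = a * f k $$ (i, j)" if "k \<in> I" for k
    using assms(1)[OF that] ij by auto
  then show "mat_sum r c (\<lambda>k. a \<cdot>\<^sub>m f k) I $$ (i, j) = (a \<cdot>\<^sub>m mat_sum r c f I) $$ (i, j)"
    using ij by (simp add: sum_distrib_left)
qed auto

lemma mat_sum_Sigma:
  assumes "finite I" "finite J"
  shows "mat_sum r c (\<lambda>i. mat_sum r c (\<lambda>j. f i j) J) I = mat_sum r c (\<lambda>(i, j). f i j) (I \<times> J)"
  by (rule eq_matI) (auto simp: sum.cartesian_product intro!: sum.cong)

lemma mat_sum_swap:
  "mat_sum r c (\<lambda>i. mat_sum r c (\<lambda>j. f i j) J) I = mat_sum r c (\<lambda>j. mat_sum r c (\<lambda>i. f i j) I) J"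
  by (rule eq_matI) (auto intro: sum.swap)

lemma mat_sum_Plus:
  assumes "finite I" "finite J"
  shows "mat_sum r c f (I <+> J) = mat_sum r c (\<lambda>i. f (Inl i)) I + mat_sum r c (\<lambda>j. f (Inr j)) J"
  using assms by (intro eq_matI) (auto simp: sum.Plus)

lemma mat_sum_zero: "(\<And>k. k \<in> I \<Longrightarrow> f k = 0\<^sub>m r c) \<Longrightarrow> mat_sum r c f I = 0\<^sub>m r c"
  by (rule eq_matI) auto

lemma mat_sum_insert:
  assumes "finite I" "k \<notin> I" "f k \<in> carrier_mat r c"
  shows "mat_sum r c f (insert k I) = f k + mat_sum r c f I"
  using assms by (intro eq_matI) auto

section \<open>The trace pairing and matrix units\<close>

lemma mat_trace_mult_comm:
  assumes "A \<in> carrier_mat n m" "B \<in> carrier_mat m n"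
  shows "mat_trace (A * B) = mat_trace (B * A)"
proof -
  have "mat_trace (A * B) = (\<Sum>i<n. \<Sum>k<m. A $$ (i, k) * B $$ (k, i))"
    unfolding mat_trace_def using assms by (intro sum.cong) (auto simp del: index_mult_mat(1) simp: entry_mult)
  also have "\<dots> = (\<Sum>k<m. \<Sum>i<n. B $$ (k, i) * A $$ (i, k))"
    by (subst sum.swap) (simp add: mult.commute)
  also have "\<dots> = mat_trace (B * A)"
    unfolding mat_trace_def using assms by (intro sum.cong) (auto simp del: index_mult_mat(1) simp: entry_mult)
  finally show ?thesis .
qed

lemma mat_trace_sum:
  assumes "\<And>k. k \<in> I \<Longrightarrow> f k \<in> carrier_mat n n"
  shows "mat_trace (mat_sum n n f I) = (\<Sum>k\<in>I. mat_trace (f k))"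
proof -
  have "mat_trace (mat_sum n n f I) = (\<Sum>k\<in>I. \<Sum>i<n. f k $$ (i, i))"
    unfolding mat_trace_def by (simp add: sum.swap[of _ I])
  also have "\<dots> = (\<Sum>k\<in>I. mat_trace (f k))"
    using assms by (intro sum.cong) (auto simp: mat_trace_def)
  finally show ?thesis .
qed

definition mat_unit :: "nat \<Rightarrow> nat \<Rightarrow> nat \<Rightarrow> nat \<Rightarrow> complex mat" where
  "mat_unit n m a b = mat n m (\<lambda>(i, j). if i = a \<and> j = b then 1 else 0)"

lemma mat_unit_dim [simp]: "dim_row (mat_unit n m a b) = n" "dim_col (mat_unit n m a b) = m"
  by (simp_all add: mat_unit_def)

lemma mat_unit_carrier [simp]: "mat_unit n m a b \<in> carrier_mat n m"
  by (simp add: mat_unit_def)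

lemma mat_unit_index [simp]:
  "i < n \<Longrightarrow> j < m \<Longrightarrow> mat_unit n m a b $$ (i, j) = (if i = a \<and> j = b then 1 else 0)"
  by (simp add: mat_unit_def)

lemma mat_trace_mult_unit:
  assumes "Z \<in> carrier_mat n n" "a < n" "b < n"
  shows "mat_trace (Z * mat_unit n n a b) = Z $$ (b, a)"
proof -
  have "(Z * mat_unit n n a b) $$ (i, i) = (if i = b then Z $$ (i, a) else 0)" if "i < n" for i
  proof -
    have "(Z * mat_unit n n a b) $$ (i, i) = (\<Sum>k<n. Z $$ (i, k) * (if k = a \<and> i = b then 1 else 0))"
      using assms that by (subst entry_mult) auto
    also have "\<dots> = (\<Sum>k<n. if k = a then (if i = b then Z $$ (i, a) else 0) else 0)"
      by (intro sum.cong) auto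
    also have "\<dots> = (if i = b then Z $$ (i, a) else 0)"
      using assms by (subst sum.delta) auto
    finally show ?thesis .
  qed
  then have "mat_trace (Z * mat_unit n n a b) = (\<Sum>i<n. if i = b then Z $$ (i, a) else 0)"
    unfolding mat_trace_def using assms by (intro sum.cong) (auto simp del: index_mult_mat(1))
  then show ?thesis using assms by (simp add: sum.delta)
qed

text \<open>Pairing with matrix units reads off every entry. This uniqueness is what gives the
  definite description in \<open>adjoint_map\<close> a determined value.\<close>

lemma mat_trace_nondegenerate:
  assumes "Y \<in> carrier_mat n n" "Z \<in> carrier_mat n n"
    and "\<And>X. X \<in> carrier_mat n n \<Longrightarrow> mat_trace (Y * X) = mat_trace (Z * X)"
  shows "Y = Z"
proof (rule eq_matI)
  fix i j assume "i < dim_row Z" "j < dim_col Z"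
  then show "Y $$ (i, j) = Z $$ (i, j)"
    using assms(3)[OF mat_unit_carrier, of j i] assms(1,2) by (auto simp: mat_trace_mult_unit)
qed (use assms in auto)

text \<open>Each diagonal entry of the sum is a sum of squared moduli over all indices k and a whole
  row of \<open>B k\<close>, so its vanishing kills every term. It serves to show that the family T
  has no component off its support, and later that commutators vanish.\<close>

lemma sum_mult_adj_eq_zeroD:
  assumes "finite I" "\<And>k. k \<in> I \<Longrightarrow> B k \<in> carrier_mat r c"
    and "mat_sum r r (\<lambda>k. B k * (B k)\<^sup>\<dagger>) I = 0\<^sub>m r r" and "k \<in> I"
  shows "B k = 0\<^sub>m r c"
proof (rule eq_matI)
  fix i j assume "i < dim_row (0\<^sub>m r c :: complex mat)" "j < dim_col (0\<^sub>m r c :: complex mat)"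
  then have ij: "i < r" "j < c" by auto
  have "(B k * (B k)\<^sup>\<dagger>) $$ (i, i) = of_real (\<Sum>l<c. (cmod (B k $$ (i, l)))\<^sup>2)" if "k \<in> I" for k
  proof -
    have "(B k * (B k)\<^sup>\<dagger>) $$ (i, i) = (\<Sum>l<c. B k $$ (i, l) * cnj (B k $$ (i, l)))"
      using ij assms(2)[OF that] by (subst entry_mult) auto
    also have "\<dots> = (\<Sum>l<c. of_real ((cmod (B k $$ (i, l)))\<^sup>2))"
      by (simp only: complex_norm_square)
    finally show ?thesis by (simp only: of_real_sum)
  qed
  then have "of_real (\<Sum>k\<in>I. \<Sum>l<c. (cmod (B k $$ (i, l)))\<^sup>2) = (\<Sum>k\<in>I. (B k * (B k)\<^sup>\<dagger>) $$ (i, i))"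
    by simp
  also have "\<dots> = mat_sum r r (\<lambda>k. B k * (B k)\<^sup>\<dagger>) I $$ (i, i)" using ij by simp
  also have "\<dots> = 0" unfolding assms(3) using ij by simp
  finally have "(\<Sum>k\<in>I. \<Sum>l<c. (cmod (B k $$ (i, l)))\<^sup>2) = 0"
    using of_real_eq_0_iff by blast
  then have "(\<Sum>l<c. (cmod (B k $$ (i, l)))\<^sup>2) = 0"
    using assms(1,4) by (subst (asm) sum_nonneg_eq_0_iff) (auto intro: sum_nonneg)
  then have "(cmod (B k $$ (i, j)))\<^sup>2 = 0"
    using ij by (subst (asm) sum_nonneg_eq_0_iff) auto
  then show "B k $$ (i, j) = (0\<^sub>m r c :: complex mat) $$ (i, j)" using ij by simp
qed (use assms in auto)

subsection \<open>Positive matrices and the spectral theorem\<close>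

lemma cscalar_prod_sum: "dim_vec w = n \<Longrightarrow> v \<bullet>c w = (\<Sum>i<n. v $ i * cnj (w $ i))" for v w :: "complex vec"
  by (auto simp: scalar_prod_def lessThan_atLeast0)

lemma mat_vec_assoc:
  "dim_col A = dim_row B \<Longrightarrow> dim_col B = dim_vec v \<Longrightarrow> A * B *\<^sub>v v = A *\<^sub>v (B *\<^sub>v v)"
  for A :: "complex mat"
  by (rule assoc_mult_mat_vec[of _ "dim_row A" "dim_col A" _ "dim_col B"]) auto

lemma mult_vec_index:
  fixes A :: "complex mat"
  shows
  "i < dim_row A \<Longrightarrow> dim_col A = dim_vec v \<Longrightarrow> (A *\<^sub>v v) $ i = (\<Sum>j<dim_vec v. A $$ (i, j) * v $ j)"
  by (auto simp: scalar_prod_def lessThan_atLeast0)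

lemma adj_cscalar_prod:
  fixes A :: "complex mat"
  assumes "A \<in> carrier_mat n m" "v \<in> carrier_vec n" "w \<in> carrier_vec m"
  shows "(A\<^sup>\<dagger> *\<^sub>v v) \<bullet>c w = v \<bullet>c (A *\<^sub>v w)"
proof -
  have "(A\<^sup>\<dagger> *\<^sub>v v) \<bullet>c w = (\<Sum>i<m. (\<Sum>k<n. cnj (A $$ (k, i)) * v $ k) * cnj (w $ i))"
    using assms by (auto simp: cscalar_prod_sum mult_vec_index simp del: index_mult_mat_vec intro!: sum.cong)
  also have "\<dots> = (\<Sum>k<n. v $ k * (\<Sum>i<m. cnj (A $$ (k, i)) * cnj (w $ i)))"
    by (simp add: sum_distrib_left sum_distrib_right sum.swap[of _ "{..<m}"] mult_ac)
  also have "\<dots> = v \<bullet>c (A *\<^sub>v w)"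
    using assms by (auto simp: cscalar_prod_sum mult_vec_index simp del: index_mult_mat_vec intro!: sum.cong)
  finally show ?thesis .
qed

lemma quadratic_form_sum:
  assumes "X \<in> carrier_mat n n" "v \<in> carrier_vec n"
  shows "(X *\<^sub>v v) \<bullet>c v = (\<Sum>i<n. \<Sum>j<n. X $$ (i, j) * v $ j * cnj (v $ i))"
  using assms
  by (auto simp: cscalar_prod_sum mult_vec_index sum_distrib_right simp del: index_mult_mat_vec intro!: sum.cong)

lemma positive_op_one: "positive_op n (1\<^sub>m n)"
  unfolding positive_op_def by (auto simp: conjugate_square_positive)

lemma positive_op_congruence:
  assumes "positive_op n X" "B \<in> carrier_mat m n"
  shows "positive_op m (B * X * B\<^sup>\<dagger>)"
  unfolding positive_op_def
proof (intro conjI ballI)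
  have X: "X \<in> carrier_mat n n" using assms by (simp add: positive_op_def)
  show "B * X * B\<^sup>\<dagger> \<in> carrier_mat m m" using assms(2) X by auto
  fix v :: "complex vec" assume v: "v \<in> carrier_vec m"
  have Bv: "B\<^sup>\<dagger> *\<^sub>v v \<in> carrier_vec n" using assms(2) v by (metis adj_carrier mult_mat_vec_carrier)
  have "(B * X * B\<^sup>\<dagger> *\<^sub>v v) = B *\<^sub>v (X *\<^sub>v (B\<^sup>\<dagger> *\<^sub>v v))"
    using assms(2) X v by (simp add: mat_vec_assoc)
  then have "(B * X * B\<^sup>\<dagger> *\<^sub>v v) \<bullet>c v = (X *\<^sub>v (B\<^sup>\<dagger> *\<^sub>v v)) \<bullet>c (B\<^sup>\<dagger> *\<^sub>v v)"
    using adj_cscalar_prod[OF adj_carrier[OF assms(2)], of "X *\<^sub>v (B\<^sup>\<dagger> *\<^sub>v v)" v] X Bv v by simp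
  also have "\<dots> \<ge> 0" using assms(1) Bv by (simp add: positive_op_def)
  finally show "0 \<le> (B * X * B\<^sup>\<dagger> *\<^sub>v v) \<bullet>c v" .
qed

lemma positive_op_sum:
  assumes "\<And>k. k \<in> I \<Longrightarrow> positive_op n (f k)"
  shows "positive_op n (mat_sum n n f I)"
  unfolding positive_op_def
proof (intro conjI ballI)
  fix v :: "complex vec" assume v: "v \<in> carrier_vec n"
  have "(mat_sum n n f I *\<^sub>v v) \<bullet>c v = (\<Sum>i<n. \<Sum>j<n. \<Sum>k\<in>I. f k $$ (i, j) * v $ j * cnj (v $ i))"
    using v by (subst quadratic_form_sum[OF _ v]) (auto simp: sum_distrib_right intro!: sum.cong)
  also have "\<dots> = (\<Sum>k\<in>I. \<Sum>i<n. \<Sum>j<n. f k $$ (i, j) * v $ j * cnj (v $ i))"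
    by (simp add: sum.swap[of _ I])
  also have "\<dots> = (\<Sum>k\<in>I. (f k *\<^sub>v v) \<bullet>c v)"
    using assms v by (intro sum.cong refl quadratic_form_sum[symmetric]) (auto simp: positive_op_def)
  also have "\<dots> \<ge> 0" using assms v by (intro sum_nonneg) (auto simp: positive_op_def)
  finally show "0 \<le> (mat_sum n n f I *\<^sub>v v) \<bullet>c v" .
qed auto

text \<open>Positivity asks only for \<open>0 \<le>\<close> of the quadratic form, but in the order
  on the complex numbers this includes that the value is real; a real quadratic form over the
  complex field forces hermiticity by polarisation.\<close>

lemma positive_op_hermitian:
  assumes "positive_op n X"
  shows "X\<^sup>\<dagger> = X"
proof -
  have X: "X \<in> carrier_mat n n" using assms by (simp add: positive_op_def)
  have "cnj (X $$ (j, i)) = X $$ (i, j)" if ij: "i < n" "j < n" for i j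
  proof -
    have form: "X $$ (i, i) + c * X $$ (i, j) + cnj c * (X $$ (j, i) + c * X $$ (j, j)) \<ge> 0" for c
    proof -
      \<comment> \<open>The test vector is \<open>e_i + c e_j\<close>; for i = j its entry at i is 1
        + c, and the formula below remains valid.\<close>
      define v where "v = vec n (\<lambda>k. (if k = i then 1 else 0) + (if k = j then c else 0))"
      have vc: "v \<in> carrier_vec n" by (simp add: v_def)
      have "(\<Sum>k<n. X $$ (l, k) * v $ k) = X $$ (l, i) + c * X $$ (l, j)" for l
      proof -
        have "(\<Sum>k<n. X $$ (l, k) * v $ k)
            = (\<Sum>k<n. (if k = i then X $$ (l, i) else 0) + (if k = j then c * X $$ (l, j) else 0))"
          by (intro sum.cong) (auto simp: v_def algebra_simps)
        then show ?thesis using ij by (simp add: sum.distrib sum.delta)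
      qed
      then have "(X *\<^sub>v v) \<bullet>c v = (\<Sum>l<n. (X $$ (l, i) + c * X $$ (l, j)) * cnj (v $ l))"
        using X vc by (simp add: quadratic_form_sum[where n = n] flip: sum_distrib_right)
      also have "\<dots> = (\<Sum>l<n. (if l = i then X $$ (i, i) + c * X $$ (i, j) else 0)
            + (if l = j then cnj c * (X $$ (j, i) + c * X $$ (j, j)) else 0))"
        by (intro sum.cong) (auto simp: v_def algebra_simps)
      also have "\<dots> = X $$ (i, i) + c * X $$ (i, j) + cnj c * (X $$ (j, i) + c * X $$ (j, j))"
        using ij by (simp add: sum.distrib sum.delta)
      finally show ?thesis using assms vc unfolding positive_op_def by metis
    qed
    \<comment> \<open>The values 1 and -1 of c together give that
      \<open>X $$ (i, j) + X $$ (j, i)\<close> is real; c = 0 and these two give real diagonal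
      entries; then c = \<open>\<i>\<close> gives equal real parts of the two off-diagonal
      entries.\<close>
    have "Im (X $$ (i, i) + X $$ (i, j) + (X $$ (j, i) + X $$ (j, j))) = 0"
      using form[of 1] by (auto simp: less_eq_complex_def)
    moreover have "Im (X $$ (i, i) + \<i> * X $$ (i, j) + (- \<i> * X $$ (j, i) + X $$ (j, j))) = 0"
      using form[of \<i>] by (auto simp: less_eq_complex_def algebra_simps)
    moreover have "Im (X $$ (i, i)) = 0"
      using form[of 0] by (auto simp: less_eq_complex_def)
    moreover have "Im (X $$ (i, i) - X $$ (i, j) - (X $$ (j, i) - X $$ (j, j))) = 0"
      using form[of "-1"] by (auto simp: less_eq_complex_def)
    ultimately show ?thesis by (auto simp: complex_eq_iff)
  qed
  then show ?thesis using X by (intro eq_matI) auto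
qed

lemma positive_op_diag_nonneg:
  assumes "positive_op n X" "i < n"
  shows "0 \<le> X $$ (i, i)"
proof -
  have X: "X \<in> carrier_mat n n" using assms by (simp add: positive_op_def)
  have "(X *\<^sub>v unit_vec n i) \<bullet>c unit_vec n i
      = (\<Sum>k<n. \<Sum>l<n. if l = i then if k = i then X $$ (i, i) else 0 else 0)"
    unfolding quadratic_form_sum[OF X unit_vec_carrier] by (intro sum.cong refl) (auto simp: unit_vec_def)
  also have "\<dots> = X $$ (i, i)" using assms(2) by (simp add: sum.delta)
  finally show ?thesis using assms(1) unfolding positive_op_def by (metis unit_vec_carrier)
qed

section \<open>Diagonal matrices and unitary diagonalisation\<close>

definition diag_of :: "nat \<Rightarrow> (nat \<Rightarrow> complex) \<Rightarrow> complex mat" where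
  "diag_of n d = mat n n (\<lambda>(i, j). if i = j then d i else 0)"

lemma diag_of_dim [simp]: "dim_row (diag_of n d) = n" "dim_col (diag_of n d) = n"
  by (simp_all add: diag_of_def)

lemma diag_of_carrier [simp]: "diag_of n d \<in> carrier_mat n n"
  by (simp add: diag_of_def)

lemma diag_of_index [simp]: "i < n \<Longrightarrow> j < n \<Longrightarrow> diag_of n d $$ (i, j) = (if i = j then d i else 0)"
  by (simp add: diag_of_def)

lemma mult_diag_of_right_index:
  assumes "A \<in> carrier_mat m n" "i < m" "j < n"
  shows "(A * diag_of n d) $$ (i, j) = A $$ (i, j) * d j"
proof -
  have "(A * diag_of n d) $$ (i, j) = (\<Sum>k<n. A $$ (i, k) * diag_of n d $$ (k, j))"
    using assms by (subst entry_mult) auto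
  also have "\<dots> = (\<Sum>k<n. if k = j then A $$ (i, j) * d j else 0)"
    using assms by (intro sum.cong refl) auto
  finally show ?thesis using assms by (simp add: sum.delta)
qed

lemma mult_diag_of_left_index:
  assumes "A \<in> carrier_mat n m" "i < n" "j < m"
  shows "(diag_of n d * A) $$ (i, j) = d i * A $$ (i, j)"
proof -
  have "(diag_of n d * A) $$ (i, j) = (\<Sum>k<n. diag_of n d $$ (i, k) * A $$ (k, j))"
    using assms by (subst entry_mult) auto
  also have "\<dots> = (\<Sum>k<n. if k = i then d i * A $$ (i, j) else 0)"
    using assms by (intro sum.cong refl) auto
  finally show ?thesis using assms by (simp add: sum.delta)
qed

lemma diag_of_mult: "diag_of n a * diag_of n b = diag_of n (\<lambda>i. a i * b i)"
  by (rule eq_matI) (auto simp: mult_diag_of_left_index[OF diag_of_carrier] simp del: index_mult_mat(1))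

lemma diag_of_adj: "(diag_of n a)\<^sup>\<dagger> = diag_of n (\<lambda>i. cnj (a i))"
  by (rule eq_matI) auto

text \<open>The direct sum of the scalar c and X. The scalar sits at index 0, so induction on the
  dimension splits off the first coordinate and shifts the others by \<open>Suc\<close>.\<close>

definition corner_ext :: "complex \<Rightarrow> complex mat \<Rightarrow> complex mat" where
  "corner_ext c X = mat (Suc (dim_row X)) (Suc (dim_col X))
     (\<lambda>(i, j). case (i, j) of (0, 0) \<Rightarrow> c | (Suc i, Suc j) \<Rightarrow> X $$ (i, j) | _ \<Rightarrow> 0)"

lemma corner_ext_dim [simp]: "dim_row (corner_ext c X) = Suc (dim_row X)" "dim_col (corner_ext c X) = Suc (dim_col X)"
  by (simp_all add: corner_ext_def)

lemma corner_ext_index [simp]: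
  "corner_ext c X $$ (0, 0) = c"
  "j < dim_col X \<Longrightarrow> corner_ext c X $$ (0, Suc j) = 0"
  "i < dim_row X \<Longrightarrow> corner_ext c X $$ (Suc i, 0) = 0"
  "i < dim_row X \<Longrightarrow> j < dim_col X \<Longrightarrow> corner_ext c X $$ (Suc i, Suc j) = X $$ (i, j)"
  by (simp_all add: corner_ext_def)

lemma corner_ext_mult:
  assumes "dim_col X = dim_row Y"
  shows "corner_ext a X * corner_ext b Y = corner_ext (a * b) (X * Y)"
proof (rule eq_matI)
  fix i j assume "i < dim_row (corner_ext (a * b) (X * Y))" "j < dim_col (corner_ext (a * b) (X * Y))"
  then show "(corner_ext a X * corner_ext b Y) $$ (i, j) = corner_ext (a * b) (X * Y) $$ (i, j)"
    using assms
    by (cases i; cases j)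
      (auto simp: entry_mult sum.lessThan_Suc_shift simp del: index_mult_mat(1) sum.lessThan_Suc)
qed auto

lemma corner_ext_adj: "(corner_ext c X)\<^sup>\<dagger> = corner_ext (cnj c) (X\<^sup>\<dagger>)"
proof (rule eq_matI)
  fix i j assume "i < dim_row (corner_ext (cnj c) (X\<^sup>\<dagger>))" "j < dim_col (corner_ext (cnj c) (X\<^sup>\<dagger>))"
  then show "(corner_ext c X)\<^sup>\<dagger> $$ (i, j) = corner_ext (cnj c) (X\<^sup>\<dagger>) $$ (i, j)"
    by (cases i; cases j) auto
qed auto

lemma corner_ext_one: "corner_ext 1 (1\<^sub>m n) = 1\<^sub>m (Suc n)"
proof (rule eq_matI)
  fix i j assume "i < dim_row (1\<^sub>m (Suc n) :: complex mat)" "j < dim_col (1\<^sub>m (Suc n) :: complex mat)"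
  then show "corner_ext 1 (1\<^sub>m n) $$ (i, j) = 1\<^sub>m (Suc n) $$ (i, j)"
    by (cases i; cases j) auto
qed auto

lemma corner_ext_diag_of: "corner_ext c (diag_of n d) = diag_of (Suc n) (case_nat c d)"
proof (rule eq_matI)
  fix i j assume "i < dim_row (diag_of (Suc n) (case_nat c d))" "j < dim_col (diag_of (Suc n) (case_nat c d))"
  then show "corner_ext c (diag_of n d) $$ (i, j) = diag_of (Suc n) (case_nat c d) $$ (i, j)"
    by (cases i; cases j) auto
qed auto

text \<open>Complete v to a basis and orthogonalise it; Gram-Schmidt keeps the first vector. The
  result is orthogonal but not normalised, so column j is divided by its length \<open>s j\<close>,
  and c is the inverse of the length of v.\<close>

lemma unitary_with_first_column:
  fixes v :: "complex vec"
  assumes v: "v \<in> carrier_vec n" and v0: "v \<noteq> 0\<^sub>v n"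
  obtains U c where "U \<in> carrier_mat n n" "U\<^sup>\<dagger> * U = 1\<^sub>m n" "U * U\<^sup>\<dagger> = 1\<^sub>m n" "col U 0 = c \<cdot>\<^sub>v v"
proof -
  interpret cof_vec_space n "TYPE(complex)" .
  have n: "0 < n" using v v0 by (cases n) auto
  define b where "b = basis_completion v"
  define ws where "ws = gram_schmidt n b"
  from basis_completion[OF v v0, folded b_def]
  have b: "distinct b" "\<not> lin_dep (set b)" "set b \<subseteq> carrier_vec n" "hd b = v" "length b = n" by auto
  with n obtain vs where bv: "b = v # vs" by (cases b) auto
  from gram_schmidt_result[OF b(3,1,2) refl, folded ws_def] b(5)
  have ws: "set ws \<subseteq> carrier_vec n" "corthogonal ws" "length ws = n" by auto
  have hd: "ws ! 0 = v"
    using gram_schmidt_hd[OF v, of vs] ws(3) n by (metis hd_conv_nth list.size(3) ws_def bv less_irrefl)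
  have ws_carrier: "ws ! j \<in> carrier_vec n" if "j < n" for j using ws that by auto
  define s where "s j = complex_of_real (sqrt (Re (ws ! j \<bullet>c ws ! j)))" for j
  have s: "s j * s j = ws ! j \<bullet>c ws ! j" "s j \<noteq> 0" "cnj (s j) = s j" if "j < n" for j
  proof -
    have "ws ! j \<bullet>c ws ! j \<ge> 0" by (rule conjugate_square_ge_0_vec)
    then have re: "ws ! j \<bullet>c ws ! j = complex_of_real (Re (ws ! j \<bullet>c ws ! j))" "Re (ws ! j \<bullet>c ws ! j) \<ge> 0"
      by (auto simp: less_eq_complex_def complex_eq_iff)
    show "s j * s j = ws ! j \<bullet>c ws ! j"
      unfolding s_def of_real_mult[symmetric] using re by (metis real_sqrt_mult_self abs_of_nonneg)
    then show "s j \<noteq> 0" using corthogonalD[OF ws(2), of j j] ws(3) that by auto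
  qed (simp add: s_def)
  define U where "U = mat n n (\<lambda>(i, j). ws ! j $ i / s j)"
  have U: "U \<in> carrier_mat n n" by (simp add: U_def)
  have UU: "U\<^sup>\<dagger> * U = 1\<^sub>m n"
  proof (rule eq_matI)
    fix i j assume "i < dim_row (1\<^sub>m n :: complex mat)" "j < dim_col (1\<^sub>m n :: complex mat)"
    then have ij: "i < n" "j < n" by auto
    have "(U\<^sup>\<dagger> * U) $$ (i, j) = (\<Sum>k<n. cnj (ws ! i $ k / s i) * (ws ! j $ k / s j))"
      using ij by (subst entry_mult) (auto simp: U_def)
    also have "\<dots> = (ws ! j \<bullet>c ws ! i) / (s i * s j)"
      using ws_carrier[OF ij(1)] s(3)[OF ij(1)]
      by (subst cscalar_prod_sum[where n = n]) (auto simp: sum_divide_distrib mult.commute)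
    also have "\<dots> = (if i = j then 1 else 0)"
      using s[OF ij(1)] corthogonalD[OF ws(2), of j i] ws(3) ij by auto
    finally show "(U\<^sup>\<dagger> * U) $$ (i, j) = 1\<^sub>m n $$ (i, j)" using ij by simp
  qed (use U in auto)
  have "U * U\<^sup>\<dagger> = 1\<^sub>m n" using mat_mult_left_right_inverse[OF adj_carrier[OF U] U UU] .
  moreover have "col U 0 = (1 / s 0) \<cdot>\<^sub>v v"
    using n v hd by (intro eq_vecI) (auto simp: U_def)
  ultimately show ?thesis using that U UU by blast
qed

text \<open>Induction on the dimension: conjugating by a unitary whose first column is an
  eigenvector turns A into the direct sum of the eigenvalue and a smaller hermitian matrix.\<close>

theorem hermitian_diagonalization:
  assumes "A \<in> carrier_mat n n" "A\<^sup>\<dagger> = A"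
  shows "\<exists>U d. U \<in> carrier_mat n n \<and> U\<^sup>\<dagger> * U = 1\<^sub>m n \<and> U * U\<^sup>\<dagger> = 1\<^sub>m n \<and> A = U * diag_of n d * U\<^sup>\<dagger>"
  using assms
proof (induction n arbitrary: A)
  case 0
  then show ?case by (intro exI[of _ "1\<^sub>m 0"]) (auto intro!: eq_matI)
next
  case (Suc n A)
  note A = Suc.prems(1)
  obtain as where as: "char_poly A = (\<Prod>a\<leftarrow>as. [:- a, 1:])" "length as = Suc n"
    using char_poly_factorized[OF A] by auto
  then obtain e es where "as = e # es" by (cases as) auto
  then have "eigenvalue A e" using eigenvalue_root_char_poly[OF A] as by simp
  then obtain v where "eigenvector A v e" by (auto simp: eigenvalue_def)
  then have v: "v \<in> carrier_vec (Suc n)" "v \<noteq> 0\<^sub>v (Suc n)" "A *\<^sub>v v = e \<cdot>\<^sub>v v"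
    using A by (auto simp: eigenvector_def)
  obtain U c where U: "U \<in> carrier_mat (Suc n) (Suc n)" "U\<^sup>\<dagger> * U = 1\<^sub>m (Suc n)" "U * U\<^sup>\<dagger> = 1\<^sub>m (Suc n)"
    and c: "col U 0 = c \<cdot>\<^sub>v v"
    using unitary_with_first_column[OF v(1,2)] .
  have dims [simp]: "dim_row U = Suc n" "dim_col U = Suc n" "dim_row A = Suc n" "dim_col A = Suc n"
    using U(1) A by auto
  define B where "B = U\<^sup>\<dagger> * (A * U)"
  have dimB [simp]: "dim_row B = Suc n" "dim_col B = Suc n" by (auto simp: B_def)
  have hB: "B\<^sup>\<dagger> = B" by (simp add: B_def adj_mult Suc.prems(2) mat_assoc)
  have AUcol: "A *\<^sub>v col U 0 = e \<cdot>\<^sub>v col U 0"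
    using A v unfolding c by (simp add: mult_mat_vec smult_smult_assoc mult.commute)
  have AU0: "(A * U) $$ (i, 0) = e * U $$ (i, 0)" if "i < Suc n" for i
    using that arg_cong[OF AUcol, of "\<lambda>w. w $ i"] by simp
  have B0: "B $$ (i, 0) = (if i = 0 then e else 0)" if "i < Suc n" for i
  proof -
    have "B $$ (i, 0) = (\<Sum>k<Suc n. U\<^sup>\<dagger> $$ (i, k) * (A * U) $$ (k, 0))"
      using that by (simp add: B_def entry_mult del: index_mult_mat(1) sum.lessThan_Suc)
    also have "\<dots> = e * (\<Sum>k<Suc n. U\<^sup>\<dagger> $$ (i, k) * U $$ (k, 0))"
      using AU0 by (simp add: sum_distrib_left mult_ac del: index_mult_mat(1) sum.lessThan_Suc)
    also have "(\<Sum>k<Suc n. U\<^sup>\<dagger> $$ (i, k) * U $$ (k, 0)) = (U\<^sup>\<dagger> * U) $$ (i, 0)"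
      using that by (simp add: entry_mult del: index_mult_mat(1) sum.lessThan_Suc)
    finally show ?thesis using that by (simp add: U(2))
  qed
  \<comment> \<open>The eigenvector equation clears the first column only; hermiticity of B
    transfers the zeros to the first row.\<close>
  have B0': "B $$ (0, j) = (if j = 0 then cnj e else 0)" if "j < Suc n" for j
    using arg_cong[OF hB, of "\<lambda>M. M $$ (0, j)"] that B0[of j] by (cases "j = 0") auto
  define B' where "B' = mat n n (\<lambda>(i, j). B $$ (Suc i, Suc j))"
  have B: "B = corner_ext e B'"
  proof (rule eq_matI)
    fix i j assume "i < dim_row (corner_ext e B')" "j < dim_col (corner_ext e B')"
    then show "B $$ (i, j) = corner_ext e B' $$ (i, j)"
      using B0 B0' by (cases i; cases j) (auto simp: B'_def)
  qed (auto simp: B'_def)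
  have B'c: "B' \<in> carrier_mat n n" by (simp add: B'_def)
  have "B'\<^sup>\<dagger> = B'"
  proof (rule eq_matI)
    fix i j assume "i < dim_row B'" "j < dim_col B'"
    then show "B'\<^sup>\<dagger> $$ (i, j) = B' $$ (i, j)"
      using arg_cong[OF hB, of "\<lambda>M. M $$ (Suc i, Suc j)"] by (simp add: B'_def)
  qed (auto simp: B'_def)
  from Suc.IH[OF B'c this] obtain U' d where U': "U' \<in> carrier_mat n n" "U'\<^sup>\<dagger> * U' = 1\<^sub>m n"
    "U' * U'\<^sup>\<dagger> = 1\<^sub>m n" and d: "B' = U' * diag_of n d * U'\<^sup>\<dagger>" by blast
  have dims' [simp]: "dim_row U' = n" "dim_col U' = n" using U'(1) by auto
  define W where "W = corner_ext 1 U'"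
  have dimW [simp]: "dim_row W = Suc n" "dim_col W = Suc n" by (auto simp: W_def)
  have W: "W\<^sup>\<dagger> * W = 1\<^sub>m (Suc n)" "W * W\<^sup>\<dagger> = 1\<^sub>m (Suc n)"
    by (simp_all add: W_def corner_ext_adj corner_ext_mult U' corner_ext_one)
  have BW: "B = W * diag_of (Suc n) (case_nat e d) * W\<^sup>\<dagger>"
    by (simp add: B d W_def corner_ext_adj corner_ext_mult flip: corner_ext_diag_of)
  have "A = (U * U\<^sup>\<dagger>) * A * (U * U\<^sup>\<dagger>)" by (simp add: U(3) mat_one_left mat_one_right)
  also have "\<dots> = U * B * U\<^sup>\<dagger>" by (simp add: B_def mat_assoc)
  also have "\<dots> = (U * W) * diag_of (Suc n) (case_nat e d) * (U * W)\<^sup>\<dagger>"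
    by (simp add: BW mat_assoc adj_mult)
  finally have "A = (U * W) * diag_of (Suc n) (case_nat e d) * (U * W)\<^sup>\<dagger>" .
  moreover have "(U * W)\<^sup>\<dagger> * (U * W) = W\<^sup>\<dagger> * ((U\<^sup>\<dagger> * U) * W)" by (simp add: adj_mult mat_assoc)
  moreover have "(U * W) * (U * W)\<^sup>\<dagger> = U * ((W * W\<^sup>\<dagger>) * U\<^sup>\<dagger>)" by (simp add: adj_mult mat_assoc)
  moreover have "U * W \<in> carrier_mat (Suc n) (Suc n)" by (auto intro!: carrier_matI)
  ultimately show ?case using U(2,3) W by (metis dims(1,2) dimW adj_dim mat_one_left)
qed

text \<open>Eigenvalues are recorded as squares of nonnegative reals, so that a square root or an
  inverse square root of A arises by replacing the diagonal, without further case analysis.\<close>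

lemma positive_op_diagonalization:
  assumes "positive_op n A"
  obtains U s where "U \<in> carrier_mat n n" "U\<^sup>\<dagger> * U = 1\<^sub>m n" "U * U\<^sup>\<dagger> = 1\<^sub>m n" "\<And>i. 0 \<le> s i"
    "A = U * diag_of n (\<lambda>i. complex_of_real (s i) * complex_of_real (s i)) * U\<^sup>\<dagger>"
proof -
  have A: "A \<in> carrier_mat n n" using assms by (simp add: positive_op_def)
  obtain U d where U: "U \<in> carrier_mat n n" "U\<^sup>\<dagger> * U = 1\<^sub>m n" "U * U\<^sup>\<dagger> = 1\<^sub>m n"
    and d: "A = U * diag_of n d * U\<^sup>\<dagger>"
    using hermitian_diagonalization[OF A positive_op_hermitian[OF assms]] by blast
  have dims [simp]: "dim_row U = n" "dim_col U = n" using U(1) by auto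
  have "U\<^sup>\<dagger> * A * U\<^sup>\<dagger>\<^sup>\<dagger> = (U\<^sup>\<dagger> * U) * diag_of n d * (U\<^sup>\<dagger> * U)"
    by (simp add: d mat_assoc)
  also have "\<dots> = diag_of n d" by (simp add: U mat_one_left mat_one_right)
  finally have "positive_op n (diag_of n d)"
    using positive_op_congruence[OF assms adj_carrier[OF U(1)]] by simp
  then have pos: "0 \<le> d i" if "i < n" for i
    using positive_op_diag_nonneg[of n "diag_of n d" i] that by simp
  \<comment> \<open>The absolute value makes \<open>s i\<close> nonnegative for every index, also
    outside the range where \<open>d i\<close> is known to be nonnegative; \<open>sqrt\<close> of a
    negative real is negative.\<close>
  define s where "s i = sqrt \<bar>Re (d i)\<bar>" for i
  have ss: "complex_of_real (s i) * complex_of_real (s i) = d i" if "i < n" for i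
  proof -
    have "d i = complex_of_real (Re (d i))" "Re (d i) \<ge> 0"
      using pos[OF that] by (auto simp: less_eq_complex_def complex_eq_iff)
    then show ?thesis
      unfolding s_def of_real_mult[symmetric] by (metis real_sqrt_mult_self abs_of_nonneg abs_idempotent)
  qed
  have "diag_of n d = diag_of n (\<lambda>i. complex_of_real (s i) * complex_of_real (s i))" using ss by (intro eq_matI) auto
  then show ?thesis using that[of U s] U d by (auto simp: s_def)
qed

lemma positive_op_factor:
  assumes "positive_op n A"
  obtains W where "W \<in> carrier_mat n n" "A = W * W\<^sup>\<dagger>"
proof -
  obtain U t where U: "U \<in> carrier_mat n n"
    and A: "A = U * diag_of n (\<lambda>i. complex_of_real (t i) * complex_of_real (t i)) * U\<^sup>\<dagger>"
    using positive_op_diagonalization[OF assms] by metis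
  define s where "s = (\<lambda>i. complex_of_real (t i))"
  have dims [simp]: "dim_row U = n" "dim_col U = n" using U(1) by auto
  have "A = (U * diag_of n s) * (U * diag_of n s)\<^sup>\<dagger>"
    by (simp add: A adj_mult diag_of_adj s_def mat_assoc flip: diag_of_mult)
  then show ?thesis by (intro that[of "U * diag_of n s"]) auto
qed

text \<open>\<open>R\<close> is the square root of the pseudo-inverse of \<open>M\<close>.\<close>

lemma positive_op_inverse_sqrt:
  assumes "positive_op n M"
  obtains R where "R \<in> carrier_mat n n" "R\<^sup>\<dagger> = R" "R * (R * (M * R)) = R" "M * (R * (R * M)) = M"
    "\<And>F. F \<in> carrier_mat n n \<Longrightarrow> F * M = M * F \<Longrightarrow> F * R = R * F"
proof -
  obtain U t where U: "U \<in> carrier_mat n n" "U\<^sup>\<dagger> * U = 1\<^sub>m n" "U * U\<^sup>\<dagger> = 1\<^sub>m n"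
    and t: "\<And>i. 0 \<le> t i"
    and M: "M = U * diag_of n (\<lambda>i. complex_of_real (t i) * complex_of_real (t i)) * U\<^sup>\<dagger>"
    by (rule positive_op_diagonalization[OF assms]) blast
  define s where "s = (\<lambda>i. complex_of_real (t i))"
  have dims [simp]: "dim_row U = n" "dim_col U = n" using U(1) by auto
  \<comment> \<open>Functional calculus in the eigenbasis of M: \<open>fc\<close> is multiplicative,
    so all identities between M and R reduce to identities between scalars.\<close>
  define fc where "fc d = U * diag_of n d * U\<^sup>\<dagger>" for d
  have dim_fc [simp]: "dim_row (fc d) = n" "dim_col (fc d) = n" for d by (auto simp: fc_def)
  have fc_mult: "fc a * fc b = fc (\<lambda>i. a i * b i)" for a b
  proof -
    have "fc a * fc b = U * diag_of n a * (U\<^sup>\<dagger> * U) * (diag_of n b * U\<^sup>\<dagger>)" by (simp add: fc_def mat_assoc)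
    also have "\<dots> = fc (\<lambda>i. a i * b i)"
      by (simp add: U mat_one_right mat_assoc fc_def flip: diag_of_mult)
    finally show ?thesis .
  qed
  \<comment> \<open>Since \<open>inverse 0 = 0\<close>, r vanishes exactly where s does, which makes
    R zero on the kernel of M.\<close>
  define r where "r = (\<lambda>i. inverse (s i))"
  define R where "R = fc r"
  have Mfc: "M = fc (\<lambda>i. s i * s i)" by (simp add: M fc_def s_def)
  have "R\<^sup>\<dagger> = R" by (simp add: R_def fc_def adj_mult mat_assoc diag_of_adj r_def s_def)
  moreover have "R * (R * (M * R)) = R"
  proof -
    have "(\<lambda>i. r i * (r i * (s i * s i * r i))) = r" by (rule ext) (simp add: r_def field_simps)
    then show ?thesis by (simp add: R_def Mfc fc_mult)
  qed
  moreover have "M * (R * (R * M)) = M"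
  proof -
    have "(\<lambda>i. s i * s i * (r i * (r i * (s i * s i)))) = (\<lambda>i. s i * s i)"
      by (rule ext) (simp add: r_def field_simps)
    then show ?thesis by (simp add: R_def Mfc fc_mult)
  qed
  moreover have "F * R = R * F" if F: "F \<in> carrier_mat n n" and comm: "F * M = M * F" for F
  proof -
    have dimF [simp]: "dim_row F = n" "dim_col F = n" using F by auto
    \<comment> \<open>In the eigenbasis, commuting with M becomes a condition on single entries of
      G.\<close>
    define G where "G = U\<^sup>\<dagger> * F * U"
    have G: "G \<in> carrier_mat n n" by (auto simp: G_def)
    have GF: "G * diag_of n a = U\<^sup>\<dagger> * (F * fc a) * U" for a
    proof -
      have "U\<^sup>\<dagger> * (F * fc a) * U = U\<^sup>\<dagger> * F * U * diag_of n a * (U\<^sup>\<dagger> * U)" by (simp add: fc_def mat_assoc)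
      then show ?thesis by (simp add: U G_def mat_one_right)
    qed
    have FG: "diag_of n a * G = U\<^sup>\<dagger> * (fc a * F) * U" for a
    proof -
      have "U\<^sup>\<dagger> * (fc a * F) * U = (U\<^sup>\<dagger> * U) * (diag_of n a * (U\<^sup>\<dagger> * F * U))" by (simp add: fc_def mat_assoc)
      then show ?thesis by (simp add: U G_def mat_one_left)
    qed
    have "G * diag_of n (\<lambda>i. s i * s i) = diag_of n (\<lambda>i. s i * s i) * G"
      using comm by (simp add: GF FG Mfc)
    then have *: "G $$ (i, j) * (s j * s j) = s i * s i * G $$ (i, j)" if "i < n" "j < n" for i j
      using mult_diag_of_left_index[OF G that] mult_diag_of_right_index[OF G that]
      by (metis (no_types))
    have "G $$ (i, j) * r j = r i * G $$ (i, j)" if "i < n" "j < n" for i j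
    proof -
      \<comment> \<open>A nonzero entry of G links only indices with equal squares, and nonnegative
        reals with equal squares are equal. Hence G commutes with every function of s, in particular
        with r.\<close>
      have "s i = s j" if "G $$ (i, j) \<noteq> 0"
      proof -
        have "s j * s j = s i * s i" using *[OF \<open>i < n\<close> \<open>j < n\<close>] that by simp
        then have "t j * t j = t i * t i" by (simp add: s_def flip: of_real_mult)
        then show ?thesis using t by (simp add: s_def flip: power2_eq_square)
      qed
      then show ?thesis by (cases "G $$ (i, j) = 0") (auto simp: r_def)
    qed
    then have "G * diag_of n r = diag_of n r * G"
      using G by (intro eq_matI)
        (auto simp: mult_diag_of_left_index mult_diag_of_right_index simp del: index_mult_mat(1))
    then have "U\<^sup>\<dagger> * (F * R) * U = U\<^sup>\<dagger> * (R * F) * U" by (simp add: GF FG R_def)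
    then have "U * (U\<^sup>\<dagger> * (F * R) * U) * U\<^sup>\<dagger> = U * (U\<^sup>\<dagger> * (R * F) * U) * U\<^sup>\<dagger>" by simp
    then have "(U * U\<^sup>\<dagger>) * (F * R) * (U * U\<^sup>\<dagger>) = (U * U\<^sup>\<dagger>) * (R * F) * (U * U\<^sup>\<dagger>)"
      by (simp add: mat_assoc R_def)
    then show ?thesis by (simp add: U mat_one_left mat_one_right R_def)
  qed
  moreover have "R \<in> carrier_mat n n" by (auto simp: R_def intro!: carrier_matI)
  ultimately show ?thesis using that by blast
qed

subsection \<open>Lifting along a family of operators\<close>

locale operator_family =
  fixes m r :: nat and I :: "'i set" and T :: "'i \<Rightarrow> complex mat"
  assumes finite_I: "finite I" and T_carrier: "k \<in> I \<Longrightarrow> T k \<in> carrier_mat m r"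
begin

lemma T_dim [simp]: "k \<in> I \<Longrightarrow> dim_row (T k) = m" "k \<in> I \<Longrightarrow> dim_col (T k) = r"
  using T_carrier by auto

definition conj_sum :: "complex mat \<Rightarrow> complex mat" where
  "conj_sum X = mat_sum m m (\<lambda>k. T k * (X * (T k)\<^sup>\<dagger>)) I"

definition gram :: "complex mat" where
  "gram = mat_sum m m (\<lambda>k. T k * (T k)\<^sup>\<dagger>) I"

definition commuting :: "complex mat set" where
  "commuting = {X \<in> carrier_mat r r. \<forall>i\<in>I. \<forall>j\<in>I. (T i)\<^sup>\<dagger> * T j * X = X * ((T i)\<^sup>\<dagger> * T j)}"

lemma conj_sum_dim [simp]: "dim_row (conj_sum X) = m" "dim_col (conj_sum X) = m"
  by (simp_all add: conj_sum_def)

lemma gram_dim [simp]: "dim_row gram = m" "dim_col gram = m"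
  by (simp_all add: gram_def)

lemma positive_op_gram: "positive_op m gram"
  unfolding gram_def
proof (rule positive_op_sum)
  fix k assume "k \<in> I"
  then show "positive_op m (T k * (T k)\<^sup>\<dagger>)"
    using positive_op_congruence[OF positive_op_one T_carrier] by (simp add: mat_one_right)
qed

lemma gram_adj: "gram\<^sup>\<dagger> = gram"
  using positive_op_gram by (rule positive_op_hermitian)

text \<open>One choice is fixed for the whole locale. The last conjunct stands in for the fact that
  the operator is a function of \<open>gram\<close>.\<close>

definition root :: "complex mat" where
  "root = (SOME R. R \<in> carrier_mat m m \<and> R\<^sup>\<dagger> = R \<and> R * (R * (gram * R)) = R \<and> gram * (R * (R * gram)) = gram \<and>
     (\<forall>F\<in>carrier_mat m m. F * gram = gram * F \<longrightarrow> F * R = R * F))"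

lemma root_props: "root \<in> carrier_mat m m \<and> root\<^sup>\<dagger> = root \<and> root * (root * (gram * root)) = root \<and>
    gram * (root * (root * gram)) = gram \<and>
    (\<forall>F\<in>carrier_mat m m. F * gram = gram * F \<longrightarrow> F * root = root * F)"
  unfolding root_def by (rule someI_ex) (rule positive_op_inverse_sqrt[OF positive_op_gram], blast)

lemma root_carrier: "root \<in> carrier_mat m m"
  and root_adj: "root\<^sup>\<dagger> = root"
  and root_gram_root: "root * (root * (gram * root)) = root"
  and gram_root_gram: "gram * (root * (root * gram)) = gram"
  and root_commute: "F \<in> carrier_mat m m \<Longrightarrow> F * gram = gram * F \<Longrightarrow> F * root = root * F"
  using root_props by blast+

lemma root_dim [simp]: "dim_row root = m" "dim_col root = m"
  using root_carrier by auto

lemma root_gram_commute: "gram * root = root * gram"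
  by (rule root_commute) (auto intro!: carrier_matI)

text \<open>The orthogonal projection onto the range of \<open>gram\<close>, which is the joint
  range of the operators \<open>T k\<close>.\<close>

definition supp :: "complex mat" where
  "supp = root * (root * gram)"

lemma supp_dim [simp]: "dim_row supp = m" "dim_col supp = m"
  by (simp_all add: supp_def)

lemma supp_eqs: "supp = gram * (root * root)" "supp = root * (gram * root)"
proof -
  have "gram * (root * root) = gram * root * root" by (simp add: mat_assoc)
  also have "\<dots> = root * (gram * root)" by (simp add: mat_assoc root_gram_commute)
  finally have *: "gram * (root * root) = root * (gram * root)" .
  also have "\<dots> = supp" by (simp add: supp_def root_gram_commute)
  finally show "supp = gram * (root * root)" ..
  with * show "supp = root * (gram * root)" by simp
qed

lemma supp_adj: "supp\<^sup>\<dagger> = supp"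
  using supp_eqs(1) by (simp add: supp_def adj_mult root_adj gram_adj mat_assoc)

lemma supp_gram: "supp * gram = gram"
  using gram_root_gram by (simp add: supp_eqs(1) mat_assoc)

lemma root_supp: "root * supp = root"
  using root_gram_root by (simp add: supp_eqs(2))

lemma supp_supp: "supp * supp = supp"
proof -
  have "supp * supp = supp * gram * (root * root)" by (subst (2) supp_eqs(1)) (simp add: mat_assoc)
  then show ?thesis by (simp add: supp_gram flip: supp_eqs(1))
qed

definition co_supp :: "complex mat" where
  "co_supp = 1\<^sub>m m - supp"

lemma co_supp_dim [simp]: "dim_row co_supp = m" "dim_col co_supp = m"
  by (simp_all add: co_supp_def)

lemma co_supp_adj: "co_supp\<^sup>\<dagger> = co_supp"
  by (simp add: co_supp_def adj_minus supp_adj)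

lemma co_supp_mult: "dim_row A = m \<Longrightarrow> co_supp * A = A - supp * A"
  unfolding co_supp_def
  by (simp add: mat_minus_left mat_one_left)

lemma co_supp_co_supp: "co_supp * co_supp = co_supp"
proof -
  have "supp * co_supp = supp * 1\<^sub>m m - supp * supp"
    unfolding co_supp_def by (rule mat_minus_right) auto
  also have "\<dots> = 0\<^sub>m m m" by (simp add: mat_one_right supp_supp mat_minus_self)
  finally show ?thesis by (subst co_supp_mult) (auto intro!: eq_matI)
qed

lemma supp_add_co_supp: "supp + co_supp = 1\<^sub>m m"
  unfolding co_supp_def by (intro eq_matI) auto

text \<open>With Q for \<open>co_supp\<close>, the sum of
  \<open>(Q T\<^sub>k) (Q T\<^sub>k)\<^sup>\<dagger>\<close> is Q \<open>gram\<close> Q, which is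
  zero because \<open>supp\<close> fixes \<open>gram\<close>. So each term vanishes.\<close>

lemma co_supp_T:
  assumes "k \<in> I"
  shows "co_supp * T k = 0\<^sub>m m r"
proof (rule sum_mult_adj_eq_zeroD[OF finite_I _ _ assms])
  show "co_supp * T j \<in> carrier_mat m r" if "j \<in> I" for j using that by (auto intro!: carrier_matI)
  have "mat_sum m m (\<lambda>k. (co_supp * T k) * (co_supp * T k)\<^sup>\<dagger>) I
      = mat_sum m m (\<lambda>k. co_supp * (T k * (T k)\<^sup>\<dagger> * co_supp)) I"
    by (intro mat_sum_cong refl) (simp add: adj_mult co_supp_adj mat_assoc)
  also have "\<dots> = co_supp * (gram * co_supp)"
    unfolding gram_def by (subst mat_sum_mult_right, (auto intro!: carrier_matI)[3], subst mat_sum_mult_left)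
      (auto intro!: carrier_matI)
  also have "\<dots> = co_supp * gram * co_supp" by (simp add: mat_assoc)
  also have "co_supp * gram = 0\<^sub>m m m"
    by (simp add: co_supp_mult supp_gram mat_minus_self)
  finally show "mat_sum m m (\<lambda>k. (co_supp * T k) * (co_supp * T k)\<^sup>\<dagger>) I = 0\<^sub>m m m" by simp
qed

lemma supp_T:
  assumes "k \<in> I"
  shows "supp * T k = T k"
proof -
  have "T k = (supp + co_supp) * T k" using assms by (simp add: supp_add_co_supp mat_one_left)
  also have "\<dots> = supp * T k + co_supp * T k"
    using assms by (intro mat_add_left) auto
  also have "\<dots> = supp * T k"
    using assms by (subst co_supp_T[OF assms], intro right_add_zero_mat carrier_matI) auto
  finally show ?thesis ..
qed

definition lift :: "complex mat \<Rightarrow> complex mat" where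
  "lift X = root * (conj_sum X * root)"

lemma lift_dim [simp]: "dim_row (lift X) = m" "dim_col (lift X) = m"
  by (simp_all add: lift_def)

lemma commuting_dim [simp]: "X \<in> commuting \<Longrightarrow> dim_row X = r" "X \<in> commuting \<Longrightarrow> dim_col X = r"
  by (auto simp: commuting_def)

text \<open>In every summand X stands next to \<open>(T k)\<^sup>\<dagger> * T j\<close>, with which
  it commutes; moving it to the far right leaves the Gram sum.\<close>

lemma conj_sum_T:
  assumes X: "X \<in> commuting" and j: "j \<in> I"
  shows "conj_sum X * T j = gram * (T j * X)"
proof -
  have "conj_sum X * T j = mat_sum m r (\<lambda>k. T k * (X * ((T k)\<^sup>\<dagger> * T j))) I"
    unfolding conj_sum_def using X j
    by (subst mat_sum_mult_right) (auto intro!: carrier_matI mat_sum_cong simp: mat_assoc)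
  also have "\<dots> = mat_sum m r (\<lambda>k. T k * (T k)\<^sup>\<dagger> * (T j * X)) I"
  proof (rule mat_sum_cong[OF refl])
    fix k assume "k \<in> I"
    then have "X * ((T k)\<^sup>\<dagger> * T j) = (T k)\<^sup>\<dagger> * T j * X" using X j by (auto simp: commuting_def)
    then show "T k * (X * ((T k)\<^sup>\<dagger> * T j)) = T k * (T k)\<^sup>\<dagger> * (T j * X)"
      using X j \<open>k \<in> I\<close> by (simp add: mat_assoc)
  qed
  also have "\<dots> = gram * (T j * X)"
    unfolding gram_def using X j by (subst mat_sum_mult_right) (auto intro!: carrier_matI)
  finally show ?thesis .
qed

lemma mult_gram: "dim_col Y = m \<Longrightarrow> Y * gram = mat_sum (dim_row Y) m (\<lambda>k. Y * T k * (T k)\<^sup>\<dagger>) I"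
  unfolding gram_def by (subst mat_sum_mult_left) (auto intro!: carrier_matI mat_sum_cong simp: mat_assoc)

text \<open>Multiplying on the right by each \<open>T k * (T k)\<^sup>\<dagger>\<close> and applying
  the preceding relation pulls \<open>gram\<close> out on the left. The point is that
  \<open>root\<close>, which commutes with whatever commutes with \<open>gram\<close>, can then be
  moved past \<open>conj_sum X\<close>.\<close>

lemma conj_sum_gram:
  assumes X: "X \<in> commuting"
  shows "conj_sum X * gram = gram * conj_sum X"
proof -
  have "conj_sum X * gram = mat_sum m m (\<lambda>k. gram * (T k * (X * (T k)\<^sup>\<dagger>))) I"
    using X by (subst mult_gram) (auto simp: conj_sum_T mat_assoc intro!: mat_sum_cong)
  also have "\<dots> = gram * conj_sum X"
    unfolding conj_sum_def using X by (subst mat_sum_mult_left) (auto intro!: carrier_matI)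
  finally show ?thesis .
qed

text \<open>After both roots are collected on the left, they meet the factor \<open>gram\<close>
  produced by \<open>conj_sum_T\<close> and form \<open>supp\<close>, which fixes
  \<open>T j\<close>.\<close>

lemma lift_T:
  assumes X: "X \<in> commuting" and j: "j \<in> I"
  shows "lift X * T j = T j * X"
proof -
  have "conj_sum X * root = root * conj_sum X"
    by (rule root_commute[OF _ conj_sum_gram[OF X]]) (auto intro!: carrier_matI)
  then have "lift X * T j = root * (root * (conj_sum X * T j))" using j by (simp add: lift_def mat_assoc)
  also have "\<dots> = supp * T j * X" using X j by (simp add: conj_sum_T supp_def mat_assoc)
  finally show ?thesis using j by (simp add: supp_T)
qed

lemma lift_supp: "lift X * supp = lift X"
  by (simp add: lift_def mat_assoc root_supp)

text \<open>The columns of the \<open>T k\<close> span the range of \<open>supp\<close>.\<close>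

lemma eq_if_agree_on_T:
  assumes "Y \<in> carrier_mat m m" "Z \<in> carrier_mat m m" "Y * supp = Y" "Z * supp = Z"
    and "\<And>k. k \<in> I \<Longrightarrow> Y * T k = Z * T k"
  shows "Y = Z"
proof -
  have "Y * gram = Z * gram"
    using assms(1,2,5) by (auto simp: mult_gram intro!: mat_sum_cong)
  then have "Y * gram * (root * root) = Z * gram * (root * root)" by simp
  then have "Y * supp = Z * supp" using assms(1,2) by (simp add: supp_eqs(1) mat_assoc)
  then show ?thesis using assms(3,4) by simp
qed

text \<open>Uniqueness of the lift: it is determined by its action on the operators
  \<open>T k\<close> and by vanishing off the support. Algebraic identities for \<open>lift\<close>
  can thus be tested on the family.\<close>

lemma lift_eqI:
  assumes "X \<in> commuting" "Y \<in> carrier_mat m m" "Y * supp = Y" "\<And>k. k \<in> I \<Longrightarrow> Y * T k = T k * X"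
  shows "lift X = Y"
  by (rule eq_if_agree_on_T) (use assms in \<open>auto simp: lift_T lift_supp intro!: carrier_matI\<close>)

lemma commuting_mult:
  assumes "X \<in> commuting" "Y \<in> commuting"
  shows "X * Y \<in> commuting"
  unfolding commuting_def
proof (intro CollectI conjI ballI)
  fix i j assume ij: "i \<in> I" "j \<in> I"
  define A where "A = (T i)\<^sup>\<dagger> * T j"
  have dims [simp]: "dim_row A = r" "dim_col A = r" "dim_row X = r" "dim_col X = r" "dim_row Y = r" "dim_col Y = r"
    using ij assms by (simp_all add: A_def)
  have XA: "A * X = X * A" and YA: "A * Y = Y * A"
    using assms ij by (auto simp: commuting_def A_def)
  have "A * (X * Y) = A * X * Y" by (simp add: mat_assoc)
  also have "\<dots> = X * (A * Y)" unfolding XA by (simp add: mat_assoc)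
  also have "\<dots> = X * Y * A" unfolding YA by (simp add: mat_assoc)
  finally show "(T i)\<^sup>\<dagger> * T j * (X * Y) = X * Y * ((T i)\<^sup>\<dagger> * T j)" by (simp add: A_def)
qed (use assms in \<open>auto intro!: carrier_matI\<close>)

text \<open>Multiplicativity is not visible in the formula, which has the shape of a completely
  positive map. It follows from uniqueness, both sides sending \<open>T k\<close> to
  \<open>T k * (X * Y)\<close>.\<close>

lemma lift_mult:
  assumes X: "X \<in> commuting" and Y: "Y \<in> commuting"
  shows "lift (X * Y) = lift X * lift Y"
proof (rule lift_eqI[OF commuting_mult[OF X Y]])
  show "lift X * lift Y * T k = T k * (X * Y)" if "k \<in> I" for k
  proof -
    have "lift X * lift Y * T k = lift X * (T k * Y)" using that Y by (simp add: mat_assoc lift_T)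
    also have "\<dots> = lift X * T k * Y" using that Y by (simp add: mat_assoc)
    also have "\<dots> = T k * X * Y" using that X by (simp add: lift_T)
    finally show ?thesis using that X Y by (simp add: mat_assoc)
  qed
qed (auto intro!: carrier_matI simp: mat_assoc lift_supp)

lemma lift_add:
  assumes "X \<in> carrier_mat r r" "Y \<in> carrier_mat r r"
  shows "lift (X + Y) = lift X + lift Y"
proof -
  have "conj_sum (X + Y) = mat_sum m m (\<lambda>k. T k * (X * (T k)\<^sup>\<dagger>) + T k * (Y * (T k)\<^sup>\<dagger>)) I"
    unfolding conj_sum_def
  proof (rule mat_sum_cong[OF refl])
    fix k assume k: "k \<in> I"
    have "(X + Y) * (T k)\<^sup>\<dagger> = X * (T k)\<^sup>\<dagger> + Y * (T k)\<^sup>\<dagger>"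
      using assms k by (intro mat_add_left) auto
    then show "T k * ((X + Y) * (T k)\<^sup>\<dagger>) = T k * (X * (T k)\<^sup>\<dagger>) + T k * (Y * (T k)\<^sup>\<dagger>)"
      using assms k by (simp add: mat_add_right)
  qed
  also have "\<dots> = conj_sum X + conj_sum Y"
    unfolding conj_sum_def using assms by (intro mat_sum_add) (auto intro!: carrier_matI)
  finally have *: "conj_sum (X + Y) = conj_sum X + conj_sum Y" .
  show ?thesis by (simp add: lift_def * mat_add_left mat_add_right)
qed

lemma lift_smult:
  assumes "X \<in> carrier_mat r r"
  shows "lift (c \<cdot>\<^sub>m X) = c \<cdot>\<^sub>m lift X"
proof -
  have *: "conj_sum (c \<cdot>\<^sub>m X) = c \<cdot>\<^sub>m conj_sum X"
    unfolding conj_sum_def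
    using assms
    by (subst mat_sum_smult[symmetric])
      (auto intro!: carrier_matI mat_sum_cong simp: mat_smult_left mat_smult_right)
  show ?thesis by (simp add: lift_def * mat_smult_left mat_smult_right)
qed

lemma lift_adj:
  assumes "X \<in> carrier_mat r r"
  shows "lift (X\<^sup>\<dagger>) = (lift X)\<^sup>\<dagger>"
proof -
  have "(conj_sum X)\<^sup>\<dagger> = conj_sum (X\<^sup>\<dagger>)"
    unfolding conj_sum_def using assms
    by (subst mat_sum_adj) (auto simp: adj_mult mat_assoc intro!: carrier_matI mat_sum_cong)
  then show ?thesis by (simp add: lift_def adj_mult root_adj mat_assoc)
qed

lemma commuting_adj:
  assumes "X \<in> commuting"
  shows "X\<^sup>\<dagger> \<in> commuting"
  unfolding commuting_def
proof (intro CollectI conjI ballI)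
  fix i j assume ij: "i \<in> I" "j \<in> I"
  have "(T j)\<^sup>\<dagger> * T i * X = X * ((T j)\<^sup>\<dagger> * T i)" using assms ij by (auto simp: commuting_def)
  then have "((T j)\<^sup>\<dagger> * T i * X)\<^sup>\<dagger> = (X * ((T j)\<^sup>\<dagger> * T i))\<^sup>\<dagger>" by simp
  then show "(T i)\<^sup>\<dagger> * T j * X\<^sup>\<dagger> = X\<^sup>\<dagger> * ((T i)\<^sup>\<dagger> * T j)"
    using ij assms by (simp add: adj_mult mat_assoc)
qed (use assms in \<open>auto intro!: carrier_matI\<close>)

text \<open>If \<open>Y\<close> and \<open>Y\<^sup>\<dagger>\<close> map the range of \<open>supp\<close> into itself, then commutation with \<open>lift X\<close> may be tested
  on that range, because \<open>lift X\<close> vanishes on its complement.\<close>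

lemma lift_commute:
  assumes X: "X \<in> commuting" and Y: "Y \<in> carrier_mat m m"
    and inv: "\<And>k. k \<in> I \<Longrightarrow> lift X * (Y * T k) = Y * (T k * X)"
      "\<And>k. k \<in> I \<Longrightarrow> lift (X\<^sup>\<dagger>) * (Y\<^sup>\<dagger> * T k) = Y\<^sup>\<dagger> * (T k * X\<^sup>\<dagger>)"
  shows "lift X * Y = Y * lift X"
proof -
  have dimY [simp]: "dim_row Y = m" "dim_col Y = m" using Y by auto
  \<comment> \<open>Half of the commutation, valid on the support: both sides vanish off the support
    and agree on each \<open>T k\<close>.\<close>
  have half: "lift X * Y * supp = Y * lift X" if X: "X \<in> commuting" and Y: "Y \<in> carrier_mat m m"
    and inv: "\<And>k. k \<in> I \<Longrightarrow> lift X * (Y * T k) = Y * (T k * X)" for X Y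
    by (rule eq_if_agree_on_T)
      (use X Y inv in \<open>auto intro!: carrier_matI simp: mat_assoc supp_supp lift_supp supp_T lift_T\<close>)
  have 1: "lift X * Y * supp = Y * lift X" by (rule half[OF X Y inv(1)])
  have "lift (X\<^sup>\<dagger>) * Y\<^sup>\<dagger> * supp = Y\<^sup>\<dagger> * lift (X\<^sup>\<dagger>)"
    by (rule half[OF commuting_adj[OF X] adj_carrier[OF Y] inv(2)])
  then have "(lift (X\<^sup>\<dagger>) * Y\<^sup>\<dagger> * supp)\<^sup>\<dagger> = (Y\<^sup>\<dagger> * lift (X\<^sup>\<dagger>))\<^sup>\<dagger>" by simp
  then have 2: "supp * (Y * lift X) = lift X * Y"
    using X by (subst (asm) (1 2) lift_adj) (auto simp: adj_mult supp_adj intro!: carrier_matI)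
  have "supp * lift X = lift X"
  proof -
    have "supp * lift X = (supp * root) * (conj_sum X * root)" by (simp add: lift_def mat_assoc)
    also have "supp * root = (root * supp)\<^sup>\<dagger>" by (simp add: adj_mult supp_adj root_adj)
    also have "\<dots> = root" by (simp add: root_supp root_adj)
    finally show ?thesis by (simp add: lift_def)
  qed
  \<comment> \<open>The adjoint half says that the range of \<open>lift X * Y\<close> lies in the
    support, the direct half that cutting by \<open>supp\<close> on the right gives
    \<open>Y * lift X\<close>. As \<open>lift X\<close> absorbs \<open>supp\<close> on both sides,
    the two combine to full commutation.\<close>
  then have "lift X * Y = supp * (lift X * Y * supp)" using 1 2 by simp
  also have "\<dots> = lift X * Y * supp"
    using \<open>supp * lift X = lift X\<close> by (simp add: mat_assoc flip: mat_assoc[of supp "lift X"])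
  finally show ?thesis using 1 by simp
qed

end

subsection \<open>The *-algebra of operators\<close>

lemma op_algebra_simps [simp]:
  "carrier (op_algebra n) = carrier_mat n n" "monoid.mult (op_algebra n) = (*)" "one (op_algebra n) = 1\<^sub>m n"
  "zero (op_algebra n) = 0\<^sub>m n n" "add (op_algebra n) = (+)" "module.smult (op_algebra n) = (\<cdot>\<^sub>m)"
  "star (op_algebra n) = mat_adjoint"
  by (simp_all add: op_algebra_def)

lemma mat_smult_smult: "(a * b) \<cdot>\<^sub>m X = a \<cdot>\<^sub>m (b \<cdot>\<^sub>m X)" for X :: "complex mat"
  by (rule eq_matI) auto

lemma class_cring: "cring (class_ring :: complex ring)"
  using class_field[where 'a = complex] by (simp add: field_def domain_def)

lemma ex_mat_uminus: "X \<in> carrier_mat n n \<Longrightarrow> \<exists>Y\<in>carrier_mat n n. X + Y = 0\<^sub>m n n" for X :: "complex mat"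
  by (rule bexI[of _ "- X"]) (auto intro!: eq_matI)

lemma module_op_algebra: "Module.module (class_ring :: complex ring) (op_algebra n)"
  by (rule module_criteria)
    (auto simp: class_ring_simps add_smult_distrib_left_mat add_smult_distrib_right_mat mat_smult_smult
      class_cring
      intro: comm_add_mat assoc_add_mat ex_mat_uminus)

lemma star_algebra_op_algebra: "star_algebra (op_algebra n)"
proof -
  interpret Module.module "class_ring :: complex ring" "op_algebra n" by (rule module_op_algebra)
  have "ring (op_algebra n)"
    by (rule ringI, rule abelian_group_axioms, rule monoidI)
      (auto simp: add_mult_distrib_mat[of _ n n] mult_add_distrib_mat[of _ n n])
  then show ?thesis
    unfolding star_algebra_def star_algebra_axioms_def
    by (auto simp: module_op_algebra mat_smult_left mat_smult_right adj_add adj_smult adj_mult intro: adj_carrier)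
qed

lemma star_algebra_unital_subalgebra:
  assumes "unital_star_subalgebra n A"
  shows "star_algebra ((op_algebra n)\<lparr>carrier := A\<rparr>)"
proof -
  interpret O: star_algebra "op_algebra n" by (rule star_algebra_op_algebra)
  have sub: "submodule class_ring A (op_algebra n)" and mult: "\<And>X Y. X \<in> A \<Longrightarrow> Y \<in> A \<Longrightarrow> X * Y \<in> A"
    and adj: "\<And>X. X \<in> A \<Longrightarrow> X\<^sup>\<dagger> \<in> A" and one: "1\<^sub>m n \<in> A"
    using assms by (auto simp: unital_star_subalgebra_def star_subalgebra_def)
  have AC: "X \<in> carrier_mat n n" if "X \<in> A" for X using submodule.subset[OF sub] that by auto
  interpret M: Module.module "class_ring :: complex ring" "(op_algebra n)\<lparr>carrier := A\<rparr>"
    by (rule O.submodule_is_module[OF sub])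
  have "ring ((op_algebra n)\<lparr>carrier := A\<rparr>)"
    by (rule ringI, rule M.abelian_group_axioms, rule monoidI)
      (auto simp: mult one AC add_mult_distrib_mat[of _ n n] mult_add_distrib_mat[of _ n n] dest!: AC)
  then show ?thesis
    unfolding star_algebra_def star_algebra_axioms_def
    using M.module_axioms
    by (auto simp: mat_smult_left mat_smult_right adj_add adj_smult adj_mult adj dest!: AC)
qed

section \<open>Finite dimension and mutually embedded algebras\<close>

lemma vectorspace_class_ring:
  "Module.module (class_ring :: complex ring) M \<Longrightarrow> vectorspace (class_ring :: complex ring) M"
  unfolding vectorspace_def using class_field by auto

text \<open>Reading a vector of length n * n row by row is a linear surjection onto the square
  matrices, and finite dimension passes to images.\<close>

lemma op_algebra_fin_dim: "vectorspace.fin_dim (class_ring :: complex ring) (op_algebra n)"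
proof -
  interpret V: vec_space "TYPE(complex)" "n * n" .
  define T where "T v = mat n n (\<lambda>(i, j). v $ (i * n + j))" for v :: "complex vec"
  have idx: "i * n + j < n * n" if "i < n" "j < n" for i j
  proof -
    have "i * n + j < Suc i * n" using that by simp
    also have "\<dots> \<le> n * n" using that by (intro mult_le_mono1) auto
    finally show ?thesis .
  qed
  have "linear_map (class_ring :: complex ring) (module_vec TYPE(complex) (n * n)) (op_algebra n) T"
    unfolding linear_map_def mod_hom_def mod_hom_axioms_def
    using vec_vs vectorspace_class_ring[OF module_op_algebra] module_op_algebra vec_module
    by (auto simp: LinearCombinations.module_hom_def T_def module_vec_simps idx intro!: eq_matI)
  then interpret T: linear_map "class_ring :: complex ring" "module_vec TYPE(complex) (n * n)" "op_algebra n" T .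
  have "T ` carrier (module_vec TYPE(complex) (n * n)) = carrier (op_algebra n)"
  proof
    show "carrier (op_algebra n) \<subseteq> T ` carrier (module_vec TYPE(complex) (n * n))"
    proof
      fix X assume "X \<in> carrier (op_algebra n)"
      then have "X = T (vec (n * n) (\<lambda>k. X $$ (k div n, k mod n)))"
        by (intro eq_matI) (auto simp: T_def idx)
      then show "X \<in> T ` carrier (module_vec TYPE(complex) (n * n))"
        by (intro image_eqI[of _ _ "vec (n * n) (\<lambda>k. X $$ (k div n, k mod n))"]) (auto simp: module_vec_simps)
    qed
  qed (auto simp: T_def)
  then show ?thesis using T.surj_fin_dim V.fin_dim by blast
qed

text \<open>Independent subsets of W are independent in V, so their size is bounded by the dimension
  of V. A maximal one therefore exists, and it generates W.\<close>

lemma (in vectorspace) fin_dim_subspace: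
  assumes "VectorSpace.subspace K W V" fin_dim
  shows "vectorspace.fin_dim K (vs W)"
proof -
  interpret W: vectorspace K "vs W" by (rule subspace_is_vs[OF assms(1)])
  have sub: "submodule K W V" using assms(1) by (simp add: VectorSpace.subspace_def)
  have WV: "W \<subseteq> carrier V" using sub by (simp add: submodule_def)
  have "\<exists>A. finite A \<and> maximal A (\<lambda>S. S \<subseteq> W \<and> W.lin_indpt S)"
  proof (rule maximal_exists)
    show "finite A \<and> card A \<le> dim" if "A \<subseteq> W \<and> W.lin_indpt A" for A
      using that li_le_dim[OF assms(2), of A] span_li_not_depend(2)[OF _ sub, of A] WV by auto
    show "{} \<subseteq> W \<and> W.lin_indpt {}" by (auto simp: W.lin_dep_def)
  qed
  then obtain A where "finite A" "maximal A (\<lambda>S. S \<subseteq> carrier (vs W) \<and> W.lin_indpt S)" by auto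
  then show ?thesis using W.max_li_is_gen unfolding W.fin_dim_def maximal_def by blast
qed

text \<open>By rank-nullity the image has full dimension; a basis of the image is then an
  independent set of full size in V, hence a basis of V.\<close>

lemma (in vectorspace) inj_endo_imp_surj:
  assumes "linear_map K V V T" fin_dim "inj_on T (carrier V)"
  shows "T ` carrier V = carrier V"
proof -
  interpret T: linear_map K V V T by (rule assms(1))
  have sub: "VectorSpace.subspace K T.im V" by (rule T.imT_is_subspace)
  interpret im: vectorspace K "vs T.im" by (rule subspace_is_vs[OF sub])
  have fd: "im.fin_dim" by (rule fin_dim_subspace[OF sub assms(2)])
  have "im.dim = dim"
    using T.rank_nullity[OF assms(2)] T.inj_imp_dim_ker0[OF assms(3)] by simp
  obtain B where B: "finite B" "im.basis B" using im.finite_basis_exists[OF fd] by auto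
  then have card: "card B = dim" using im.dim_basis[of B] \<open>im.dim = dim\<close> by simp
  have Bim: "B \<subseteq> T.im" and li: "im.lin_indpt B" using B by (auto simp: im.basis_def)
  have subm: "submodule K T.im V" using sub by (simp add: VectorSpace.subspace_def)
  then have imV: "T.im \<subseteq> carrier V" by (simp add: submodule_def)
  have "lin_indpt B" using span_li_not_depend(2)[OF Bim subm] li by simp
  then have "basis B" using dim_li_is_basis[OF assms(2) B(1)] Bim imV card by auto
  then have "span B = carrier V" by (simp add: basis_def)
  moreover have "span B \<subseteq> T.im" by (rule span_is_subset[OF Bim subm])
  ultimately show ?thesis using imV by (auto simp: T.im_def)
qed

text \<open>The composite \<open>f \<circ> g\<close> is an injective linear endomorphism of B, hence
  onto. Then f is onto already, so the given embedding f is itself the isomorphism.\<close>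

lemma star_isomorphic_if_mutual_embeddings:
  assumes A: "star_algebra A" and B: "star_algebra B" "vectorspace.fin_dim class_ring B"
    and "star_embeds A B" "star_embeds B A"
  shows "star_isomorphic A B"
proof -
  obtain f g where f: "f \<in> star_hom A B" "inj_on f (carrier A)" and g: "g \<in> star_hom B A" "inj_on g (carrier B)"
    using assms(4,5) by (auto simp: star_embeds_def)
  have fc: "f \<in> carrier A \<rightarrow> carrier B" and gc: "g \<in> carrier B \<rightarrow> carrier A"
    using f g by (auto simp: star_hom_def LinearCombinations.module_hom_def)
  have mB: "Module.module (class_ring :: complex ring) B" using B(1) by (simp add: star_algebra_def)
  interpret B: vectorspace "class_ring :: complex ring" B by (rule vectorspace_class_ring[OF mB])
  have lin: "linear_map (class_ring :: complex ring) B B (f \<circ> g)"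
    unfolding linear_map_def mod_hom_def mod_hom_axioms_def
    using vectorspace_class_ring[OF mB] mB f(1) g(1) gc
    by (auto simp: star_hom_def LinearCombinations.module_hom_def Pi_iff)
  have "inj_on (f \<circ> g) (carrier B)"
    using g(2) gc by (intro comp_inj_on inj_on_subset[OF f(2)]) auto
  then have "(f \<circ> g) ` carrier B = carrier B" using B.inj_endo_imp_surj[OF lin B(2)] by simp
  moreover have "f ` g ` carrier B \<subseteq> f ` carrier A" using gc by (intro image_mono) auto
  moreover have "f ` carrier A \<subseteq> carrier B" using fc by auto
  ultimately have "f ` carrier A = carrier B" by (simp add: image_comp)
  then show ?thesis using f by (auto simp: star_isomorphic_def bij_betw_def)
qed

lemma unital_star_subalgebra_commutant:
  assumes "star_subalgebra n S"
  shows "unital_star_subalgebra n (commutant n S)"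
proof -
  have SC: "X \<in> carrier_mat n n" if "X \<in> S" for X
    using assms that by (auto simp: star_subalgebra_def submodule_def)
  have S_dim [simp]: "dim_row X = n" "dim_col X = n" if "X \<in> S" for X
    using SC[OF that] by auto
  have "submodule class_ring (commutant n S) (op_algebra n)"
    unfolding submodule_def
    using module_op_algebra
    by (auto simp: commutant_def SC mat_add_left mat_add_right mat_smult_left mat_smult_right)
  moreover have "X * Y \<in> commutant n S" if "X \<in> commutant n S" "Y \<in> commutant n S" for X Y
  proof -
    have "X * Y * Z = Z * (X * Y)" if "Z \<in> S" for Z
    proof -
      have [simp]: "dim_row Z = n" "dim_col Z = n" "dim_row X = n" "dim_col X = n" "dim_row Y = n" "dim_col Y = n"
        using \<open>X \<in> commutant n S\<close> \<open>Y \<in> commutant n S\<close> SC[OF that] by (auto simp: commutant_def)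
      have XZ: "X * Z = Z * X" and YZ: "Y * Z = Z * Y"
        using \<open>X \<in> commutant n S\<close> \<open>Y \<in> commutant n S\<close> that by (auto simp: commutant_def)
      have "X * Y * Z = X * Z * Y" by (simp add: mat_assoc YZ)
      then show ?thesis unfolding XZ by (simp add: mat_assoc)
    qed
    then show ?thesis using that by (auto simp: commutant_def)
  qed
  moreover have "X\<^sup>\<dagger> \<in> commutant n S" if "X \<in> commutant n S" for X
  proof -
    have "X\<^sup>\<dagger> * Z = Z * X\<^sup>\<dagger>" if "Z \<in> S" for Z
    proof -
      have [simp]: "dim_row Z = n" "dim_col Z = n" "dim_row X = n" "dim_col X = n"
        using \<open>X \<in> commutant n S\<close> SC[OF that] by (auto simp: commutant_def)
      have "Z\<^sup>\<dagger> \<in> S" using assms that by (auto simp: star_subalgebra_def)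
      then have "(X * Z\<^sup>\<dagger>)\<^sup>\<dagger> = (Z\<^sup>\<dagger> * X)\<^sup>\<dagger>" using \<open>X \<in> commutant n S\<close> by (auto simp: commutant_def)
      then show ?thesis by (simp add: adj_mult)
    qed
    then show ?thesis using that by (auto simp: commutant_def)
  qed
  moreover have "1\<^sub>m n \<in> commutant n S" by (auto simp: commutant_def mat_one_left mat_one_right)
  ultimately show ?thesis by (auto simp: unital_star_subalgebra_def star_subalgebra_def)
qed

subsection \<open>The operator norm\<close>

definition vnorm :: "complex vec \<Rightarrow> real" where
  "vnorm v = L2_set (\<lambda>i. cmod (v $ i)) {..<dim_vec v}"

lemma vnorm_nonneg [simp]: "0 \<le> vnorm v"
  by (simp add: vnorm_def L2_set_nonneg)

lemma vnorm_eq_0_iff: "v \<in> carrier_vec n \<Longrightarrow> vnorm v = 0 \<longleftrightarrow> v = 0\<^sub>v n"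
  unfolding vnorm_def by (subst L2_set_eq_0_iff) auto

lemma vnorm_add:
  assumes "v \<in> carrier_vec n" "w \<in> carrier_vec n"
  shows "vnorm (v + w) \<le> vnorm v + vnorm w"
proof -
  have "vnorm (v + w) \<le> L2_set (\<lambda>i. cmod (v $ i) + cmod (w $ i)) {..<n}"
    unfolding vnorm_def using assms by (auto intro!: L2_set_mono norm_triangle_ineq)
  also have "\<dots> \<le> vnorm v + vnorm w"
    using L2_set_triangle_ineq[of "\<lambda>i. cmod (v $ i)" "\<lambda>i. cmod (w $ i)" "{..<n}"] assms by (simp add: vnorm_def)
  finally show ?thesis .
qed

lemma vnorm_smult: "vnorm (c \<cdot>\<^sub>v v) = cmod c * vnorm v"
proof -
  have "vnorm (c \<cdot>\<^sub>v v) = L2_set (\<lambda>i. cmod c * cmod (v $ i)) {..<dim_vec v}"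
    unfolding vnorm_def by (rule L2_set_cong) (auto simp: norm_mult)
  then show ?thesis by (simp add: vnorm_def L2_set_right_distrib)
qed

lemma vnorm_sq: "(vnorm v)\<^sup>2 = Re (v \<bullet>c v)" "v \<bullet>c v = complex_of_real ((vnorm v)\<^sup>2)"
proof -
  have "v \<bullet>c v = (\<Sum>i<dim_vec v. complex_of_real ((cmod (v $ i))\<^sup>2))"
    unfolding complex_norm_square by (rule cscalar_prod_sum) simp
  then show "v \<bullet>c v = complex_of_real ((vnorm v)\<^sup>2)"
    by (simp add: vnorm_def L2_set_def sum_nonneg)
  then show "(vnorm v)\<^sup>2 = Re (v \<bullet>c v)" by (metis Re_complex_of_real)
qed

lemma cscalar_prod_le:
  assumes "v \<in> carrier_vec n" "w \<in> carrier_vec n"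
  shows "cmod (v \<bullet>c w) \<le> vnorm v * vnorm w"
proof -
  have "cmod (v \<bullet>c w) \<le> (\<Sum>i<n. \<bar>cmod (v $ i)\<bar> * \<bar>cmod (w $ i)\<bar>)"
    using assms by (subst cscalar_prod_sum[where n = n]) (auto intro!: sum_norm_le simp: norm_mult)
  also have "\<dots> \<le> vnorm v * vnorm w"
    using L2_set_mult_ineq[of "\<lambda>i. cmod (v $ i)" "\<lambda>i. cmod (w $ i)" "{..<n}"] assms by (simp add: vnorm_def)
  finally show ?thesis .
qed

text \<open>The condition \<open>0 \<le> c\<close> keeps the set bounded below even for n = 0, where
  the inequality holds for every real c; the infimum is then 0.\<close>

definition op_bounds :: "nat \<Rightarrow> complex mat \<Rightarrow> real set" where
  "op_bounds n X = {c. 0 \<le> c \<and> (\<forall>v\<in>carrier_vec n. vnorm (X *\<^sub>v v) \<le> c * vnorm v)}"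

definition op_norm :: "nat \<Rightarrow> complex mat \<Rightarrow> real" where
  "op_norm n X = Inf (op_bounds n X)"

lemma op_bounds_nonempty:
  assumes X: "X \<in> carrier_mat n n"
  shows "op_bounds n X \<noteq> {}"
proof -
  define c where "c = (\<Sum>i<n. \<Sum>j<n. cmod (X $$ (i, j)))"
  have "vnorm (X *\<^sub>v v) \<le> c * vnorm v" if v: "v \<in> carrier_vec n" for v
  proof -
    have le: "cmod (v $ j) \<le> vnorm v" if "j < n" for j
      unfolding vnorm_def using v that by (intro member_le_L2_set) auto
    have "vnorm (X *\<^sub>v v) \<le> (\<Sum>i<n. cmod ((X *\<^sub>v v) $ i))"
      unfolding vnorm_def using X by (simp add: L2_set_le_sum del: index_mult_mat_vec)
    also have "\<dots> \<le> (\<Sum>i<n. \<Sum>j<n. cmod (X $$ (i, j)) * vnorm v)"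
    proof (rule sum_mono)
      fix i assume "i \<in> {..<n}"
      then have "cmod ((X *\<^sub>v v) $ i) = cmod (\<Sum>j<n. X $$ (i, j) * v $ j)"
        using X v by (subst mult_vec_index) auto
      also have "\<dots> \<le> (\<Sum>j<n. cmod (X $$ (i, j)) * vnorm v)"
        using le by (intro sum_norm_le) (auto simp: norm_mult intro: mult_left_mono)
      finally show "cmod ((X *\<^sub>v v) $ i) \<le> (\<Sum>j<n. cmod (X $$ (i, j)) * vnorm v)" .
    qed
    also have "\<dots> = c * vnorm v" by (simp add: c_def sum_distrib_right)
    finally show ?thesis .
  qed
  moreover have "0 \<le> c" by (auto simp: c_def intro!: sum_nonneg)
  ultimately show ?thesis by (auto simp: op_bounds_def)
qed

lemma op_norm_le: "0 \<le> c \<Longrightarrow> (\<And>v. v \<in> carrier_vec n \<Longrightarrow> vnorm (X *\<^sub>v v) \<le> c * vnorm v) \<Longrightarrow> op_norm n X \<le> c"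
  unfolding op_norm_def by (intro cInf_lower) (auto simp: op_bounds_def intro!: bdd_belowI[of _ 0])

lemma op_norm_nonneg: "X \<in> carrier_mat n n \<Longrightarrow> 0 \<le> op_norm n X"
  unfolding op_norm_def by (intro cInf_greatest op_bounds_nonempty) (auto simp: op_bounds_def)

text \<open>The infimum is itself a bound: for v of positive length the quotient of the lengths is
  below every element of \<open>op_bounds\<close>. For length zero, where no quotient exists, any
  single bound settles the claim.\<close>

lemma vnorm_le_op_norm:
  assumes "X \<in> carrier_mat n n" "v \<in> carrier_vec n"
  shows "vnorm (X *\<^sub>v v) \<le> op_norm n X * vnorm v"
proof (cases "vnorm v = 0")
  case True
  obtain c where "c \<in> op_bounds n X" using op_bounds_nonempty[OF assms(1)] by auto
  then have "vnorm (X *\<^sub>v v) \<le> c * vnorm v" using assms(2) by (auto simp: op_bounds_def)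
  then show ?thesis using True by simp
next
  case False
  then have pos: "0 < vnorm v" using vnorm_nonneg[of v] by linarith
  have "vnorm (X *\<^sub>v v) / vnorm v \<le> op_norm n X"
    unfolding op_norm_def
    using pos assms by (intro cInf_greatest op_bounds_nonempty) (auto simp: op_bounds_def divide_le_eq)
  then show ?thesis using pos by (simp add: divide_le_eq)
qed

lemma op_norm_mult:
  assumes X: "X \<in> carrier_mat n n" and Y: "Y \<in> carrier_mat n n"
  shows "op_norm n (X * Y) \<le> op_norm n X * op_norm n Y"
proof (rule op_norm_le)
  fix v :: "complex vec" assume v: "v \<in> carrier_vec n"
  have "vnorm (X * Y *\<^sub>v v) = vnorm (X *\<^sub>v (Y *\<^sub>v v))" using assms v by (simp add: mat_vec_assoc)
  also have "\<dots> \<le> op_norm n X * vnorm (Y *\<^sub>v v)" using assms v by (intro vnorm_le_op_norm) auto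
  also have "\<dots> \<le> op_norm n X * (op_norm n Y * vnorm v)"
    using assms v by (intro mult_left_mono vnorm_le_op_norm op_norm_nonneg) auto
  finally show "vnorm (X * Y *\<^sub>v v) \<le> op_norm n X * op_norm n Y * vnorm v" by (simp add: mult.assoc)
qed (use assms in \<open>simp add: op_norm_nonneg\<close>)

text \<open>The squared length of \<open>X *\<^sub>v v\<close> is the quadratic form of
  \<open>X\<^sup>\<dagger> * X\<close> at v, which Cauchy-Schwarz bounds by the norm of that product
  times the squared length of v.\<close>

lemma op_norm_sq_le:
  assumes X: "X \<in> carrier_mat n n"
  shows "(op_norm n X)\<^sup>2 \<le> op_norm n (X\<^sup>\<dagger> * X)"
proof -
  have XX: "X\<^sup>\<dagger> * X \<in> carrier_mat n n" using X by (auto intro!: carrier_matI)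
  have "op_norm n X \<le> sqrt (op_norm n (X\<^sup>\<dagger> * X))"
  proof (rule op_norm_le)
    fix v :: "complex vec" assume v: "v \<in> carrier_vec n"
    have Xv: "X *\<^sub>v v \<in> carrier_vec n" using X v by auto
    have "(X\<^sup>\<dagger> * X *\<^sub>v v) \<bullet>c v = (X *\<^sub>v v) \<bullet>c (X *\<^sub>v v)"
      using X v adj_cscalar_prod[OF X Xv v] by (simp add: mat_vec_assoc)
    then have "(vnorm (X *\<^sub>v v))\<^sup>2 = Re ((X\<^sup>\<dagger> * X *\<^sub>v v) \<bullet>c v)" by (simp add: vnorm_sq(1))
    also have "\<dots> \<le> cmod ((X\<^sup>\<dagger> * X *\<^sub>v v) \<bullet>c v)" by (rule complex_Re_le_cmod)
    also have "\<dots> \<le> vnorm (X\<^sup>\<dagger> * X *\<^sub>v v) * vnorm v"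
      using XX v by (intro cscalar_prod_le mult_mat_vec_carrier)
    also have "\<dots> \<le> op_norm n (X\<^sup>\<dagger> * X) * vnorm v * vnorm v"
      using XX v by (intro mult_right_mono vnorm_le_op_norm) auto
    also have "\<dots> = (sqrt (op_norm n (X\<^sup>\<dagger> * X)) * vnorm v)\<^sup>2"
      unfolding power_mult_distrib real_sqrt_pow2[OF op_norm_nonneg[OF XX]]
      by (simp add: power2_eq_square mult.assoc)
    finally have "(vnorm (X *\<^sub>v v))\<^sup>2 \<le> (sqrt (op_norm n (X\<^sup>\<dagger> * X)) * vnorm v)\<^sup>2" .
    then show "vnorm (X *\<^sub>v v) \<le> sqrt (op_norm n (X\<^sup>\<dagger> * X)) * vnorm v"
      by (rule power2_le_imp_le) (simp add: op_norm_nonneg[OF XX])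
  qed (use op_norm_nonneg[OF XX] in simp)
  then have "(op_norm n X)\<^sup>2 \<le> (sqrt (op_norm n (X\<^sup>\<dagger> * X)))\<^sup>2"
    by (rule power_mono) (rule op_norm_nonneg[OF X])
  then show ?thesis by (simp only: real_sqrt_pow2[OF op_norm_nonneg[OF XX]])
qed

text \<open>One factor \<open>op_norm n X\<close> is cancelled from the C*-inequality combined with
  submultiplicativity. Applied to the adjoint it gives the opposite estimate.\<close>

lemma op_norm_adj_le:
  assumes X: "X \<in> carrier_mat n n"
  shows "op_norm n X \<le> op_norm n (X\<^sup>\<dagger>)"
proof -
  have "op_norm n X * op_norm n X \<le> op_norm n (X\<^sup>\<dagger>) * op_norm n X"
    using op_norm_sq_le[OF X] op_norm_mult[OF adj_carrier[OF X] X] by (simp add: power2_eq_square)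
  then show ?thesis
    using op_norm_nonneg[OF X] op_norm_nonneg[OF adj_carrier[OF X]]
    by (cases "op_norm n X = 0") (auto simp: mult_le_cancel_right)
qed

lemma op_norm_smult_le:
  assumes "X \<in> carrier_mat n n"
  shows "op_norm n (c \<cdot>\<^sub>m X) \<le> cmod c * op_norm n X"
proof (rule op_norm_le)
  fix v :: "complex vec" assume v: "v \<in> carrier_vec n"
  have "(c \<cdot>\<^sub>m X) *\<^sub>v v = c \<cdot>\<^sub>v (X *\<^sub>v v)" using assms v by (intro eq_vecI) auto
  then show "vnorm (c \<cdot>\<^sub>m X *\<^sub>v v) \<le> cmod c * op_norm n X * vnorm v"
    using vnorm_le_op_norm[OF assms v] by (simp add: vnorm_smult mult.assoc mult_left_mono)
qed (use assms in \<open>simp add: op_norm_nonneg\<close>)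

lemma cstar_norm_op_norm: "cstar_norm (op_algebra n) (op_norm n)"
  unfolding cstar_norm_def
proof (intro conjI ballI allI; unfold op_algebra_simps)
  fix X :: "complex mat" assume X: "X \<in> carrier_mat n n"
  show "0 \<le> op_norm n X" by (rule op_norm_nonneg[OF X])
  show "op_norm n X = 0 \<longleftrightarrow> X = 0\<^sub>m n n"
  proof
    assume 0: "op_norm n X = 0"
    have "X *\<^sub>v unit_vec n j = 0\<^sub>v n" for j
    proof -
      have "vnorm (X *\<^sub>v unit_vec n j) = 0"
        using vnorm_le_op_norm[OF X, of "unit_vec n j"] vnorm_nonneg[of "X *\<^sub>v unit_vec n j"] 0 by simp
      then show ?thesis using vnorm_eq_0_iff[of "X *\<^sub>v unit_vec n j" n] X by auto
    qed
    then have col: "(X *\<^sub>v unit_vec n j) $ i = 0" if "i < n" for i j using that by simp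
    have "X $$ (i, j) = 0" if "i < n" "j < n" for i j
      using col[OF that(1), of j] X that by (simp add: scalar_prod_right_unit[of _ n])
    then show "X = 0\<^sub>m n n" using X by (intro eq_matI) auto
  next
    assume "X = 0\<^sub>m n n"
    moreover have "0\<^sub>m n n *\<^sub>v v = 0\<^sub>v n" if "v \<in> carrier_vec n" for v :: "complex vec"
      using that by (intro eq_vecI) auto
    ultimately have "op_norm n X \<le> 0" using vnorm_eq_0_iff[of "0\<^sub>v n" n] by (intro op_norm_le) auto
    then show "op_norm n X = 0" using op_norm_nonneg[OF X] by simp
  qed
  show "op_norm n (X\<^sup>\<dagger> * X) = (op_norm n X)\<^sup>2"
  proof (rule antisym)
    have "op_norm n (X\<^sup>\<dagger> * X) \<le> op_norm n (X\<^sup>\<dagger>) * op_norm n X"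
      by (rule op_norm_mult[OF adj_carrier[OF X] X])
    also have "\<dots> \<le> op_norm n X * op_norm n X"
      using op_norm_adj_le[OF adj_carrier[OF X]] op_norm_nonneg[OF X] by (simp add: mult_right_mono)
    finally show "op_norm n (X\<^sup>\<dagger> * X) \<le> (op_norm n X)\<^sup>2" by (simp add: power2_eq_square)
  qed (rule op_norm_sq_le[OF X])
  fix Y :: "complex mat" assume Y: "Y \<in> carrier_mat n n"
  show "op_norm n (X * Y) \<le> op_norm n X * op_norm n Y" by (rule op_norm_mult[OF X Y])
  show "op_norm n (X + Y) \<le> op_norm n X + op_norm n Y"
  proof (rule op_norm_le)
    fix v :: "complex vec" assume v: "v \<in> carrier_vec n"
    have "(X + Y) *\<^sub>v v = X *\<^sub>v v + Y *\<^sub>v v" using X Y v by (rule add_mult_distrib_mat_vec)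
    then have "vnorm ((X + Y) *\<^sub>v v) \<le> vnorm (X *\<^sub>v v) + vnorm (Y *\<^sub>v v)"
      using X Y v by (simp add: vnorm_add[of _ n])
    then show "vnorm ((X + Y) *\<^sub>v v) \<le> (op_norm n X + op_norm n Y) * vnorm v"
      using vnorm_le_op_norm[OF X v] vnorm_le_op_norm[OF Y v] by (simp add: distrib_right)
  qed (simp add: op_norm_nonneg X Y)
next
  fix c and X :: "complex mat" assume X: "X \<in> carrier_mat n n"
  show "op_norm n (c \<cdot>\<^sub>m X) = cmod c * op_norm n X"
  proof (cases "c = 0")
    case True
    then show ?thesis
      using op_norm_smult_le[OF X, of c] op_norm_nonneg[of "c \<cdot>\<^sub>m X" n] X by simp
  next
    case False
    \<comment> \<open>The reverse inequality is the easy one applied to the scalar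
      \<open>inverse c\<close>.\<close>
    have "X = inverse c \<cdot>\<^sub>m (c \<cdot>\<^sub>m X)" using False by (intro eq_matI) auto
    then have "op_norm n X \<le> cmod (inverse c) * op_norm n (c \<cdot>\<^sub>m X)"
      using op_norm_smult_le[of "c \<cdot>\<^sub>m X" n "inverse c"] X by simp
    then have "cmod c * op_norm n X \<le> cmod c * (cmod (inverse c) * op_norm n (c \<cdot>\<^sub>m X))"
      by (rule mult_left_mono) simp
    also have "\<dots> = op_norm n (c \<cdot>\<^sub>m X)"
      using False by (simp only: norm_inverse mult.assoc[symmetric]) simp
    finally have "cmod c * op_norm n X \<le> op_norm n (c \<cdot>\<^sub>m X)" .
    then show ?thesis using op_norm_smult_le[OF X, of c] by simp
  qed
qed

lemma fd_cstar_algebra_commutant: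
  assumes "0 < n" "star_subalgebra n S"
  shows "fd_cstar_algebra (commutant_algebra n S)"
proof -
  have C: "unital_star_subalgebra n (commutant n S)" by (rule unital_star_subalgebra_commutant[OF assms(2)])
  interpret O: vectorspace "class_ring :: complex ring" "op_algebra n"
    by (rule vectorspace_class_ring[OF module_op_algebra])
  have "VectorSpace.subspace class_ring (commutant n S) (op_algebra n)"
    using C O.vectorspace_axioms by (simp add: VectorSpace.subspace_def unital_star_subalgebra_def star_subalgebra_def)
  then have "vectorspace.fin_dim class_ring (commutant_algebra n S)"
    unfolding commutant_algebra_def using O.fin_dim_subspace op_algebra_fin_dim by blast
  moreover have "carrier (commutant_algebra n S) \<noteq> {\<zero>\<^bsub>commutant_algebra n S\<^esub>}"
  proof -
    have "(1\<^sub>m n :: complex mat) \<noteq> 0\<^sub>m n n"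
    proof
      assume "(1\<^sub>m n :: complex mat) = 0\<^sub>m n n"
      then have "(1\<^sub>m n :: complex mat) $$ (0, 0) = 0\<^sub>m n n $$ (0, 0)" by simp
      then show False using assms(1) by simp
    qed
    then show ?thesis using C by (auto simp: commutant_algebra_def unital_star_subalgebra_def)
  qed
  \<comment> \<open>All C*-norm axioms are universal over the carrier, so they restrict to a
    subalgebra with the same operations.\<close>
  moreover have "cstar_norm (commutant_algebra n S) (op_norm n)"
    using cstar_norm_op_norm[of n]
    by (auto simp: cstar_norm_def commutant_algebra_def commutant_def)
  ultimately show ?thesis
    unfolding fd_cstar_algebra_def using star_algebra_unital_subalgebra[OF C]
    by (auto simp: commutant_algebra_def)
qed

subsection \<open>Channels and Kraus representations\<close>

lemma linear_zero:
  assumes "\<Phi> \<in> LinearCombinations.module_hom class_ring (op_algebra n) (op_algebra m)"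
  shows "\<Phi> (0\<^sub>m n n) = 0\<^sub>m m m"
proof -
  have P: "\<Phi> (0\<^sub>m n n) \<in> carrier_mat m m"
    using assms by (auto simp: LinearCombinations.module_hom_def)
  have "\<Phi> (0\<^sub>m n n) = 0 \<cdot>\<^sub>m \<Phi> (0\<^sub>m n n)"
    using LinearCombinations.module_hom_smult[OF assms, of 0 "0\<^sub>m n n"] by (simp add: class_ring_simps)
  also have "\<dots> = 0\<^sub>m m m"
    by (intro eq_matI) (use P in auto)
  finally show ?thesis .
qed

lemma linear_mat_sum:
  assumes "\<Phi> \<in> LinearCombinations.module_hom class_ring (op_algebra n) (op_algebra m)"
    and "finite I" "\<And>k. k \<in> I \<Longrightarrow> f k \<in> carrier_mat n n"
  shows "\<Phi> (mat_sum n n f I) = mat_sum m m (\<lambda>k. \<Phi> (f k)) I"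
  using assms(2,3)
proof (induction I rule: finite_induct)
  case empty
  have "mat_sum n n f {} = 0\<^sub>m n n" "mat_sum m m (\<lambda>k. \<Phi> (f k)) {} = 0\<^sub>m m m"
    by (auto intro: mat_sum_zero)
  then show ?case using linear_zero[OF assms(1)] by simp
next
  case (insert k I)
  have fk: "f k \<in> carrier_mat n n" using insert.prems by simp
  then have Pk: "\<Phi> (f k) \<in> carrier_mat m m" using assms(1) by (auto simp: LinearCombinations.module_hom_def)
  have "\<Phi> (f k + mat_sum n n f I) = \<Phi> (f k) + \<Phi> (mat_sum n n f I)"
    using assms(1) fk by (auto simp: LinearCombinations.module_hom_def)
  then show ?case
    using insert fk Pk by (simp add: mat_sum_insert)
qed

lemma mat_eq_sum_units:
  assumes "X \<in> carrier_mat n n"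
  shows "X = mat_sum n n (\<lambda>(a, b). X $$ (a, b) \<cdot>\<^sub>m mat_unit n n a b) ({..<n} \<times> {..<n})"
proof (rule eq_matI)
  fix i j assume "i < dim_row (mat_sum n n (\<lambda>(a, b). X $$ (a, b) \<cdot>\<^sub>m mat_unit n n a b) ({..<n} \<times> {..<n}))"
    "j < dim_col (mat_sum n n (\<lambda>(a, b). X $$ (a, b) \<cdot>\<^sub>m mat_unit n n a b) ({..<n} \<times> {..<n}))"
  then have ij: "i < n" "j < n" by auto
  have "(\<Sum>x\<in>{..<n} \<times> {..<n}. (case x of (a, b) \<Rightarrow> X $$ (a, b) \<cdot>\<^sub>m mat_unit n n a b) $$ (i, j))
      = (\<Sum>x\<in>{..<n} \<times> {..<n}. if x = (i, j) then X $$ (i, j) else 0)"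
    using ij by (intro sum.cong refl) (auto split: if_splits)
  also have "\<dots> = X $$ (i, j)" using ij by (simp add: sum.delta)
  finally show "X $$ (i, j) = mat_sum n n (\<lambda>(a, b). X $$ (a, b) \<cdot>\<^sub>m mat_unit n n a b) ({..<n} \<times> {..<n}) $$ (i, j)"
    using ij by simp
qed (use assms in auto)

lemma linear_eqI:
  assumes f: "f \<in> LinearCombinations.module_hom class_ring (op_algebra n) (op_algebra m)"
    and g: "g \<in> LinearCombinations.module_hom class_ring (op_algebra n) (op_algebra m)"
    and eq: "\<And>a b. a < n \<Longrightarrow> b < n \<Longrightarrow> f (mat_unit n n a b) = g (mat_unit n n a b)"
    and X: "X \<in> carrier_mat n n"
  shows "f X = g X"
proof -
  let ?h = "\<lambda>(a, b). X $$ (a, b) \<cdot>\<^sub>m mat_unit n n a b" and ?I = "{..<n} \<times> {..<n}"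
  have h: "?h x \<in> carrier_mat n n" for x by (cases x) auto
  have "f X = f (mat_sum n n ?h ?I)" using mat_eq_sum_units[OF X] by simp
  also have "\<dots> = mat_sum m m (\<lambda>x. f (?h x)) ?I" using h by (intro linear_mat_sum[OF f]) auto
  also have "\<dots> = mat_sum m m (\<lambda>x. g (?h x)) ?I"
    using f g eq by (intro mat_sum_cong) (auto simp: LinearCombinations.module_hom_def class_ring_simps)
  also have "\<dots> = g (mat_sum n n ?h ?I)" using h by (intro linear_mat_sum[OF g, symmetric]) auto
  also have "\<dots> = g X" using mat_eq_sum_units[OF X] by simp
  finally show ?thesis .
qed

text \<open>The index set has arbitrary type, unlike the initial segment in
  \<open>kraus_rep\<close>, so disjoint unions and products of families need no renumbering.\<close>

definition kraus_map :: "nat \<Rightarrow> ('i \<Rightarrow> complex mat) \<Rightarrow> 'i set \<Rightarrow> complex mat \<Rightarrow> complex mat" where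
  "kraus_map m K I X = mat_sum m m (\<lambda>k. K k * (X * (K k)\<^sup>\<dagger>)) I"

lemma kraus_map_linear:
  assumes "\<And>k. k \<in> I \<Longrightarrow> K k \<in> carrier_mat m n"
  shows "kraus_map m K I \<in> LinearCombinations.module_hom class_ring (op_algebra n) (op_algebra m)"
proof -
  have dims [simp]: "dim_row (K k) = m" "dim_col (K k) = n" if "k \<in> I" for k using assms[OF that] by auto
  have "kraus_map m K I (X + Y) = kraus_map m K I X + kraus_map m K I Y"
    if "X \<in> carrier_mat n n" "Y \<in> carrier_mat n n" for X Y
  proof -
    have [simp]: "dim_row X = n" "dim_col X = n" "dim_row Y = n" "dim_col Y = n" using that by auto
    show ?thesis unfolding kraus_map_def
      by (subst mat_sum_add[symmetric]) (auto intro!: carrier_matI mat_sum_cong simp: mat_add_left mat_add_right)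
  qed
  moreover have "kraus_map m K I (c \<cdot>\<^sub>m X) = c \<cdot>\<^sub>m kraus_map m K I X" if "X \<in> carrier_mat n n" for c X
  proof -
    have [simp]: "dim_row X = n" "dim_col X = n" using that by auto
    show ?thesis unfolding kraus_map_def
      by (subst mat_sum_smult[symmetric]) (auto intro!: carrier_matI mat_sum_cong simp: mat_smult_left mat_smult_right)
  qed
  ultimately show ?thesis by (auto simp: LinearCombinations.module_hom_def kraus_map_def)
qed

lemma mat_trace_kraus_map:
  assumes "\<And>k. k \<in> I \<Longrightarrow> K k \<in> carrier_mat m n" "X \<in> carrier_mat n n" "Y \<in> carrier_mat m m"
  shows "mat_trace (Y * kraus_map m K I X) = mat_trace (mat_sum n n (\<lambda>k. (K k)\<^sup>\<dagger> * (Y * K k)) I * X)"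
proof -
  have dims [simp]: "dim_row (K k) = m" "dim_col (K k) = n" if "k \<in> I" for k using assms(1)[OF that] by auto
  have [simp]: "dim_row X = n" "dim_col X = n" "dim_row Y = m" "dim_col Y = m" using assms by auto
  have "mat_trace (Y * kraus_map m K I X) = (\<Sum>k\<in>I. mat_trace (Y * (K k * (X * (K k)\<^sup>\<dagger>))))"
    unfolding kraus_map_def
    by (subst mat_sum_mult_left) (auto intro!: carrier_matI mat_trace_sum)
  also have "\<dots> = (\<Sum>k\<in>I. mat_trace ((K k)\<^sup>\<dagger> * (Y * K k) * X))"
  proof (rule sum.cong[OF refl])
    fix k assume k: "k \<in> I"
    have "mat_trace (Y * (K k * (X * (K k)\<^sup>\<dagger>))) = mat_trace ((Y * K k * X) * (K k)\<^sup>\<dagger>)"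
      using k by (simp add: mat_assoc)
    also have "\<dots> = mat_trace ((K k)\<^sup>\<dagger> * (Y * K k * X))"
      using k by (intro mat_trace_mult_comm[of _ m n]) (auto intro!: carrier_matI)
    finally show "mat_trace (Y * (K k * (X * (K k)\<^sup>\<dagger>))) = mat_trace ((K k)\<^sup>\<dagger> * (Y * K k) * X)"
      using k by (simp add: mat_assoc)
  qed
  also have "\<dots> = mat_trace (mat_sum n n (\<lambda>k. (K k)\<^sup>\<dagger> * (Y * K k)) I * X)"
    by (subst mat_sum_mult_right) (auto intro!: carrier_matI mat_trace_sum[symmetric])
  finally show ?thesis .
qed

text \<open>Agreement with the Kraus form is asked on the carrier only, since values of a channel
  off the carrier are arbitrary. Cyclicity of the trace supplies the candidate, nondegeneracy its
  uniqueness.\<close>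

lemma adjoint_map_kraus:
  assumes K: "\<And>k. k \<in> I \<Longrightarrow> K k \<in> carrier_mat m n" and Y: "Y \<in> carrier_mat m m"
    and \<Phi>: "\<And>X. X \<in> carrier_mat n n \<Longrightarrow> \<Phi> X = kraus_map m K I X"
  shows "adjoint_map n m \<Phi> Y = mat_sum n n (\<lambda>k. (K k)\<^sup>\<dagger> * (Y * K k)) I"
proof -
  have tr: "mat_trace (Y * \<Phi> X) = mat_trace (mat_sum n n (\<lambda>k. (K k)\<^sup>\<dagger> * (Y * K k)) I * X)"
    if "X \<in> carrier_mat n n" for X
    unfolding \<Phi>[OF that] by (rule mat_trace_kraus_map[OF K that Y])
  show ?thesis
    unfolding adjoint_map_def
  proof (rule the_equality)
    show "mat_sum n n (\<lambda>k. (K k)\<^sup>\<dagger> * (Y * K k)) I \<in> carrier_mat n n \<and>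
      (\<forall>X\<in>carrier_mat n n. mat_trace (Y * \<Phi> X) = mat_trace (mat_sum n n (\<lambda>k. (K k)\<^sup>\<dagger> * (Y * K k)) I * X))"
      using tr by auto
  next
    fix Z assume "Z \<in> carrier_mat n n \<and> (\<forall>X\<in>carrier_mat n n. mat_trace (Y * \<Phi> X) = mat_trace (Z * X))"
    then show "Z = mat_sum n n (\<lambda>k. (K k)\<^sup>\<dagger> * (Y * K k)) I"
      using tr by (intro mat_trace_nondegenerate) auto
  qed
qed

text \<open>The trace of the image of X is the pairing of X with the sum of
  \<open>(K k)\<^sup>\<dagger> * K k\<close>, and the trace itself is the pairing with the identity;
  nondegeneracy compares the two.\<close>

lemma kraus_trace_preserving_iff:
  assumes K: "\<And>k. k \<in> I \<Longrightarrow> K k \<in> carrier_mat m n"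
  shows "(\<forall>X\<in>carrier_mat n n. mat_trace (kraus_map m K I X) = mat_trace X)
    \<longleftrightarrow> mat_sum n n (\<lambda>k. (K k)\<^sup>\<dagger> * K k) I = 1\<^sub>m n"
proof -
  have dims [simp]: "dim_row (K k) = m" "dim_col (K k) = n" if "k \<in> I" for k using K[OF that] by auto
  have *: "mat_trace (kraus_map m K I X) = mat_trace (mat_sum n n (\<lambda>k. (K k)\<^sup>\<dagger> * K k) I * X)"
    if X: "X \<in> carrier_mat n n" for X
  proof -
    have "mat_trace (1\<^sub>m m * kraus_map m K I X) = mat_trace (mat_sum n n (\<lambda>k. (K k)\<^sup>\<dagger> * (1\<^sub>m m * K k)) I * X)"
      by (rule mat_trace_kraus_map[OF K X]) auto
    moreover have "1\<^sub>m m * kraus_map m K I X = kraus_map m K I X"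
      by (simp add: kraus_map_def mat_one_left)
    moreover have "mat_sum n n (\<lambda>k. (K k)\<^sup>\<dagger> * (1\<^sub>m m * K k)) I = mat_sum n n (\<lambda>k. (K k)\<^sup>\<dagger> * K k) I"
      by (intro mat_sum_cong) (auto simp: mat_one_left)
    ultimately show ?thesis by simp
  qed
  show ?thesis
  proof
    assume tp: "\<forall>X\<in>carrier_mat n n. mat_trace (kraus_map m K I X) = mat_trace X"
    show "mat_sum n n (\<lambda>k. (K k)\<^sup>\<dagger> * K k) I = 1\<^sub>m n"
      using tp by (intro mat_trace_nondegenerate) (auto simp: * mat_one_left)
  next
    assume "mat_sum n n (\<lambda>k. (K k)\<^sup>\<dagger> * K k) I = 1\<^sub>m n"
    then show "\<forall>X\<in>carrier_mat n n. mat_trace (kraus_map m K I X) = mat_trace X"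
      by (auto simp: * mat_one_left)
  qed
qed

text \<open>\<open>block_diag k L\<close> is \<open>1 \<otimes> L\<close> with \<open>k\<close> diagonal blocks.\<close>

definition block_diag :: "nat \<Rightarrow> complex mat \<Rightarrow> complex mat" where
  "block_diag k L = mat (k * dim_row L) (k * dim_col L)
     (\<lambda>(i, p). if p div dim_col L = i div dim_row L then L $$ (i mod dim_row L, p mod dim_col L) else 0)"

lemma div_mod_less: "i < k * m \<Longrightarrow> i div m < k \<and> i mod m < (m::nat)"
  by (metis less_mult_imp_div_less mod_less_divisor mult_0_right not_gr_zero not_less_zero)

lemma mult_add_less:
  fixes a :: nat
  assumes "a < k" "i < m"
  shows "a * m + i < k * m"
proof -
  have "a * m + i < Suc a * m" using assms by simp
  also have "\<dots> \<le> k * m" using assms by (intro mult_le_mono1) simp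
  finally show ?thesis .
qed

lemma sum_blocks: "(\<Sum>p<k * n. f p) = (\<Sum>a<k. \<Sum>i<n. f (a * n + i :: nat))"
proof -
  have "(\<Sum>p<k * n. f p) = (\<Sum>a<k. sum f {a * n..<a * n + n})" by (rule sum.nat_group[symmetric])
  also have "\<dots> = (\<Sum>a<k. \<Sum>i<n. f (a * n + i))"
  proof (rule sum.cong[OF refl])
    show "sum f {a * n..<a * n + n} = (\<Sum>i<n. f (a * n + i))" for a
      using sum.shift_bounds_nat_ivl[of f 0 "a * n" n] by (simp add: lessThan_atLeast0 add.commute)
  qed
  finally show ?thesis .
qed

text \<open>Conjugation by \<open>1 \<otimes> L\<close> acts on each block separately. Every index
  is split into a block number and a position in the block, and the block-diagonal factors leave one
  block in each of the two sums.\<close>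

lemma block_diag_conj_index:
  assumes L: "L \<in> carrier_mat m n" and X: "X \<in> carrier_mat (k * n) (k * n)" and ij: "i < k * m" "j < k * m"
  shows "(block_diag k L * (X * (block_diag k L)\<^sup>\<dagger>)) $$ (i, j)
    = (L * (mat_block n X (i div m) (j div m) * L\<^sup>\<dagger>)) $$ (i mod m, j mod m)"
proof -
  have dims [simp]: "dim_row L = m" "dim_col L = n" "dim_row X = k * n" "dim_col X = k * n" using L X by auto
  have B [simp]: "dim_row (block_diag k L) = k * m" "dim_col (block_diag k L) = k * n"
    by (simp_all add: block_diag_def)
  have Mb [simp]: "dim_row (mat_block n X a b) = n" "dim_col (mat_block n X a b) = n" for a b
    by (simp_all add: mat_block_def)
  note bounds = div_mod_less[OF ij(1)] div_mod_less[OF ij(2)]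
  have Bij: "block_diag k L $$ (l, a * n + p) = (if a = l div m then L $$ (l mod m, p) else 0)"
    if "l < k * m" "a < k" "p < n" for l a p
    using that mult_add_less[of a k p n] by (simp add: block_diag_def)
  have inner: "(X * (block_diag k L)\<^sup>\<dagger>) $$ (q, j) = (\<Sum>p<n. X $$ (q, (j div m) * n + p) * cnj (L $$ (j mod m, p)))"
    if q: "q < k * n" for q
  proof -
    have "(X * (block_diag k L)\<^sup>\<dagger>) $$ (q, j) = (\<Sum>p<k * n. X $$ (q, p) * cnj (block_diag k L $$ (j, p)))"
      using q ij by (subst entry_mult) auto
    also have "\<dots> = (\<Sum>a<k. \<Sum>p<n. X $$ (q, a * n + p) * cnj (block_diag k L $$ (j, a * n + p)))"
      by (rule sum_blocks)
    also have "\<dots> = (\<Sum>a<k. if a = j div m then (\<Sum>p<n. X $$ (q, (j div m) * n + p) * cnj (L $$ (j mod m, p))) else 0)"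
      using ij by (intro sum.cong refl) (auto simp: Bij)
    also have "\<dots> = (\<Sum>p<n. X $$ (q, (j div m) * n + p) * cnj (L $$ (j mod m, p)))"
      using bounds by (simp add: sum.delta)
    finally show ?thesis .
  qed
  have "(block_diag k L * (X * (block_diag k L)\<^sup>\<dagger>)) $$ (i, j)
      = (\<Sum>q<k * n. block_diag k L $$ (i, q) * (X * (block_diag k L)\<^sup>\<dagger>) $$ (q, j))"
    using ij by (subst entry_mult) auto
  also have "\<dots> = (\<Sum>a<k. \<Sum>q<n. block_diag k L $$ (i, a * n + q) * (X * (block_diag k L)\<^sup>\<dagger>) $$ (a * n + q, j))"
    by (rule sum_blocks)
  also have "\<dots> = (\<Sum>a<k. if a = i div m then (\<Sum>q<n. L $$ (i mod m, q) *
      (\<Sum>p<n. X $$ ((i div m) * n + q, (j div m) * n + p) * cnj (L $$ (j mod m, p)))) else 0)"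
    using ij by (intro sum.cong refl) (auto simp: Bij inner mult_add_less simp del: index_mult_mat(1))
  also have "\<dots> = (\<Sum>q<n. L $$ (i mod m, q) *
      (\<Sum>p<n. X $$ ((i div m) * n + q, (j div m) * n + p) * cnj (L $$ (j mod m, p))))"
    using bounds by (simp add: sum.delta)
  also have "\<dots> = (\<Sum>q<n. L $$ (i mod m, q) * (mat_block n X (i div m) (j div m) * L\<^sup>\<dagger>) $$ (q, j mod m))"
    using bounds by (intro sum.cong refl) (auto simp: entry_mult mat_block_def simp del: index_mult_mat(1))
  also have "\<dots> = (L * (mat_block n X (i div m) (j div m) * L\<^sup>\<dagger>)) $$ (i mod m, j mod m)"
    using bounds by (simp add: entry_mult del: index_mult_mat(1))
  finally show ?thesis .
qed

text \<open>The ampliation of a map in Kraus form is the sum of the conjugations by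
  \<open>1 \<otimes> K\<^sub>l\<close>, and congruences preserve positivity.\<close>

lemma channel_kraus_map:
  assumes K: "\<And>k. k \<in> I \<Longrightarrow> K k \<in> carrier_mat m n"
    and one: "mat_sum n n (\<lambda>k. (K k)\<^sup>\<dagger> * K k) I = 1\<^sub>m n"
  shows "channel n m (kraus_map m K I)"
  unfolding channel_def
proof (intro conjI)
  show "completely_positive n m (kraus_map m K I)"
    unfolding completely_positive_def
  proof (intro allI impI)
    fix k X assume pos: "positive_op (k * n) X"
    have X: "X \<in> carrier_mat (k * n) (k * n)" using pos by (simp add: positive_op_def)
    have Bc: "block_diag k (K l) \<in> carrier_mat (k * m) (k * n)" if "l \<in> I" for l
      using K[OF that] by (auto simp: block_diag_def)
    have "ampliation k n m (kraus_map m K I) X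
        = mat_sum (k * m) (k * m) (\<lambda>l. block_diag k (K l) * (X * (block_diag k (K l))\<^sup>\<dagger>)) I"
    proof (rule eq_matI)
      fix i j
      assume "i < dim_row (mat_sum (k * m) (k * m) (\<lambda>l. block_diag k (K l) * (X * (block_diag k (K l))\<^sup>\<dagger>)) I)"
        "j < dim_col (mat_sum (k * m) (k * m) (\<lambda>l. block_diag k (K l) * (X * (block_diag k (K l))\<^sup>\<dagger>)) I)"
      then have ij: "i < k * m" "j < k * m" by auto
      have "(\<Sum>l\<in>I. (K l * (mat_block n X (i div m) (j div m) * (K l)\<^sup>\<dagger>)) $$ (i mod m, j mod m))
          = (\<Sum>l\<in>I. (block_diag k (K l) * (X * (block_diag k (K l))\<^sup>\<dagger>)) $$ (i, j))"
        using K by (intro sum.cong refl block_diag_conj_index[OF _ X ij, symmetric])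
      then show "ampliation k n m (kraus_map m K I) X $$ (i, j)
          = mat_sum (k * m) (k * m) (\<lambda>l. block_diag k (K l) * (X * (block_diag k (K l))\<^sup>\<dagger>)) I $$ (i, j)"
        using ij div_mod_less[OF ij(1)] div_mod_less[OF ij(2)]
        by (simp add: ampliation_def kraus_map_def del: index_mult_mat(1))
    qed (auto simp: ampliation_def)
    moreover have "positive_op (k * m) (block_diag k (K l) * (X * (block_diag k (K l))\<^sup>\<dagger>))" if "l \<in> I" for l
      using positive_op_congruence[OF pos Bc[OF that]] Bc[OF that] X by (simp add: mat_assoc)
    ultimately show "positive_op (k * m) (ampliation k n m (kraus_map m K I) X)"
      by (simp add: positive_op_sum)
  qed
next
  show "kraus_map m K I \<in> LinearCombinations.module_hom class_ring (op_algebra n) (op_algebra m)"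
    by (rule kraus_map_linear[OF K])
  show "\<forall>X\<in>carrier_mat n n. mat_trace (kraus_map m K I X) = mat_trace X"
    using kraus_trace_preserving_iff[of I K m n, OF K] one by simp
qed

lemma finsum_op_algebra:
  assumes "finite I" "\<And>k. k \<in> I \<Longrightarrow> f k \<in> carrier_mat m m"
  shows "finsum (op_algebra m) f I = mat_sum m m f I"
proof -
  interpret star_algebra "op_algebra m" by (rule star_algebra_op_algebra)
  show ?thesis
    using assms
  proof (induction I rule: finite_induct)
    case empty
    then show ?case by (auto simp: mat_sum_zero)
  next
    case (insert k I)
    then show ?case by (subst M.finsum_insert) (auto simp: mat_sum_insert Pi_iff)
  qed
qed

lemma kraus_rep_iff:
  "kraus_rep n m \<Phi> k K \<longleftrightarrow>
     (\<forall>i<k. K i \<in> carrier_mat m n) \<and> (\<forall>X\<in>carrier_mat n n. \<Phi> X = kraus_map m K {..<k} X)"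
proof -
  have "(\<Oplus>\<^bsub>op_algebra m\<^esub>i\<in>{..<k}. K i * X * (K i)\<^sup>\<dagger>) = kraus_map m K {..<k} X"
    if K: "\<forall>i<k. K i \<in> carrier_mat m n" and X: "X \<in> carrier_mat n n" for X
  proof -
    have [simp]: "dim_row (K i) = m" "dim_col (K i) = n" if "i < k" for i using K that by auto
    have [simp]: "dim_row X = n" "dim_col X = n" using X by auto
    have "(\<Oplus>\<^bsub>op_algebra m\<^esub>i\<in>{..<k}. K i * X * (K i)\<^sup>\<dagger>) = mat_sum m m (\<lambda>i. K i * X * (K i)\<^sup>\<dagger>) {..<k}"
      by (rule finsum_op_algebra) (auto intro!: carrier_matI)
    then show ?thesis by (auto simp: kraus_map_def mat_assoc intro!: mat_sum_cong)
  qed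
  then show ?thesis unfolding kraus_rep_def by auto
qed

text \<open>Choi's theorem: factor the image of the unnormalised maximally entangled state under the
  ampliation, and reshape the columns of the factor.\<close>

theorem channel_has_kraus_rep:
  assumes "channel n m \<Phi>"
  obtains k K where "kraus_rep n m \<Phi> k K"
proof -
  have lin: "\<Phi> \<in> LinearCombinations.module_hom class_ring (op_algebra n) (op_algebra m)"
    and cp: "completely_positive n m \<Phi>"
    using assms by (auto simp: channel_def)
  \<comment> \<open>The sum of the vectors \<open>e_a \<otimes> e_a\<close>, written as a one-column
    matrix. The blocks of \<open>w * w\<^sup>\<dagger>\<close> are exactly the matrix units, so its
    ampliation contains all values of \<open>\<Phi>\<close> on a basis.\<close>
  define w :: "complex mat" where "w = mat (n * n) 1 (\<lambda>(p, _). if p div n = p mod n then 1 else 0)"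
  define \<Omega> where "\<Omega> = w * 1\<^sub>m 1 * w\<^sup>\<dagger>"
  have w: "w \<in> carrier_mat (n * n) 1" by (simp add: w_def)
  have [simp]: "dim_row w = n * n" "dim_col w = 1" by (simp_all add: w_def)
  have \<Omega>_index: "\<Omega> $$ (p, q) = (if p div n = p mod n \<and> q div n = q mod n then 1 else 0)"
    if "p < n * n" "q < n * n" for p q
  proof -
    have "\<Omega> = w * w\<^sup>\<dagger>" using w by (simp add: \<Omega>_def mat_one_right)
    then have "\<Omega> $$ (p, q) = (\<Sum>k<1. w $$ (p, k) * cnj (w $$ (q, k)))"
      using that by (simp add: entry_mult del: index_mult_mat(1))
    then show ?thesis using that by (auto simp: w_def)
  qed
  have block: "mat_block n \<Omega> a b = mat_unit n n a b" if "a < n" "b < n" for a b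
    using that by (intro eq_matI) (auto simp: mat_block_def \<Omega>_index mult_add_less)
  have "positive_op (n * n) \<Omega>" unfolding \<Omega>_def by (rule positive_op_congruence[OF positive_op_one w])
  then have "positive_op (n * m) (ampliation n n m \<Phi> \<Omega>)" using cp by (simp add: completely_positive_def)
  then obtain W where W: "W \<in> carrier_mat (n * m) (n * m)" "ampliation n n m \<Phi> \<Omega> = W * W\<^sup>\<dagger>"
    by (rule positive_op_factor)
  \<comment> \<open>Column l of W, of length n * m, is cut into n pieces of length m, which become
    the columns of \<open>K l\<close>. Row \<open>a * m + i\<close> of W thus corresponds to entry
    (i, a).\<close>
  define K where "K l = mat m n (\<lambda>(i, a). W $$ (a * m + i, l))" for l
  have K: "K l \<in> carrier_mat m n" for l by (simp add: K_def)
  have dimK [simp]: "dim_row (K l) = m" "dim_col (K l) = n" for l by (simp_all add: K_def)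
  have "\<Phi> (mat_unit n n a b) = kraus_map m K {..<n * m} (mat_unit n n a b)" if ab: "a < n" "b < n" for a b
  proof (rule eq_matI)
    have \<Phi>E: "\<Phi> (mat_unit n n a b) \<in> carrier_mat m m"
      using lin by (auto simp: LinearCombinations.module_hom_def)
    then show "dim_row (\<Phi> (mat_unit n n a b)) = dim_row (kraus_map m K {..<n * m} (mat_unit n n a b))"
      "dim_col (\<Phi> (mat_unit n n a b)) = dim_col (kraus_map m K {..<n * m} (mat_unit n n a b))"
      by (auto simp: kraus_map_def)
    fix i j assume "i < dim_row (kraus_map m K {..<n * m} (mat_unit n n a b))"
      "j < dim_col (kraus_map m K {..<n * m} (mat_unit n n a b))"
    then have ij: "i < m" "j < m" by (auto simp: kraus_map_def)
    have ai: "a * m + i < n * m" and bj: "b * m + j < n * m" using ab ij by (auto intro: mult_add_less)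
    have K_unit: "(K l * (mat_unit n n a b * (K l)\<^sup>\<dagger>)) $$ (i, j) = K l $$ (i, a) * cnj (K l $$ (j, b))" for l
    proof -
      have in1: "(mat_unit n n a b * (K l)\<^sup>\<dagger>) $$ (p, j) = (if p = a then cnj (K l $$ (j, b)) else 0)" if "p < n" for p
      proof -
        have "(mat_unit n n a b * (K l)\<^sup>\<dagger>) $$ (p, j) = (\<Sum>q<n. mat_unit n n a b $$ (p, q) * (K l)\<^sup>\<dagger> $$ (q, j))"
          using that ij by (subst entry_mult) auto
        also have "\<dots> = (\<Sum>q<n. if q = b then (if p = a then cnj (K l $$ (j, b)) else 0) else 0)"
          using that ij by (intro sum.cong refl) auto
        finally show ?thesis using ab by (simp add: sum.delta)
      qed
      have "(K l * (mat_unit n n a b * (K l)\<^sup>\<dagger>)) $$ (i, j)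
          = (\<Sum>p<n. K l $$ (i, p) * (mat_unit n n a b * (K l)\<^sup>\<dagger>) $$ (p, j))"
        using ij by (subst entry_mult) auto
      also have "\<dots> = (\<Sum>p<n. if p = a then K l $$ (i, a) * cnj (K l $$ (j, b)) else 0)"
        by (intro sum.cong refl) (auto simp: in1 simp del: index_mult_mat(1))
      finally show ?thesis using ab by (simp add: sum.delta)
    qed
    have "\<Phi> (mat_unit n n a b) $$ (i, j) = ampliation n n m \<Phi> \<Omega> $$ (a * m + i, b * m + j)"
      using ai bj ij ab by (simp add: ampliation_def block)
    also have "\<dots> = (\<Sum>l<n * m. W $$ (a * m + i, l) * cnj (W $$ (b * m + j, l)))"
      unfolding W(2) using W(1) ai bj by (subst entry_mult) auto
    also have "\<dots> = (\<Sum>l<n * m. (K l * (mat_unit n n a b * (K l)\<^sup>\<dagger>)) $$ (i, j))"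
      unfolding K_unit using ij ab by (simp add: K_def)
    finally show "\<Phi> (mat_unit n n a b) $$ (i, j) = kraus_map m K {..<n * m} (mat_unit n n a b) $$ (i, j)"
      using ij by (simp add: kraus_map_def del: index_mult_mat(1))
  qed
  then have "\<Phi> X = kraus_map m K {..<n * m} X" if "X \<in> carrier_mat n n" for X
    by (rule linear_eqI[OF lin kraus_map_linear[OF K] _ that])
  then have "kraus_rep n m \<Phi> (n * m) K" using K by (auto simp: kraus_rep_iff)
  then show ?thesis by (rule that)
qed

lemma kraus_rep_unital:
  assumes "channel n m \<Phi>" "kraus_rep n m \<Phi> k K"
  shows "mat_sum n n (\<lambda>i. (K i)\<^sup>\<dagger> * K i) {..<k} = 1\<^sub>m n"
proof -
  have K: "K i \<in> carrier_mat m n" if "i \<in> {..<k}" for i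
    using assms(2) that by (auto simp: kraus_rep_iff)
  have "\<forall>X\<in>carrier_mat n n. mat_trace (kraus_map m K {..<k} X) = mat_trace X"
    using assms by (auto simp: kraus_rep_iff channel_def)
  then show ?thesis using kraus_trace_preserving_iff[of "{..<k}" K m n, OF K] by simp
qed

lemma kraus_map_comp:
  assumes "finite I" "finite J" and L: "\<And>x. x \<in> I \<Longrightarrow> L x \<in> carrier_mat p m"
    and K: "\<And>j. j \<in> J \<Longrightarrow> K j \<in> carrier_mat m n" and X: "X \<in> carrier_mat n n"
  shows "kraus_map p L I (kraus_map m K J X) = kraus_map p (\<lambda>(x, j). L x * K j) (I \<times> J) X"
proof -
  have [simp]: "dim_row (L x) = p" "dim_col (L x) = m" if "x \<in> I" for x using L[OF that] by auto
  have [simp]: "dim_row (K j) = m" "dim_col (K j) = n" if "j \<in> J" for j using K[OF that] by auto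
  have [simp]: "dim_row X = n" "dim_col X = n" using X by auto
  have "L x * (kraus_map m K J X * (L x)\<^sup>\<dagger>) = mat_sum p p (\<lambda>j. (L x * K j) * (X * (L x * K j)\<^sup>\<dagger>)) J"
    if x: "x \<in> I" for x
  proof -
    have "kraus_map m K J X * (L x)\<^sup>\<dagger> = mat_sum m p (\<lambda>j. K j * (X * (K j)\<^sup>\<dagger>) * (L x)\<^sup>\<dagger>) J"
      unfolding kraus_map_def using x by (subst mat_sum_mult_right) (auto intro!: carrier_matI)
    then have "L x * (kraus_map m K J X * (L x)\<^sup>\<dagger>) = mat_sum p p (\<lambda>j. L x * (K j * (X * (K j)\<^sup>\<dagger>) * (L x)\<^sup>\<dagger>)) J"
      using x by (simp, subst mat_sum_mult_left) (auto intro!: carrier_matI)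
    also have "\<dots> = mat_sum p p (\<lambda>j. (L x * K j) * (X * (L x * K j)\<^sup>\<dagger>)) J"
      using x by (intro mat_sum_cong refl) (simp add: mat_assoc adj_mult)
    finally show ?thesis .
  qed
  then have "kraus_map p L I (kraus_map m K J X)
      = mat_sum p p (\<lambda>x. mat_sum p p (\<lambda>j. (L x * K j) * (X * (L x * K j)\<^sup>\<dagger>)) J) I"
    by (auto simp: kraus_map_def[of p L] intro!: mat_sum_cong)
  also have "\<dots> = kraus_map p (\<lambda>(x, j). L x * K j) (I \<times> J) X"
    unfolding kraus_map_def mat_sum_Sigma[OF assms(1,2)] by (intro mat_sum_cong) auto
  finally show ?thesis .
qed

lemma mat_unit_adj: "(mat_unit n m a b)\<^sup>\<dagger> = mat_unit m n b a"
  by (rule eq_matI) auto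

text \<open>This is the trace condition for the operators \<open>mat_unit n m 0 c\<close>, which
  send every state to the pure state \<open>e_0\<close>; \<open>0 < n\<close> ensures that this
  vector exists.\<close>

lemma sum_mat_unit_mult:
  assumes "0 < n"
  shows "mat_sum m m (\<lambda>c. mat_unit m n c 0 * mat_unit n m 0 c) {..<m} = 1\<^sub>m m"
proof (rule eq_matI)
  fix i j assume "i < dim_row (1\<^sub>m m :: complex mat)" "j < dim_col (1\<^sub>m m :: complex mat)"
  then have ij: "i < m" "j < m" by auto
  have "(mat_unit m n c 0 * mat_unit n m 0 c) $$ (i, j) = (if c = i then if i = j then 1 else 0 else 0)" if "c < m" for c
  proof -
    have "(mat_unit m n c 0 * mat_unit n m 0 c) $$ (i, j) = (\<Sum>l<n. mat_unit m n c 0 $$ (i, l) * mat_unit n m 0 c $$ (l, j))"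
      using ij by (subst entry_mult) auto
    also have "\<dots> = (\<Sum>l<n. if l = 0 then (if c = i then if i = j then 1 else 0 else 0) else 0)"
      using ij by (intro sum.cong refl) auto
    finally show ?thesis using assms by (simp add: sum.delta)
  qed
  then have "mat_sum m m (\<lambda>c. mat_unit m n c 0 * mat_unit n m 0 c) {..<m} $$ (i, j)
      = (\<Sum>c<m. if c = i then if i = j then 1 else 0 else 0)"
    using ij by (simp del: index_mult_mat(1))
  then show "mat_sum m m (\<lambda>c. mat_unit m n c 0 * mat_unit n m 0 c) {..<m} $$ (i, j) = 1\<^sub>m m $$ (i, j)"
    using ij by (simp add: sum.delta)
qed auto

subsection \<open>Correctable algebras and the commutant\<close>

lemma kraus_generator_in_span:
  assumes "\<And>i. i < k \<Longrightarrow> K i \<in> carrier_mat m n" "i < k" "j < k"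
  shows "(K i)\<^sup>\<dagger> * K j \<in> kraus_span n k K"
proof -
  interpret Module.module "class_ring :: complex ring" "op_algebra n" by (rule module_op_algebra)
  have "{(K i)\<^sup>\<dagger> * K j | i j. i < k \<and> j < k} \<subseteq> carrier (op_algebra n)"
    using assms(1) by (auto intro!: mult_carrier_mat[of _ n m] adj_carrier)
  then show ?thesis unfolding kraus_span_def using in_own_span assms(2,3) by blast
qed

text \<open>The recovery channel is the transpose channel \<open>Y \<mapsto> \<Phi>\<^sup>*(R Y R)\<close> with \<open>R = \<Phi>(1)\<close> to the power
  \<open>-1/2\<close>, completed by a channel that sends everything outside the support of \<open>\<Phi>(1)\<close> to a fixed
  pure state.\<close>

lemma correctable_commutant:
  assumes n: "0 < n" and ch: "channel n m \<Phi>" and kr: "kraus_rep n m \<Phi> k K"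
    and S: "star_subalgebra n (kraus_span n k K)"
  shows "correctable n m \<Phi> (commutant n (kraus_span n k K))"
proof -
  have K: "K i \<in> carrier_mat m n" if "i < k" for i using kr that by (auto simp: kraus_rep_iff)
  have \<Phi>: "\<Phi> X = kraus_map m K {..<k} X" if "X \<in> carrier_mat n n" for X using kr that by (auto simp: kraus_rep_iff)
  interpret F: operator_family m n "{..<k}" K by unfold_locales (auto intro: K)
  have dimK [simp]: "dim_row (K i) = m" "dim_col (K i) = n" if "i < k" for i using K[OF that] by auto
  have comm: "X \<in> F.commuting" if "X \<in> commutant n (kraus_span n k K)" for X
    using that kraus_generator_in_span[of k K m n] K by (auto simp: F.commuting_def commutant_def)
  \<comment> \<open>The left branch gives the Kraus operators of the transpose channel, the right
    branch those of the reset to \<open>e_0\<close> after projection off the support.\<close>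
  define L where "L x = (case x of Inl i \<Rightarrow> (K i)\<^sup>\<dagger> * F.root | Inr c \<Rightarrow> mat_unit n m 0 c * F.co_supp)" for x
  define I where "I = {..<k} <+> {..<m}"
  have I: "finite I" by (simp add: I_def)
  have L: "L x \<in> carrier_mat n m" if "x \<in> I" for x
    using that by (auto simp: L_def I_def intro!: carrier_matI)
  \<comment> \<open>The left branch contributes \<open>supp\<close>, the right one
    \<open>co_supp\<close>, so together they preserve the trace.\<close>
  have "mat_sum m m (\<lambda>x. (L x)\<^sup>\<dagger> * L x) I
      = mat_sum m m (\<lambda>i. F.root * (K i * (K i)\<^sup>\<dagger> * F.root)) {..<k}
      + mat_sum m m (\<lambda>c. F.co_supp * (mat_unit m n c 0 * mat_unit n m 0 c * F.co_supp)) {..<m}"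
    unfolding I_def mat_sum_Plus[OF finite_lessThan finite_lessThan]
    by (intro arg_cong2[of _ _ _ _ "(+)"] mat_sum_cong refl)
      (simp_all add: L_def adj_mult mat_assoc F.root_adj F.co_supp_adj mat_unit_adj)
  also have "mat_sum m m (\<lambda>i. F.root * (K i * (K i)\<^sup>\<dagger> * F.root)) {..<k} = F.root * (F.gram * F.root)"
    unfolding F.gram_def
    by (subst mat_sum_mult_right, auto intro!: carrier_matI, subst mat_sum_mult_left, auto intro!: carrier_matI)
  also have "\<dots> = F.supp" by (rule F.supp_eqs(2)[symmetric])
  also have "mat_sum m m (\<lambda>c. F.co_supp * (mat_unit m n c 0 * mat_unit n m 0 c * F.co_supp)) {..<m}
      = F.co_supp * (mat_sum m m (\<lambda>c. mat_unit m n c 0 * mat_unit n m 0 c) {..<m} * F.co_supp)"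
    by (subst mat_sum_mult_right, auto intro!: carrier_matI, subst mat_sum_mult_left, auto intro!: carrier_matI)
  also have "\<dots> = F.co_supp"
    unfolding sum_mat_unit_mult[OF n] by (simp add: mat_one_left F.co_supp_co_supp)
  finally have "mat_sum m m (\<lambda>x. (L x)\<^sup>\<dagger> * L x) I = 1\<^sub>m m" by (simp add: F.supp_add_co_supp)
  then have D: "channel m n (kraus_map n L I)" by (intro channel_kraus_map) (auto intro: L)
  have one: "mat_sum n n (\<lambda>i. (K i)\<^sup>\<dagger> * K i) {..<k} = 1\<^sub>m n" by (rule kraus_rep_unital[OF ch kr])
  have "adjoint_map n n (kraus_map n L I \<circ> compression (1\<^sub>m n) \<Phi>) X = X"
    if X: "X \<in> commutant n (kraus_span n k K)" for X
  proof -
    have Xc: "X \<in> carrier_mat n n" using X by (simp add: commutant_def)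
    then have [simp]: "dim_row X = n" "dim_col X = n" by auto
    have "(kraus_map n L I \<circ> compression (1\<^sub>m n) \<Phi>) Y = kraus_map n (\<lambda>(x, j). L x * K j) (I \<times> {..<k}) Y"
      if Y: "Y \<in> carrier_mat n n" for Y
    proof -
      have "compression (1\<^sub>m n) \<Phi> Y = kraus_map m K {..<k} Y"
        using Y \<Phi>[OF Y] by (simp add: compression_def)
      then show ?thesis using kraus_map_comp[OF I finite_lessThan L K Y] by simp
    qed
    then have "adjoint_map n n (kraus_map n L I \<circ> compression (1\<^sub>m n) \<Phi>) X
        = mat_sum n n (\<lambda>y. ((\<lambda>(x, j). L x * K j) y)\<^sup>\<dagger> * (X * (\<lambda>(x, j). L x * K j) y)) (I \<times> {..<k})"
      by (intro adjoint_map_kraus[OF _ Xc]) (auto dest: L intro!: carrier_matI)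
    also have "\<dots> = mat_sum n n (\<lambda>(x, j). (L x * K j)\<^sup>\<dagger> * (X * (L x * K j))) (I \<times> {..<k})"
      by (intro mat_sum_cong refl) auto
    also have "\<dots> = mat_sum n n (\<lambda>j. mat_sum n n (\<lambda>x. (L x * K j)\<^sup>\<dagger> * (X * (L x * K j))) I) {..<k}"
      unfolding mat_sum_Sigma[OF I finite_lessThan, symmetric] by (rule mat_sum_swap)
    also have "\<dots> = mat_sum n n (\<lambda>j. (K j)\<^sup>\<dagger> * K j * X) {..<k}"
    proof (rule mat_sum_cong[OF refl])
      fix j assume "j \<in> {..<k}"
      then have j: "j < k" by simp
      \<comment> \<open>The reset branch never acts on an output of the channel, because
        \<open>co_supp\<close> annihilates every \<open>K j\<close>.\<close>
      have inr: "(L (Inr c) * K j)\<^sup>\<dagger> * (X * (L (Inr c) * K j)) = 0\<^sub>m n n" for c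
      proof -
        have "L (Inr c) * K j = mat_unit n m 0 c * (F.co_supp * K j)" using j by (simp add: L_def mat_assoc)
        also have "\<dots> = 0\<^sub>m n n" using j by (subst F.co_supp_T) auto
        finally show ?thesis by simp
      qed
      have inl: "(L (Inl i) * K j)\<^sup>\<dagger> * (X * (L (Inl i) * K j))
          = (K j)\<^sup>\<dagger> * (F.root * (K i * (X * (K i)\<^sup>\<dagger>) * (F.root * K j)))" if "i < k" for i
        using j that by (simp add: L_def adj_mult mat_assoc F.root_adj)
      have "mat_sum n n (\<lambda>x. (L x * K j)\<^sup>\<dagger> * (X * (L x * K j))) I
          = mat_sum n n (\<lambda>i. (L (Inl i) * K j)\<^sup>\<dagger> * (X * (L (Inl i) * K j))) {..<k}
          + mat_sum n n (\<lambda>c. (L (Inr c) * K j)\<^sup>\<dagger> * (X * (L (Inr c) * K j))) {..<m}"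
        unfolding I_def by (rule mat_sum_Plus) auto
      also have "\<dots> = mat_sum n n (\<lambda>i. (K j)\<^sup>\<dagger> * (F.root * (K i * (X * (K i)\<^sup>\<dagger>) * (F.root * K j)))) {..<k} + 0\<^sub>m n n"
        using inl inr by (intro arg_cong2[of _ _ _ _ "(+)"] mat_sum_cong mat_sum_zero refl) auto
      also have "\<dots> = mat_sum n n (\<lambda>i. (K j)\<^sup>\<dagger> * (F.root * (K i * (X * (K i)\<^sup>\<dagger>) * (F.root * K j)))) {..<k}"
        by (intro right_add_zero_mat) auto
      also have "\<dots> = (K j)\<^sup>\<dagger> * (F.root * (F.conj_sum X * (F.root * K j)))"
      proof -
        have "F.conj_sum X * (F.root * K j) = mat_sum m n (\<lambda>i. K i * (X * (K i)\<^sup>\<dagger>) * (F.root * K j)) {..<k}"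
          unfolding F.conj_sum_def using j by (subst mat_sum_mult_right) (auto intro!: carrier_matI)
        moreover have "F.root * \<dots> = mat_sum m n (\<lambda>i. F.root * (K i * (X * (K i)\<^sup>\<dagger>) * (F.root * K j))) {..<k}"
          using j by (subst mat_sum_mult_left) (auto intro!: carrier_matI)
        moreover have "(K j)\<^sup>\<dagger> * \<dots> = mat_sum n n (\<lambda>i. (K j)\<^sup>\<dagger> * (F.root * (K i * (X * (K i)\<^sup>\<dagger>) * (F.root * K j)))) {..<k}"
          using j by (subst mat_sum_mult_left) (auto intro!: carrier_matI)
        ultimately show ?thesis by simp
      qed
      \<comment> \<open>The sum over the transpose branch has assembled into the lift of X, which
        can be moved through \<open>K j\<close>. Summing over j then leaves X times the unital
        sum.\<close>
      also have "\<dots> = (K j)\<^sup>\<dagger> * (F.lift X * K j)" using j by (simp add: F.lift_def mat_assoc)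
      also have "F.lift X * K j = K j * X" using F.lift_T[OF comm[OF X], of j] j by simp
      finally show "mat_sum n n (\<lambda>x. (L x * K j)\<^sup>\<dagger> * (X * (L x * K j))) I = (K j)\<^sup>\<dagger> * K j * X"
        using j by (simp add: mat_assoc)
    qed
    also have "\<dots> = mat_sum n n (\<lambda>j. (K j)\<^sup>\<dagger> * K j) {..<k} * X"
      by (subst mat_sum_mult_right) (auto intro!: carrier_matI)
    also have "\<dots> = X" by (simp add: one mat_one_left)
    finally show ?thesis .
  qed
  moreover have C: "unital_star_subalgebra n (commutant n (kraus_span n k K))"
    by (rule unital_star_subalgebra_commutant[OF S])
  moreover have "1\<^sub>m n * X = X" "X * 1\<^sub>m n = X" if "X \<in> commutant n (kraus_span n k K)" for X
    using that by (auto simp: commutant_def)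
  \<comment> \<open>The unit of the commutant is the full identity, so the subspace is the whole
    space and both P and V are \<open>1\<^sub>m n\<close>.\<close>
  ultimately show ?thesis
    using D unfolding correctable_def unital_star_subalgebra_def
    by (intro conjI exI[of _ "1\<^sub>m n"] exI[of _ n] exI[of _ "kraus_map n L I"]) auto
qed

text \<open>If a unital completely positive map fixes \<open>X\<close>, \<open>X\<^sup>\<dagger>\<close> and \<open>X\<^sup>\<dagger> X\<close>, then the sum of the positive
  operators \<open>[N\<^sub>k, X]\<^sup>\<dagger> [N\<^sub>k, X]\<close> vanishes.\<close>

lemma kraus_operators_commute_with_fixed:
  assumes "finite I" and N: "\<And>k. k \<in> I \<Longrightarrow> N k \<in> carrier_mat r r" and X: "X \<in> carrier_mat r r"
    and one: "mat_sum r r (\<lambda>k. (N k)\<^sup>\<dagger> * N k) I = 1\<^sub>m r"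
    and fixed: "mat_sum r r (\<lambda>k. (N k)\<^sup>\<dagger> * (X * N k)) I = X"
      "mat_sum r r (\<lambda>k. (N k)\<^sup>\<dagger> * (X\<^sup>\<dagger> * N k)) I = X\<^sup>\<dagger>"
      "mat_sum r r (\<lambda>k. (N k)\<^sup>\<dagger> * (X\<^sup>\<dagger> * X * N k)) I = X\<^sup>\<dagger> * X"
    and k: "k \<in> I"
  shows "N k * X = X * N k"
proof -
  have [simp]: "dim_row (N k) = r" "dim_col (N k) = r" if "k \<in> I" for k using N[OF that] by auto
  have [simp]: "dim_row X = r" "dim_col X = r" using X by auto
  define C where "C k = N k * X - X * N k" for k
  have C: "C k \<in> carrier_mat r r" if "k \<in> I" for k using that by (auto simp: C_def intro!: carrier_matI)
  \<comment> \<open>After summation each of the four terms of the expanded square becomes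
    \<open>X\<^sup>\<dagger> * X\<close>, two with each sign.\<close>
  have CC: "(C k)\<^sup>\<dagger> * C k = X\<^sup>\<dagger> * ((N k)\<^sup>\<dagger> * N k * X) - (N k)\<^sup>\<dagger> * (X\<^sup>\<dagger> * N k) * X
      - (X\<^sup>\<dagger> * ((N k)\<^sup>\<dagger> * (X * N k)) - (N k)\<^sup>\<dagger> * (X\<^sup>\<dagger> * X * N k))" if "k \<in> I" for k
    using that by (simp add: C_def adj_minus adj_mult mat_minus_left mat_minus_right mat_assoc)
  have "mat_sum r r (\<lambda>k. (C k)\<^sup>\<dagger> * C k) I
      = mat_sum r r (\<lambda>k. X\<^sup>\<dagger> * ((N k)\<^sup>\<dagger> * N k * X)) I - mat_sum r r (\<lambda>k. (N k)\<^sup>\<dagger> * (X\<^sup>\<dagger> * N k) * X) I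
      - (mat_sum r r (\<lambda>k. X\<^sup>\<dagger> * ((N k)\<^sup>\<dagger> * (X * N k))) I - mat_sum r r (\<lambda>k. (N k)\<^sup>\<dagger> * (X\<^sup>\<dagger> * X * N k)) I)"
    by (simp add: CC cong: mat_sum_cong) ((subst mat_sum_minus, (auto intro!: carrier_matI)[2])+, rule refl)
  also have "mat_sum r r (\<lambda>k. X\<^sup>\<dagger> * ((N k)\<^sup>\<dagger> * N k * X)) I = X\<^sup>\<dagger> * (mat_sum r r (\<lambda>k. (N k)\<^sup>\<dagger> * N k) I * X)"
    by (subst mat_sum_mult_right, auto intro!: carrier_matI, subst mat_sum_mult_left, auto intro!: carrier_matI)
  also have "mat_sum r r (\<lambda>k. X\<^sup>\<dagger> * ((N k)\<^sup>\<dagger> * (X * N k))) I = X\<^sup>\<dagger> * mat_sum r r (\<lambda>k. (N k)\<^sup>\<dagger> * (X * N k)) I"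
    by (subst mat_sum_mult_left) (auto intro!: carrier_matI)
  also have "mat_sum r r (\<lambda>k. (N k)\<^sup>\<dagger> * (X\<^sup>\<dagger> * N k) * X) I = mat_sum r r (\<lambda>k. (N k)\<^sup>\<dagger> * (X\<^sup>\<dagger> * N k)) I * X"
    by (subst mat_sum_mult_right) (auto intro!: carrier_matI)
  \<comment> \<open>The double adjoint presents the sum as one of terms
    \<open>B B\<^sup>\<dagger>\<close> with B the adjoint of \<open>C k\<close>, the form covered by
    the vanishing criterion.\<close>
  finally have "mat_sum r r (\<lambda>k. (C k)\<^sup>\<dagger> * (C k)\<^sup>\<dagger>\<^sup>\<dagger>) I = 0\<^sub>m r r"
    by (simp add: one fixed mat_one_left mat_minus_self)
  then have "(C k)\<^sup>\<dagger> = 0\<^sub>m r r"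
    by (rule sum_mult_adj_eq_zeroD[where B = "\<lambda>k. (C k)\<^sup>\<dagger>", OF assms(1) _ _ k, rotated])
      (auto intro!: adj_carrier C)
  then have "C k = 0\<^sub>m r r" by (metis adj_adj adj_zero)
  then have "C k $$ (i, j) = 0" if "i < r" "j < r" for i j using that by simp
  then show ?thesis using k by (intro eq_matI) (auto simp: C_def simp del: index_mult_mat(1))
qed

section \<open>Lifting from the compression to the full space\<close>

lemma kraus_span_induct:
  assumes "Z \<in> kraus_span n k K" "\<And>i. i < k \<Longrightarrow> K i \<in> carrier_mat m n"
    and "\<And>i j. i < k \<Longrightarrow> j < k \<Longrightarrow> Q ((K i)\<^sup>\<dagger> * K j)" "Q (0\<^sub>m n n)"
    and "\<And>X Y. X \<in> carrier_mat n n \<Longrightarrow> Y \<in> carrier_mat n n \<Longrightarrow> Q X \<Longrightarrow> Q Y \<Longrightarrow> Q (X + Y)"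
    and "\<And>c X. X \<in> carrier_mat n n \<Longrightarrow> Q X \<Longrightarrow> Q (c \<cdot>\<^sub>m X)"
  shows "Q Z"
proof -
  interpret Module.module "class_ring :: complex ring" "op_algebra n" by (rule module_op_algebra)
  have "submodule class_ring {X \<in> carrier_mat n n. Q X} (op_algebra n)"
    unfolding submodule_def using assms(4-6) module_op_algebra by auto
  moreover have "{(K i)\<^sup>\<dagger> * K j | i j. i < k \<and> j < k} \<subseteq> {X \<in> carrier_mat n n. Q X}"
    using assms(2,3) by (auto intro!: mult_carrier_mat[of _ n m] adj_carrier)
  ultimately have "kraus_span n k K \<subseteq> {X \<in> carrier_mat n n. Q X}"
    unfolding kraus_span_def by (intro span_is_subset)
  then show ?thesis using assms(1) by auto
qed

text \<open>The commutant of \<open>V\<^sup>\<dagger> S V\<close> on the smaller space. For an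
  isometry V this is the compression of S to the range of V, and in general that set is not closed
  under products.\<close>

definition compressed_commutant :: "nat \<Rightarrow> complex mat \<Rightarrow> complex mat set \<Rightarrow> complex mat set" where
  "compressed_commutant r V S =
     {X \<in> carrier_mat r r. \<forall>Z\<in>S. V\<^sup>\<dagger> * (Z * V) * X = X * (V\<^sup>\<dagger> * (Z * V))}"

text \<open>Arveson's commutant lifting for the compression \<open>Z \<mapsto> V\<^sup>\<dagger> Z V\<close> of the identity representation of \<open>S\<close>.\<close>

theorem commutant_lifting:
  assumes K: "\<And>i. i < k \<Longrightarrow> K i \<in> carrier_mat m n" and S: "S = kraus_span n k K"
    and alg: "unital_star_subalgebra n S" and V: "V \<in> carrier_mat n r"
  obtains H where
    "\<And>X. X \<in> compressed_commutant r V S \<Longrightarrow> H X \<in> commutant n S"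
    "\<And>X. X \<in> compressed_commutant r V S \<Longrightarrow> H X * V = V * X"
    "\<And>X Y. X \<in> compressed_commutant r V S \<Longrightarrow> Y \<in> compressed_commutant r V S \<Longrightarrow> H (X + Y) = H X + H Y"
    "\<And>X Y. X \<in> compressed_commutant r V S \<Longrightarrow> Y \<in> compressed_commutant r V S \<Longrightarrow> H (X * Y) = H X * H Y"
    "\<And>c X. X \<in> compressed_commutant r V S \<Longrightarrow> H (c \<cdot>\<^sub>m X) = c \<cdot>\<^sub>m H X"
    "\<And>X. X \<in> compressed_commutant r V S \<Longrightarrow> H (X\<^sup>\<dagger>) = (H X)\<^sup>\<dagger>"
proof -
  let ?C = "compressed_commutant r V S"
  have SC: "Z \<in> carrier_mat n n" if "Z \<in> S" for Z
    using alg that by (auto simp: unital_star_subalgebra_def star_subalgebra_def submodule_def)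
  have S_dim [simp]: "dim_row Z = n" "dim_col Z = n" if "Z \<in> S" for Z using SC[OF that] by auto
  have [simp]: "dim_row V = n" "dim_col V = r" using V by auto
  have S_mult: "X * Y \<in> S" and S_adj: "X\<^sup>\<dagger> \<in> S" if "X \<in> S" "Y \<in> S" for X Y
    using alg that by (auto simp: unital_star_subalgebra_def star_subalgebra_def)
  have one: "1\<^sub>m n \<in> S" using alg by (auto simp: unital_star_subalgebra_def)
  have gen: "(K i)\<^sup>\<dagger> * K j \<in> S" if "i < k" "j < k" for i j
    using kraus_generator_in_span[of k K m n i j] K that S by auto
  \<comment> \<open>The generators of S followed by V: the span of this finite family consists of
    all \<open>Z * V\<close> with Z in S.\<close>
  define T where "T = (\<lambda>(i, j). (K i)\<^sup>\<dagger> * K j * V)"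
  have T_eq: "T (i, j) = (K i)\<^sup>\<dagger> * K j * V" for i j by (simp add: T_def)
  have T_form: "\<exists>Z\<in>S. T x = Z * V" if "x \<in> {..<k} \<times> {..<k}" for x
    using that gen by (auto simp: T_def)
  interpret G: operator_family n r "{..<k} \<times> {..<k}" T
    by unfold_locales (use T_form in \<open>force intro!: carrier_matI\<close>)+
  have C_dim [simp]: "dim_row X = r" "dim_col X = r" if "X \<in> ?C" for X
    using that by (auto simp: compressed_commutant_def)
  have comm: "X \<in> G.commuting" if X: "X \<in> ?C" for X
    unfolding G.commuting_def
  proof (intro CollectI conjI ballI)
    fix x y assume "x \<in> {..<k} \<times> {..<k}" "y \<in> {..<k} \<times> {..<k}"
    then obtain Y Z where YZ: "Y \<in> S" "Z \<in> S" "T x = Y * V" "T y = Z * V" using T_form by blast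
    \<comment> \<open>Closure of S under adjoints and products makes this again a compression of an
      element of S, with which X commutes.\<close>
    have "(T x)\<^sup>\<dagger> * T y = V\<^sup>\<dagger> * (Y\<^sup>\<dagger> * Z * V)" using YZ by (simp add: adj_mult mat_assoc)
    moreover have "Y\<^sup>\<dagger> * Z \<in> S" using YZ S_mult S_adj by blast
    ultimately show "(T x)\<^sup>\<dagger> * T y * X = X * ((T x)\<^sup>\<dagger> * T y)"
      using X by (simp add: compressed_commutant_def)
  qed (use X in \<open>simp add: compressed_commutant_def\<close>)
  have C_adj: "X\<^sup>\<dagger> \<in> ?C" if X: "X \<in> ?C" for X
    unfolding compressed_commutant_def
  proof (intro CollectI conjI ballI)
    fix Z assume Z: "Z \<in> S"
    have "V\<^sup>\<dagger> * (Z\<^sup>\<dagger> * V) * X = X * (V\<^sup>\<dagger> * (Z\<^sup>\<dagger> * V))"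
      using X S_adj[OF Z Z] by (simp add: compressed_commutant_def)
    then have "(V\<^sup>\<dagger> * (Z\<^sup>\<dagger> * V) * X)\<^sup>\<dagger> = (X * (V\<^sup>\<dagger> * (Z\<^sup>\<dagger> * V)))\<^sup>\<dagger>" by simp
    then show "V\<^sup>\<dagger> * (Z * V) * X\<^sup>\<dagger> = X\<^sup>\<dagger> * (V\<^sup>\<dagger> * (Z * V))"
      using X Z by (simp add: adj_mult mat_assoc)
  qed (use X in \<open>auto simp: compressed_commutant_def\<close>)
  \<comment> \<open>The intertwining relation is known on the generators and extends linearly to
    S.\<close>
  have lift_S: "G.lift X * (Z * V) = Z * V * X" if X: "X \<in> ?C" and Z: "Z \<in> S" for X Z
    using Z[unfolded S]
  proof (rule kraus_span_induct[OF _ K])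
    fix i j assume "i < k" "j < k"
    then show "G.lift X * ((K i)\<^sup>\<dagger> * K j * V) = (K i)\<^sup>\<dagger> * K j * V * X"
      using G.lift_T[OF comm[OF X], of "(i, j)"] by (simp add: T_eq)
  next
    show "G.lift X * (0\<^sub>m n n * V) = 0\<^sub>m n n * V * X" using X by (auto intro!: eq_matI)
  next
    fix Y Z :: "complex mat" assume "Y \<in> carrier_mat n n" "Z \<in> carrier_mat n n"
      and *: "G.lift X * (Y * V) = Y * V * X" "G.lift X * (Z * V) = Z * V * X"
    then have [simp]: "dim_row Y = n" "dim_col Y = n" "dim_row Z = n" "dim_col Z = n" by auto
    show "G.lift X * ((Y + Z) * V) = (Y + Z) * V * X"
      using X by (simp add: mat_add_left mat_add_right *)
  next
    fix c and Y :: "complex mat" assume "Y \<in> carrier_mat n n" and *: "G.lift X * (Y * V) = Y * V * X"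
    then have [simp]: "dim_row Y = n" "dim_col Y = n" by auto
    show "G.lift X * (c \<cdot>\<^sub>m Y * V) = c \<cdot>\<^sub>m Y * V * X"
      using X by (simp add: mat_smult_left mat_smult_right *)
  qed
  \<comment> \<open>For Y in S the operator \<open>Y * T x\<close> is again of the form
    \<open>Z * V\<close> with Z in S. This is the invariance of the joint range, for Y and for its
    adjoint, that commutation with Y requires.\<close>
  have lift_ST: "G.lift X * (Y * T x) = Y * (T x * X)" if X: "X \<in> ?C" and Y: "Y \<in> S" and x: "x \<in> {..<k} \<times> {..<k}"
    for X Y x
  proof -
    obtain Z where Z: "Z \<in> S" "T x = Z * V" using T_form[OF x] by blast
    show ?thesis using lift_S[OF X S_mult[OF Y Z(1)]] X Y Z by (simp add: mat_assoc)
  qed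
  show ?thesis
  proof (rule that[of G.lift])
    show "G.lift X \<in> commutant n S" if X: "X \<in> ?C" for X
      unfolding commutant_def
    proof (intro CollectI conjI ballI)
      fix Y assume Y: "Y \<in> S"
      show "G.lift X * Y = Y * G.lift X"
        by (rule G.lift_commute[OF comm[OF X] SC[OF Y] lift_ST[OF X Y] lift_ST[OF C_adj[OF X] S_adj[OF Y Y]]])
    qed (auto intro!: carrier_matI)
    \<comment> \<open>Here the identity of S is taken as Z.\<close>
    show "G.lift X * V = V * X" if "X \<in> ?C" for X
      using lift_S[OF that one] by (simp add: mat_one_left)
    show "G.lift (X + Y) = G.lift X + G.lift Y" if "X \<in> ?C" "Y \<in> ?C" for X Y
      using that by (intro G.lift_add) (auto simp: compressed_commutant_def)
    show "G.lift (X * Y) = G.lift X * G.lift Y" if "X \<in> ?C" "Y \<in> ?C" for X Y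
      by (rule G.lift_mult[OF comm comm]) (fact that)+
    show "G.lift (c \<cdot>\<^sub>m X) = c \<cdot>\<^sub>m G.lift X" if "X \<in> ?C" for c X
      using that by (intro G.lift_smult) (auto simp: compressed_commutant_def)
    show "G.lift (X\<^sup>\<dagger>) = (G.lift X)\<^sup>\<dagger>" if "X \<in> ?C" for X
      using that by (intro G.lift_adj) (auto simp: compressed_commutant_def)
  qed
qed

text \<open>Let \<open>L\<^sub>a\<close> be Kraus operators of the recovery D. The corrected channel
  on the subspace has Kraus operators \<open>L\<^sub>a K\<^sub>j V\<close>, and its dual fixes the
  compressed algebra, so these operators and their adjoints commute with that algebra. Since the
  \<open>L\<^sub>a\<^sup>\<dagger> L\<^sub>a\<close> sum to 1, the compressed products
  \<open>V\<^sup>\<dagger> K\<^sub>i\<^sup>\<dagger> K\<^sub>j V\<close> are sums of products of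
  such operators and inherit the commutation.\<close>

lemma correctable_compression_commutes:
  assumes ch: "channel n m \<Phi>" and kr: "kraus_rep n m \<Phi> k K" and A: "star_subalgebra n A"
    and P: "\<And>X. X \<in> A \<Longrightarrow> P * X = X" and V: "V \<in> carrier_mat n r" "V\<^sup>\<dagger> * V = 1\<^sub>m r" "V * V\<^sup>\<dagger> = P"
    and D: "channel m r D"
    and fixed: "\<And>X. X \<in> A \<Longrightarrow> adjoint_map r r (D \<circ> compression V \<Phi>) (V\<^sup>\<dagger> * X * V) = V\<^sup>\<dagger> * X * V"
    and X: "X \<in> A"
  shows "V\<^sup>\<dagger> * X * V \<in> compressed_commutant r V (kraus_span n k K)"
proof -
  have AC: "X \<in> carrier_mat n n" if "X \<in> A" for X
    using A that by (auto simp: star_subalgebra_def submodule_def)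
  have A_dim [simp]: "dim_row X = n" "dim_col X = n" if "X \<in> A" for X using AC[OF that] by auto
  have [simp]: "dim_row V = n" "dim_col V = r" using V by auto
  have K: "K i \<in> carrier_mat m n" if "i < k" for i using kr that by (auto simp: kraus_rep_iff)
  have [simp]: "dim_row (K i) = m" "dim_col (K i) = n" if "i < k" for i using K[OF that] by auto
  have \<Phi>: "\<Phi> Y = kraus_map m K {..<k} Y" if "Y \<in> carrier_mat n n" for Y using kr that by (auto simp: kraus_rep_iff)
  obtain l L where Lr: "kraus_rep m r D l L" using channel_has_kraus_rep[OF D] .
  have L: "L a \<in> carrier_mat r m" if "a < l" for a using Lr that by (auto simp: kraus_rep_iff)
  have [simp]: "dim_row (L a) = r" "dim_col (L a) = m" if "a < l" for a using L[OF that] by auto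
  have LL: "mat_sum m m (\<lambda>a. (L a)\<^sup>\<dagger> * L a) {..<l} = 1\<^sub>m m" by (rule kraus_rep_unital[OF D Lr])
  define N where "N = (\<lambda>(a, j). L a * (K j * V))"
  define J where "J = {..<l} \<times> {..<k}"
  have N: "N x \<in> carrier_mat r r" if "x \<in> J" for x using that by (auto simp: N_def J_def intro!: carrier_matI)
  have E: "(D \<circ> compression V \<Phi>) Y = kraus_map r N J Y" if Y: "Y \<in> carrier_mat r r" for Y
  proof -
    have [simp]: "dim_row Y = r" "dim_col Y = r" using Y by auto
    have "compression V \<Phi> Y = kraus_map m K {..<k} (V * Y * V\<^sup>\<dagger>)"
      unfolding compression_def by (rule \<Phi>) (auto intro!: carrier_matI)
    also have "\<dots> = kraus_map m (\<lambda>j. K j * V) {..<k} Y"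
      unfolding kraus_map_def by (intro mat_sum_cong refl) (simp add: adj_mult mat_assoc)
    finally have "(D \<circ> compression V \<Phi>) Y = kraus_map r L {..<l} (kraus_map m (\<lambda>j. K j * V) {..<k} Y)"
      using Lr by (auto simp: kraus_rep_iff kraus_map_def)
    also have "\<dots> = kraus_map r N J Y"
      unfolding N_def J_def by (rule kraus_map_comp[OF _ _ L _ Y]) (auto intro!: carrier_matI)
    finally show ?thesis .
  qed
  have "mat_trace (kraus_map r N J Y) = mat_trace Y" if Y: "Y \<in> carrier_mat r r" for Y
  proof -
    have [simp]: "dim_row Y = r" "dim_col Y = r" using Y by auto
    have VYV: "V * Y * V\<^sup>\<dagger> \<in> carrier_mat n n" by (auto intro!: carrier_matI)
    then have "\<Phi> (V * Y * V\<^sup>\<dagger>) \<in> carrier_mat m m" using \<Phi> by (simp add: kraus_map_def)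
    then have "mat_trace (kraus_map r N J Y) = mat_trace (V * Y * V\<^sup>\<dagger>)"
      using E[OF Y] D ch VYV unfolding channel_def comp_apply compression_def by metis
    also have "\<dots> = mat_trace (V\<^sup>\<dagger> * (V * Y))"
      by (rule mat_trace_mult_comm[of _ n r]) (auto intro!: carrier_matI)
    also have "V\<^sup>\<dagger> * (V * Y) = V\<^sup>\<dagger> * V * Y" by (simp add: mat_assoc)
    finally show ?thesis by (simp add: V(2) mat_one_left)
  qed
  then have NN: "mat_sum r r (\<lambda>x. (N x)\<^sup>\<dagger> * N x) J = 1\<^sub>m r"
    using kraus_trace_preserving_iff[of J N r r, OF N] by simp
  have fix_N: "mat_sum r r (\<lambda>x. (N x)\<^sup>\<dagger> * (V\<^sup>\<dagger> * X * V * N x)) J = V\<^sup>\<dagger> * X * V" if "X \<in> A" for X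
  proof -
    have "V\<^sup>\<dagger> * X * V \<in> carrier_mat r r" by (auto intro!: carrier_matI)
    then have "adjoint_map r r (D \<circ> compression V \<Phi>) (V\<^sup>\<dagger> * X * V)
        = mat_sum r r (\<lambda>x. (N x)\<^sup>\<dagger> * (V\<^sup>\<dagger> * X * V * N x)) J"
      using N E by (intro adjoint_map_kraus)
    then show ?thesis using fixed[OF that] by simp
  qed
  have comm_N: "N x * (V\<^sup>\<dagger> * X * V) = V\<^sup>\<dagger> * X * V * N x" if X: "X \<in> A" and x: "x \<in> J" for X x
  proof (rule kraus_operators_commute_with_fixed[OF _ N _ NN fix_N[OF X] _ _ x])
    have X': "X\<^sup>\<dagger> \<in> A" and X'X: "X\<^sup>\<dagger> * X \<in> A" using A X by (auto simp: star_subalgebra_def)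
    have 1: "(V\<^sup>\<dagger> * X * V)\<^sup>\<dagger> = V\<^sup>\<dagger> * X\<^sup>\<dagger> * V" using X by (simp add: adj_mult mat_assoc)
    \<comment> \<open>Compression is multiplicative on A because
      \<open>V * V\<^sup>\<dagger>\<close> is the unit of A; so the product to which the fixed-point
      argument applies is again a compressed element.\<close>
    have "V\<^sup>\<dagger> * X\<^sup>\<dagger> * V * (V\<^sup>\<dagger> * X * V) = V\<^sup>\<dagger> * (X\<^sup>\<dagger> * (V * V\<^sup>\<dagger> * X * V))" using X by (simp add: mat_assoc)
    also have "\<dots> = V\<^sup>\<dagger> * (X\<^sup>\<dagger> * X) * V" using X by (simp add: V(3) P mat_assoc)
    finally have 2: "(V\<^sup>\<dagger> * X * V)\<^sup>\<dagger> * (V\<^sup>\<dagger> * X * V) = V\<^sup>\<dagger> * (X\<^sup>\<dagger> * X) * V" by (simp add: 1)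
    show "mat_sum r r (\<lambda>x. (N x)\<^sup>\<dagger> * ((V\<^sup>\<dagger> * X * V)\<^sup>\<dagger> * N x)) J = (V\<^sup>\<dagger> * X * V)\<^sup>\<dagger>"
      unfolding 1 by (rule fix_N[OF X'])
    show "mat_sum r r (\<lambda>x. (N x)\<^sup>\<dagger> * ((V\<^sup>\<dagger> * X * V)\<^sup>\<dagger> * (V\<^sup>\<dagger> * X * V) * N x)) J = (V\<^sup>\<dagger> * X * V)\<^sup>\<dagger> * (V\<^sup>\<dagger> * X * V)"
      unfolding 2 by (rule fix_N[OF X'X])
  qed (use X in \<open>auto simp: J_def intro!: carrier_matI\<close>)
  define Y where "Y = V\<^sup>\<dagger> * X * V"
  have [simp]: "dim_row Y = r" "dim_col Y = r" by (simp_all add: Y_def)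
  have comm1: "N x * Y = Y * N x" if "x \<in> J" for x using comm_N[OF X that] by (simp add: Y_def)
  have comm2: "(N x)\<^sup>\<dagger> * Y = Y * (N x)\<^sup>\<dagger>" if "x \<in> J" for x
  proof -
    have X': "X\<^sup>\<dagger> \<in> A" using A X by (auto simp: star_subalgebra_def)
    have "V\<^sup>\<dagger> * X\<^sup>\<dagger> * V = Y\<^sup>\<dagger>" using X by (simp add: Y_def adj_mult mat_assoc)
    then have "(N x * Y\<^sup>\<dagger>)\<^sup>\<dagger> = (Y\<^sup>\<dagger> * N x)\<^sup>\<dagger>" using comm_N[OF X' that] by simp
    then show ?thesis using N[OF that] by (simp add: adj_mult)
  qed
  have gen: "V\<^sup>\<dagger> * ((K i)\<^sup>\<dagger> * K j * V) * Y = Y * (V\<^sup>\<dagger> * ((K i)\<^sup>\<dagger> * K j * V))" if ij: "i < k" "j < k" for i j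
  proof -
    have NJ: "N (a, i) \<in> carrier_mat r r" "N (a, j) \<in> carrier_mat r r" if "a < l" for a
      using N ij that by (auto simp: J_def)
    then have dN [simp]: "dim_row (N (a, i)) = r" "dim_col (N (a, i)) = r"
      "dim_row (N (a, j)) = r" "dim_col (N (a, j)) = r" if "a < l" for a using that by auto
    \<comment> \<open>The identity is inserted between the two Kraus factors as the sum of
      \<open>(L a)\<^sup>\<dagger> * L a\<close>, which eliminates the recovery channel from the
      conclusion.\<close>
    have "V\<^sup>\<dagger> * ((K i)\<^sup>\<dagger> * K j * V) = (K i * V)\<^sup>\<dagger> * (mat_sum m m (\<lambda>a. (L a)\<^sup>\<dagger> * L a) {..<l} * (K j * V))"
      using ij by (simp add: LL mat_one_left adj_mult mat_assoc)
    also have "\<dots> = mat_sum r r (\<lambda>a. (K i * V)\<^sup>\<dagger> * ((L a)\<^sup>\<dagger> * L a * (K j * V))) {..<l}"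
      using ij
      by (subst mat_sum_mult_right, auto intro!: carrier_matI, subst mat_sum_mult_left, auto intro!: carrier_matI)
    also have "\<dots> = mat_sum r r (\<lambda>a. (N (a, i))\<^sup>\<dagger> * N (a, j)) {..<l}"
      using ij by (intro mat_sum_cong refl) (simp add: N_def adj_mult mat_assoc)
    finally have *: "V\<^sup>\<dagger> * ((K i)\<^sup>\<dagger> * K j * V) = mat_sum r r (\<lambda>a. (N (a, i))\<^sup>\<dagger> * N (a, j)) {..<l}" .
    have "mat_sum r r (\<lambda>a. (N (a, i))\<^sup>\<dagger> * N (a, j)) {..<l} * Y
        = mat_sum r r (\<lambda>a. (N (a, i))\<^sup>\<dagger> * N (a, j) * Y) {..<l}"
      by (subst mat_sum_mult_right) (auto intro!: carrier_matI)
    also have "\<dots> = mat_sum r r (\<lambda>a. Y * ((N (a, i))\<^sup>\<dagger> * N (a, j))) {..<l}"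
    proof (rule mat_sum_cong[OF refl])
      fix a assume "a \<in> {..<l}"
      then have a: "a < l" by simp
      then have J: "(a, i) \<in> J" "(a, j) \<in> J" using ij by (auto simp: J_def)
      have "(N (a, i))\<^sup>\<dagger> * N (a, j) * Y = (N (a, i))\<^sup>\<dagger> * Y * N (a, j)"
        using a by (simp add: mat_assoc comm1[OF J(2)])
      then show "(N (a, i))\<^sup>\<dagger> * N (a, j) * Y = Y * ((N (a, i))\<^sup>\<dagger> * N (a, j))"
        unfolding comm2[OF J(1)] using a by (simp add: mat_assoc)
    qed
    also have "\<dots> = Y * mat_sum r r (\<lambda>a. (N (a, i))\<^sup>\<dagger> * N (a, j)) {..<l}"
      by (subst mat_sum_mult_left) (auto intro!: carrier_matI)
    finally show ?thesis unfolding * .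
  qed
  have "V\<^sup>\<dagger> * (Z * V) * Y = Y * (V\<^sup>\<dagger> * (Z * V))" if "Z \<in> kraus_span n k K" for Z
    using that
  proof (rule kraus_span_induct[OF _ K])
    show "V\<^sup>\<dagger> * (0\<^sub>m n n * V) * Y = Y * (V\<^sup>\<dagger> * (0\<^sub>m n n * V))" by (auto intro!: eq_matI)
  next
    fix W Z :: "complex mat" assume "W \<in> carrier_mat n n" "Z \<in> carrier_mat n n"
      and *: "V\<^sup>\<dagger> * (W * V) * Y = Y * (V\<^sup>\<dagger> * (W * V))" "V\<^sup>\<dagger> * (Z * V) * Y = Y * (V\<^sup>\<dagger> * (Z * V))"
    then have [simp]: "dim_row W = n" "dim_col W = n" "dim_row Z = n" "dim_col Z = n" by auto
    show "V\<^sup>\<dagger> * ((W + Z) * V) * Y = Y * (V\<^sup>\<dagger> * ((W + Z) * V))"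
      by (simp add: mat_add_left mat_add_right *)
  next
    fix c and Z :: "complex mat" assume "Z \<in> carrier_mat n n"
      and *: "V\<^sup>\<dagger> * (Z * V) * Y = Y * (V\<^sup>\<dagger> * (Z * V))"
    then have [simp]: "dim_row Z = n" "dim_col Z = n" by auto
    show "V\<^sup>\<dagger> * (c \<cdot>\<^sub>m Z * V) * Y = Y * (V\<^sup>\<dagger> * (c \<cdot>\<^sub>m Z * V))"
      by (simp add: mat_smult_left mat_smult_right *)
  qed (assumption | rule gen)+
  then show ?thesis by (auto simp: compressed_commutant_def Y_def intro!: carrier_matI)
qed

text \<open>The embedding is the composite of the transmission map, compression by V and the lift.
  It is injective because the lift followed by cutting down to the range of V returns the original
  operator.\<close>

lemma transmittable_embeds_commutant:
  assumes ch: "channel n m \<Phi>" and kr: "kraus_rep n m \<Phi> k K"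
    and alg: "unital_star_subalgebra n (kraus_span n k K)" and tr: "transmittable n m \<Phi> B"
  shows "star_embeds B (commutant_algebra n (kraus_span n k K))"
proof -
  let ?S = "kraus_span n k K"
  obtain \<pi> where \<pi>: "\<pi> \<in> star_hom B (op_algebra n)" "inj_on \<pi> (carrier B)"
    and cor: "correctable n m \<Phi> (\<pi> ` carrier B)"
    using tr by (auto simp: transmittable_def)
  then obtain P r V D where A: "star_subalgebra n (\<pi> ` carrier B)"
    and P: "\<And>X. X \<in> \<pi> ` carrier B \<Longrightarrow> P * X = X" "\<And>X. X \<in> \<pi> ` carrier B \<Longrightarrow> X * P = X"
    and V: "V \<in> carrier_mat n r" "V\<^sup>\<dagger> * V = 1\<^sub>m r" "V * V\<^sup>\<dagger> = P"
    and D: "channel m r D"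
    and fixed: "\<And>X. X \<in> \<pi> ` carrier B \<Longrightarrow> adjoint_map r r (D \<circ> compression V \<Phi>) (V\<^sup>\<dagger> * X * V) = V\<^sup>\<dagger> * X * V"
    unfolding correctable_def by blast
  have K: "K i \<in> carrier_mat m n" if "i < k" for i using kr that by (auto simp: kraus_rep_iff)
  have \<pi>_carrier: "\<pi> x \<in> carrier_mat n n" if "x \<in> carrier B" for x
    using \<pi>(1) that by (auto simp: star_hom_def LinearCombinations.module_hom_def)
  have \<pi>_dim [simp]: "dim_row (\<pi> x) = n" "dim_col (\<pi> x) = n" if "x \<in> carrier B" for x
    using \<pi>_carrier[OF that] by auto
  have [simp]: "dim_row V = n" "dim_col V = r" using V by auto
  define c where "c x = V\<^sup>\<dagger> * \<pi> x * V" for x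
  have c_dim [simp]: "dim_row (c x) = r" "dim_col (c x) = r" for x by (simp_all add: c_def)
  have c: "c x \<in> compressed_commutant r V ?S" if "x \<in> carrier B" for x
    unfolding c_def
    by (rule correctable_compression_commutes[OF ch kr A P(1) V D fixed]) (use that in auto)
  obtain H where H: "\<And>X. X \<in> compressed_commutant r V ?S \<Longrightarrow> H X \<in> commutant n ?S"
    "\<And>X. X \<in> compressed_commutant r V ?S \<Longrightarrow> H X * V = V * X"
    "\<And>X Y. X \<in> compressed_commutant r V ?S \<Longrightarrow> Y \<in> compressed_commutant r V ?S \<Longrightarrow> H (X + Y) = H X + H Y"
    "\<And>X Y. X \<in> compressed_commutant r V ?S \<Longrightarrow> Y \<in> compressed_commutant r V ?S \<Longrightarrow> H (X * Y) = H X * H Y"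
    "\<And>c X. X \<in> compressed_commutant r V ?S \<Longrightarrow> H (c \<cdot>\<^sub>m X) = c \<cdot>\<^sub>m H X"
    "\<And>X. X \<in> compressed_commutant r V ?S \<Longrightarrow> H (X\<^sup>\<dagger>) = (H X)\<^sup>\<dagger>"
    by (rule commutant_lifting[OF K refl alg V(1)]) blast+
  have c_add: "c (x \<oplus>\<^bsub>B\<^esub> y) = c x + c y" if "x \<in> carrier B" "y \<in> carrier B" for x y
  proof -
    have "\<pi> (x \<oplus>\<^bsub>B\<^esub> y) = \<pi> x + \<pi> y" using \<pi>(1) that by (auto simp: star_hom_def LinearCombinations.module_hom_def)
    then show ?thesis using that by (simp add: c_def mat_add_left mat_add_right)
  qed
  have c_smult: "c (a \<odot>\<^bsub>B\<^esub> x) = a \<cdot>\<^sub>m c x" if "x \<in> carrier B" for a x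
  proof -
    have "\<pi> (a \<odot>\<^bsub>B\<^esub> x) = a \<cdot>\<^sub>m \<pi> x"
      using \<pi>(1) that by (auto simp: star_hom_def LinearCombinations.module_hom_def class_ring_simps)
    then show ?thesis using that by (simp add: c_def mat_smult_left mat_smult_right)
  qed
  have c_mult: "c (x \<otimes>\<^bsub>B\<^esub> y) = c x * c y" if "x \<in> carrier B" "y \<in> carrier B" for x y
  proof -
    have \<pi>_mult: "\<pi> (x \<otimes>\<^bsub>B\<^esub> y) = \<pi> x * \<pi> y" using \<pi>(1) that by (auto simp: star_hom_def hom_def)
    have "c x * c y = V\<^sup>\<dagger> * (\<pi> x * ((V * V\<^sup>\<dagger>) * \<pi> y * V))" using that by (simp add: c_def mat_assoc)
    also have "\<dots> = c (x \<otimes>\<^bsub>B\<^esub> y)" using that by (simp add: V(3) P(1) \<pi>_mult c_def mat_assoc)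
    finally show ?thesis ..
  qed
  have c_star: "c (star B x) = (c x)\<^sup>\<dagger>" if "x \<in> carrier B" for x
  proof -
    have "\<pi> (star B x) = (\<pi> x)\<^sup>\<dagger>" using \<pi>(1) that by (auto simp: star_hom_def)
    then show ?thesis using that by (simp add: c_def adj_mult mat_assoc)
  qed
  have "(\<lambda>x. H (c x)) \<in> star_hom B (commutant_algebra n ?S)"
    using c
    by (auto simp: star_hom_def LinearCombinations.module_hom_def hom_def commutant_algebra_def
        c_add c_smult c_mult c_star H class_ring_simps)
  moreover have "inj_on (\<lambda>x. H (c x)) (carrier B)"
  proof (rule inj_onI)
    \<comment> \<open>The relation between H and V turns the left side into
      \<open>P * \<pi> x * P\<close>, and P is the unit of the image.\<close>
    have recover: "H (c x) * V * V\<^sup>\<dagger> = \<pi> x" if "x \<in> carrier B" for x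
    proof -
      have "H (c x) * V * V\<^sup>\<dagger> = V * V\<^sup>\<dagger> * \<pi> x * (V * V\<^sup>\<dagger>)"
        using that H(2)[OF c[OF that]] by (simp add: c_def mat_assoc)
      then show ?thesis using that by (simp add: V(3) P)
    qed
    fix x y assume xy: "x \<in> carrier B" "y \<in> carrier B" and "H (c x) = H (c y)"
    then have "\<pi> x = \<pi> y" using recover[OF xy(1)] recover[OF xy(2)] by simp
    then show "x = y" using \<pi>(2) xy by (auto dest: inj_onD)
  qed
  ultimately show ?thesis by (auto simp: star_embeds_def)
qed

section \<open>The dominating algebra\<close>

lemma operator_system_kraus:
  assumes "channel n m \<Phi>"
  obtains k K where "kraus_rep n m \<Phi> k K" "operator_system n m \<Phi> = kraus_span n k K"
proof -
  have "\<exists>S k K. kraus_rep n m \<Phi> k K \<and> S = kraus_span n k K"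
    using channel_has_kraus_rep[OF assms] by metis
  then have "\<exists>k K. kraus_rep n m \<Phi> k K \<and> operator_system n m \<Phi> = kraus_span n k K"
    unfolding operator_system_def by (rule someI_ex)
  then show ?thesis using that by blast
qed

theorem theorem4p15:
  fixes n m :: nat and \<Phi> :: "complex mat \<Rightarrow> complex mat"
  assumes "0 < n"
    and "channel n m \<Phi>"
    and "unital_star_subalgebra n (operator_system n m \<Phi>)"
  shows "(\<exists>A :: complex mat star_algebra.
            dominating_transmittable TYPE('b) n m \<Phi> A \<and>
            star_isomorphic A (commutant_algebra n (operator_system n m \<Phi>))) \<and>
         (\<forall>A :: 'a star_algebra.
            dominating_transmittable TYPE(complex mat) n m \<Phi> A \<longrightarrow>
            star_isomorphic A (commutant_algebra n (operator_system n m \<Phi>)))"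
proof -
  let ?C = "commutant_algebra n (operator_system n m \<Phi>)"
  obtain k K where kr: "kraus_rep n m \<Phi> k K" and S: "operator_system n m \<Phi> = kraus_span n k K"
    using operator_system_kraus[OF assms(2)] .
  have alg: "unital_star_subalgebra n (kraus_span n k K)" "star_subalgebra n (kraus_span n k K)"
    using assms(3) by (auto simp: S unital_star_subalgebra_def)
  have fd: "fd_cstar_algebra ?C" unfolding S by (rule fd_cstar_algebra_commutant[OF assms(1) alg(2)])
  have "(\<lambda>x. x) \<in> star_hom ?C (op_algebra n)"
    by (auto simp: star_hom_def LinearCombinations.module_hom_def hom_def commutant_algebra_def commutant_def)
  moreover have "correctable n m \<Phi> ((\<lambda>x. x) ` carrier ?C)"
    using correctable_commutant[OF assms(1,2) kr alg(2)] by (simp add: S commutant_algebra_def)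
  ultimately have tr: "transmittable n m \<Phi> ?C"
    using fd unfolding transmittable_def by (intro conjI bexI[of _ "\<lambda>x. x"]) auto
  \<comment> \<open>The type variables \<open>'a\<close> and \<open>'b\<close> are fixed inside the
    proof, so the embedding is stated once for each.\<close>
  have emb1: "star_embeds B ?C" if "transmittable n m \<Phi> B" for B :: "'b star_algebra"
    unfolding S by (rule transmittable_embeds_commutant[OF assms(2) kr alg(1) that])
  have emb2: "star_embeds A ?C" if "transmittable n m \<Phi> A" for A :: "'a star_algebra"
    unfolding S by (rule transmittable_embeds_commutant[OF assms(2) kr alg(1) that])
  have "dominating_transmittable TYPE('b) n m \<Phi> ?C"
    using tr emb1 by (simp add: dominating_transmittable_def)
  moreover have "star_isomorphic ?C ?C"
    unfolding star_isomorphic_def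
    by (rule bexI[of _ "\<lambda>x. x"])
      (auto simp: star_hom_def LinearCombinations.module_hom_def hom_def bij_betw_def)
  \<comment> \<open>With the dominated algebras ranging over \<open>complex mat\<close>, the
    commutant is one of them and embeds into A; A embeds into the commutant because it is
    transmittable.\<close>
  moreover have "star_isomorphic A ?C" if "dominating_transmittable TYPE(complex mat) n m \<Phi> A" for A :: "'a star_algebra"
  proof (rule star_isomorphic_if_mutual_embeddings)
    have trA: "transmittable n m \<Phi> A" using that by (simp add: dominating_transmittable_def)
    then show "star_algebra A" by (simp add: transmittable_def fd_cstar_algebra_def)
    show "star_algebra ?C" "vectorspace.fin_dim class_ring ?C" using fd by (simp_all add: fd_cstar_algebra_def)
    show "star_embeds A ?C" by (rule emb2[OF trA])
    show "star_embeds ?C A" using that tr by (simp add: dominating_transmittable_def)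
  qed
  ultimately show ?thesis by blast
qed

end
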